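(* Let $e\in\mathbb{R}^3$ be a unit vector, $\overline{e}:=-e$, and let $t_1,t_2\in\mathbb{R}$. Then there is a Dirac wavefunction $\psi\in L^2(\mathbb{R}^3,\mathbb{C}^4)$, $\psi\neq0$, localized in a bounded region, with $t_e(\psi)=t_1$ and $t_{\overline{e}}(\psi)=t_2$.
   Context: Fix a mass $m>0$ and Dirac matrices $\alpha_1,\alpha_2,\alpha_3,\beta$: Hermitian $4\times4$ complex matrices with $\alpha_j\alpha_k+\alpha_k\alpha_j=2\delta_{jk}I_4$, $\alpha_k\beta+\beta\alpha_k=0$, $\beta^2=I_4$. The free Dirac operator is the self-adjoint operator $H=\sum_{k=1}^3\alpha_k\frac{1}{\mathrm{i}}\partial_k+\beta m$ in $L^2(\mathbb{R}^3,\mathbb{C}^4)$ (equivalently $H=\mathcal{F}^{-1}h\mathcal{F}$, where $\mathcal{F}$ is the unitary Fourier transform and $h$ denotes multiplication by $h(p)=\sum_k\alpha_kp_k+\beta m$). A Dirac wavefunction is an element of $L^2(\mathbb{R}^3,\mathbb{C}^4)$. For a Dirac wavefunction $\psi$ and $t\in\mathbb{R}$ put $\psi_t:=\mathrm{e}^{\mathrm{i}tH}\psi$. A region is a measurable subset $\Delta\subset\mathbb{R}^3$; $\psi$ is localized in $\Delta$ if $1_\Delta\psi=\psi$ a.e. For $x,y\in\mathbb{R}^3$, $xy:=\sum_kx_ky_k$. For a unit vector $e\in\mathbb{R}^3$ and $\psi\neq0$, $e(\psi)\in[-\infty,\infty]$ denotes the maximal $\alpha\in[-\infty,\infty]$ such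 that $1_{\{x\in\mathbb{R}^3:\,xe\le\alpha\}}\psi=0$ a.e. For $\psi\ne0$ localized in a bounded region and a unit vector $e$, $t_e(\psi)\in\mathbb{R}$ denotes the unique real number such that $e(\psi_t)=e(\psi)+|t_e(\psi)|-|t-t_e(\psi)|$ for all $t\in\mathbb{R}$ (such a number exists and is unique); $t_{\overline{e}}(\psi)$ is the same quantity for the unit vector $\overline{e}=-e$. *)

theory Defs
  imports "HOL-Analysis.Analysis"
begin

section \<open>Dirac matrices\<close>

definition hermitian :: "complex^4^4 \<Rightarrow> bool" where
  "hermitian A \<longleftrightarrow> (\<forall>i j. A $ i $ j = cnj (A $ j $ i))"

definition dirac_matrices :: "(3 \<Rightarrow> complex^4^4) \<Rightarrow> complex^4^4 \<Rightarrow> bool" where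
  "dirac_matrices \<alpha> \<beta> \<longleftrightarrow>
     (\<forall>k. hermitian (\<alpha> k)) \<and> hermitian \<beta> \<and>
     (\<forall>j k. \<alpha> j ** \<alpha> k + \<alpha> k ** \<alpha> j = (if j = k then 2 *\<^sub>R mat 1 else 0)) \<and>
     (\<forall>k. \<alpha> k ** \<beta> + \<beta> ** \<alpha> k = 0) \<and>
     \<beta> ** \<beta> = mat 1"

section \<open>Wavefunctions\<close>

text \<open>
  Elements of \<open>L\<^sup>2(\<real>\<^sup>3, \<complex>\<^sup>4)\<close> are represented by Borel functions (every class of Lebesgue
  measurable functions modulo null sets contains one); equality in \<open>L\<^sup>2\<close> is equality almost
  everywhere.  Likewise regions are Borel sets, which is no restriction modulo null sets.
\<close>

definition dirac_wavefunction :: "(real^3 \<Rightarrow> complex^4) \<Rightarrow> bool" where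
  "dirac_wavefunction \<psi> \<longleftrightarrow>
     \<psi> \<in> borel_measurable lborel \<and> integrable lborel (\<lambda>x. (norm (\<psi> x))\<^sup>2)"

definition eq_ae :: "(real^3 \<Rightarrow> complex^4) \<Rightarrow> (real^3 \<Rightarrow> complex^4) \<Rightarrow> bool" where
  "eq_ae \<phi> \<psi> \<longleftrightarrow> (AE x in lborel. \<phi> x = \<psi> x)"

definition cutoff :: "(real^3) set \<Rightarrow> (real^3 \<Rightarrow> complex^4) \<Rightarrow> real^3 \<Rightarrow> complex^4" where
  "cutoff \<Delta> \<psi> = (\<lambda>x. indicator \<Delta> x *\<^sub>R \<psi> x)"

definition localized_in :: "(real^3 \<Rightarrow> complex^4) \<Rightarrow> (real^3) set \<Rightarrow> bool" where
  "localized_in \<psi> \<Delta> \<longleftrightarrow> \<Delta> \<in> sets lborel \<and> eq_ae (cutoff \<Delta> \<psi>) \<psi>"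

section \<open>The unitary Fourier transform\<close>

definition fourier_integral :: "(real^3 \<Rightarrow> complex^4) \<Rightarrow> real^3 \<Rightarrow> complex^4" where
  "fourier_integral f p =
     ((2 * pi) powr (- 3 / 2)) *\<^sub>R (\<integral>x. cis (- (p \<bullet> x)) *s f x \<partial>lborel)"

text \<open>
  The transform on \<open>L\<^sup>2\<close> is the \<open>L\<^sup>2\<close>-limit of the integrals over balls of increasing radius
  (Plancherel); \<open>SOME\<close> only picks a representative of the class.
\<close>

definition fourier :: "(real^3 \<Rightarrow> complex^4) \<Rightarrow> real^3 \<Rightarrow> complex^4" where
  "fourier f = (SOME g. dirac_wavefunction g \<and>
     ((\<lambda>n. \<integral>\<^sup>+p. ennreal ((norm (fourier_integral (cutoff (ball 0 (real n)) f) p - g p))\<^sup>2)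
        \<partial>lborel) \<longlonglongrightarrow> 0))"

definition inv_fourier :: "(real^3 \<Rightarrow> complex^4) \<Rightarrow> real^3 \<Rightarrow> complex^4" where
  "inv_fourier g = (SOME f. dirac_wavefunction f \<and> eq_ae (fourier f) g)"

section \<open>Free Dirac evolution\<close>

definition dirac_symbol ::
  "real \<Rightarrow> (3 \<Rightarrow> complex^4^4) \<Rightarrow> complex^4^4 \<Rightarrow> real^3 \<Rightarrow> complex^4^4" where
  "dirac_symbol m \<alpha> \<beta> p = (\<Sum>k\<in>UNIV. (p $ k) *\<^sub>R \<alpha> k) + m *\<^sub>R \<beta>"

definition matrix_scale :: "complex \<Rightarrow> complex^4^4 \<Rightarrow> complex^4^4" where
  "matrix_scale c A = (\<chi> i j. c * A $ i $ j)"

definition matrix_exp :: "complex^4^4 \<Rightarrow> complex^4^4" where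
  "matrix_exp A = (\<Sum>n. (1 / fact n) *\<^sub>R (((**) A) ^^ n) (mat 1))"

text \<open>
  \<open>\<psi>\<^sub>t = e\<^bsup>itH\<^esup> \<psi>\<close> for the self-adjoint operator \<open>H = F\<^sup>-\<^sup>1 h F\<close>, where \<open>h\<close> is multiplication by the
  Hermitian matrix function \<open>dirac_symbol\<close>.  The functional calculus of \<open>H\<close> is that of the
  multiplication operator \<open>h\<close>, conjugated by \<open>F\<close>: \<open>e\<^bsup>itH\<^esup> = F\<^sup>-\<^sup>1 e\<^bsup>ith\<^esup> F\<close>.
\<close>

definition dirac_evolution ::
  "real \<Rightarrow> (3 \<Rightarrow> complex^4^4) \<Rightarrow> complex^4^4 \<Rightarrow> real \<Rightarrow> (real^3 \<Rightarrow> complex^4) \<Rightarrow> real^3 \<Rightarrow> complex^4"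
  where
  "dirac_evolution m \<alpha> \<beta> t \<psi> =
     inv_fourier (\<lambda>p. matrix_exp (matrix_scale (\<i> * of_real t) (dirac_symbol m \<alpha> \<beta> p))
                        *v fourier \<psi> p)"

section \<open>The functions \<open>e(\<psi>)\<close> and \<open>t\<^sub>e(\<psi>)\<close>\<close>

definition edge :: "real^3 \<Rightarrow> (real^3 \<Rightarrow> complex^4) \<Rightarrow> ereal" where
  "edge e \<psi> = (GREATEST a. eq_ae (cutoff {x. ereal (x \<bullet> e) \<le> a} \<psi>) (\<lambda>_. 0))"

definition edge_time ::
  "real \<Rightarrow> (3 \<Rightarrow> complex^4^4) \<Rightarrow> complex^4^4 \<Rightarrow> real^3 \<Rightarrow> (real^3 \<Rightarrow> complex^4) \<Rightarrow> real" where
  "edge_time m \<alpha> \<beta> e \<psi> =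
     (THE s. \<forall>t. edge e (dirac_evolution m \<alpha> \<beta> t \<psi>) = edge e \<psi> + ereal \<bar>s\<bar> - ereal \<bar>t - s\<bar>)"

end

theory Submission
  imports Defs
    "HOL-Probability.Characteristic_Functions"
    "HOL-Probability.Sinc_Integral"
    "HOL-Complex_Analysis.Complex_Analysis"
    "HOL-Real_Asymp.Real_Asymp"
begin

text \<open>
  Take \<open>\<beta> u = \<plusminus> u\<close> and let \<open>\<Phi>\<^sub>t\<close> be the inverse Fourier transform of
  \<open>e\<^bsup>ith(p)\<^esup> u \<Prod>\<^sub>k (sin p\<^sub>k / p\<^sub>k)\<^sup>4\<close>, so that \<open>\<Phi>\<^sub>t = e\<^bsup>itH\<^esup> \<Phi>\<^sub>0\<close>.
  Since \<open>h(p)\<^sup>2 = p\<^sup>2 + m\<^sup>2\<close>, this amplitude is entire in \<open>p\<close>, and along \<open>p + isn\<close> with a unit vector \<open>n\<close>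
  it is at most of order \<open>s e\<^bsup>s(|t| + r)\<^esup>\<close> where \<open>r = 4 \<Sum>\<^sub>k |n\<^sub>k|\<close>; shifting the contour and letting
  \<open>s \<rightarrow> \<infinity>\<close> shows that \<open>\<Phi>\<^sub>t\<close> vanishes for \<open>xn > |t| + r\<close>.
  Conversely \<open>\<langle>u, \<alpha>\<^sub>k u\<rangle> = 0\<close>, so the \<open>u\<close>-component of the amplitude at \<open>isn\<close> grows
  like \<open>cosh (ts) e\<^bsup>sr\<^esup>\<close> up to powers of \<open>s\<close>, and the bound is sharp for all directions and all times.
  Hence \<open>\<Phi>\<close> has both edge times equal to \<open>0\<close>.  The superposition of \<open>e\<^bsup>-it\<^sub>1H\<^esup> \<Phi>\<^sub>0\<close> moved far to
  the left and \<open>e\<^bsup>-it\<^sub>2H\<^esup> \<Phi>\<^sub>0\<close> moved far to the right along \<open>e\<close> has its left edge governed by the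
  first summand and its right edge by the second one.
\<close>

section \<open>Entire functions\<close>

text \<open>The choice of u decides sharpness. At isn the propagator mixes cosh and sinh, and on an
  eigenvector of the velocity along n the two cancel to leading order for one sign of t. On an
  eigenvector of \<beta> the velocity drops out of the u-component, and the remaining mass term is
  purely imaginary there, so it cannot cancel the real cosh. Of the four powers of sin p / p, two
  pay for integrability and two for the linear growth of h(p). The product is the transform of a
  function supported in the cube [-4,4]^3, and r is the support function of that cube.
  \<open>fourier\<close> and \<open>inv_fourier\<close> are choices of representatives of L^2
  limits, so explicit integrals reach the evolution only through uniqueness almost everywhere. This
  is why Bessel's inequality, completeness of L^2 and injectivity of the transform come before the
  waves. The two summands are centred at -Le and Le with 2L > |t1 - t2|. Since ||t - t1| - |t - t2||
  <= |t1 - t2|, neither summand's outer edge is ever overtaken by the other summand.\<close>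

definition cos_sqrt :: "complex \<Rightarrow> complex" where
  "cos_sqrt w = cos (csqrt w)"

text \<open>Both cos z and sin z / z are even, so neither composite sees the branch cut of
  \<open>csqrt\<close>: they are entire in w. This continues functions of the energy analytically in
  terms of its square, without choosing a square root.\<close>

definition sinc_sqrt :: "complex \<Rightarrow> complex" where
  "sinc_sqrt w = (if w = 0 then 1 else sin (csqrt w) / csqrt w)"

lemma csqrt_power2_cases: "csqrt (z\<^sup>2) = z \<or> csqrt (z\<^sup>2) = - z"
  by (metis power2_csqrt power2_eq_iff)

lemma cos_sqrt_power2 [simp]: "cos_sqrt (z\<^sup>2) = cos z"
  using csqrt_power2_cases[of z] by (auto simp: cos_sqrt_def)

lemma sinc_sqrt_power2: "sinc_sqrt (z\<^sup>2) = (if z = 0 then 1 else sin z / z)"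
  using csqrt_power2_cases[of z] by (auto simp: sinc_sqrt_def)

lemma mult_sinc_sqrt_power2: "z * sinc_sqrt (z\<^sup>2) = sin z"
  by (simp add: sinc_sqrt_power2)

text \<open>Summing in blocks of two removes the vanishing odd coefficients. What is left is a
  series in z^2, which z = csqrt w turns into a power series in w.\<close>

lemma cos_sums_even: "(\<lambda>n. (-1)^n / fact (2*n) * z^(2*n)) sums cos (z::complex)"
proof -
  have "(\<lambda>n. \<Sum>k = n*2..<n*2+2. cos_coeff k *\<^sub>R z^k) sums cos z"
    by (rule sums_group[OF cos_converges]) simp
  moreover have "(\<Sum>k = n*2..<n*2+2. cos_coeff k *\<^sub>R z^k) = (-1)^n / fact (2*n) * z^(2*n)" for n
  proof -
    have "{n*2..<n*2+2} = {2*n, Suc (2*n)}" by auto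
    then show ?thesis by (simp add: cos_coeff_def scaleR_conv_of_real)
  qed
  ultimately show ?thesis by simp
qed

lemma sin_sums_odd: "(\<lambda>n. (-1)^n / fact (2*n+1) * z^(2*n+1)) sums sin (z::complex)"
proof -
  have "(\<lambda>n. \<Sum>k = n*2..<n*2+2. sin_coeff k *\<^sub>R z^k) sums sin z"
    by (rule sums_group[OF sin_converges]) simp
  moreover have "(\<Sum>k = n*2..<n*2+2. sin_coeff k *\<^sub>R z^k) = (-1)^n / fact (2*n+1) * z^(2*n+1)" for n
  proof -
    have "{n*2..<n*2+2} = {2*n, Suc (2*n)}" by auto
    then show ?thesis by (simp add: sin_coeff_def scaleR_conv_of_real)
  qed
  ultimately show ?thesis by simp
qed

lemma cos_sqrt_sums: "(\<lambda>n. (-1)^n / fact (2*n) * w^n) sums cos_sqrt w"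
  using cos_sums_even[of "csqrt w"] by (simp add: cos_sqrt_def power_mult)

lemma sinc_sqrt_sums: "(\<lambda>n. (-1)^n / fact (2*n+1) * w^n) sums sinc_sqrt w"
proof (cases "w = 0")
  case True
  have "(\<lambda>n. (-1)^n / fact (2*n+1) * (0::complex)^n) sums ((-1)^0 / fact (2*0+1))"
    by (rule powser_sums_zero)
  then show ?thesis using True by (simp add: sinc_sqrt_def)
next
  case False
  have "(\<lambda>n. (-1)^n / fact (2*n+1) * csqrt w^(2*n+1) / csqrt w) sums (sin (csqrt w) / csqrt w)"
    by (intro sums_divide sin_sums_odd)
  moreover have "(-1)^n / fact (2*n+1) * csqrt w^(2*n+1) / csqrt w = (-1)^n / fact (2*n+1) * w^n" for n
    using False by (simp add: power_mult)
  ultimately show ?thesis using False by (simp only: sinc_sqrt_def if_False)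
qed

lemma holomorphic_entire_power_series:
  assumes "\<And>w. (\<lambda>n. a n * w^n) sums f w"
  shows "f holomorphic_on UNIV"
proof -
  have "f holomorphic_on ball 0 r" for r
    by (rule power_series_holomorphic[where a = a]) (use assms in simp)
  then have "f holomorphic_on (\<Union>r. ball 0 r)"
    by (intro holomorphic_on_UN_open) auto
  moreover have "(\<Union>r. ball 0 r) = (UNIV :: complex set)"
    by (auto intro: gt_ex)
  ultimately show ?thesis by simp
qed

lemma holomorphic_cos_sqrt: "cos_sqrt holomorphic_on A"
  by (rule holomorphic_on_subset[OF holomorphic_entire_power_series[OF cos_sqrt_sums]]) simp

lemma holomorphic_sinc_sqrt: "sinc_sqrt holomorphic_on A"
  by (rule holomorphic_on_subset[OF holomorphic_entire_power_series[OF sinc_sqrt_sums]]) simp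

section \<open>Growth and decay of sine and cosine in the complex plane\<close>

lemma norm_cos_le: "norm (cos z) \<le> exp \<bar>Im z\<bar>" for z :: complex
proof -
  have "norm (exp (\<i> * z)) \<le> exp \<bar>Im z\<bar>" "norm (exp (- (\<i> * z))) \<le> exp \<bar>Im z\<bar>"
    by (auto simp: norm_exp_eq_Re)
  then show ?thesis
    unfolding cos_exp_eq using norm_triangle_ineq[of "exp (\<i> * z)" "exp (- (\<i> * z))"]
    by (simp add: norm_divide del: norm_exp_eq_Re)
qed

lemma norm_sin_le: "norm (sin z) \<le> exp \<bar>Im z\<bar>" for z :: complex
proof -
  have "norm (exp (\<i> * z)) \<le> exp \<bar>Im z\<bar>" "norm (exp (- (\<i> * z))) \<le> exp \<bar>Im z\<bar>"
    by (auto simp: norm_exp_eq_Re)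
  then show ?thesis
    unfolding sin_exp_eq using norm_triangle_ineq4[of "exp (\<i> * z)" "exp (- (\<i> * z))"]
    by (simp add: norm_divide norm_mult del: norm_exp_eq_Re)
qed

text \<open>Mean value inequality on the strip |Im w| <= |Im z|, which is convex, contains 0 and z,
  and bounds the derivative cos. The factor |z| keeps sin z / z bounded near 0.\<close>

lemma norm_sin_le_mult: "norm (sin z) \<le> exp \<bar>Im z\<bar> * norm z" for z :: complex
proof -
  let ?S = "{w. \<bar>Im w\<bar> \<le> \<bar>Im z\<bar>}"
  have "?S = {w. Im w \<le> \<bar>Im z\<bar>} \<inter> {w. Im w \<ge> - \<bar>Im z\<bar>}" by auto
  then have cv: "convex ?S"
    by (simp add: convex_Int convex_halfspace_Im_le convex_halfspace_Im_ge)
  have "norm (sin z - sin 0) \<le> exp \<bar>Im z\<bar> * norm (z - 0)"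
  proof (rule field_differentiable_bound[OF cv])
    show "(sin has_field_derivative cos w) (at w within ?S)" for w
      by (auto intro!: derivative_eq_intros)
    show "norm (cos w) \<le> exp \<bar>Im z\<bar>" if "w \<in> ?S" for w
      using norm_cos_le[of w] that by (meson exp_le_cancel_iff mem_Collect_eq order_trans)
  qed auto
  then show ?thesis by simp
qed

lemma norm_cos_sqrt_le: "norm (cos_sqrt (z\<^sup>2)) \<le> exp \<bar>Im z\<bar>"
  by (simp add: norm_cos_le)

lemma norm_sinc_sqrt_le: "norm (sinc_sqrt (z\<^sup>2)) \<le> exp \<bar>Im z\<bar>"
proof (cases "z = 0")
  case False
  then show ?thesis using norm_sin_le_mult[of z]
    by (simp add: sinc_sqrt_power2 norm_divide divide_simps)
qed (simp add: sinc_sqrt_def)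

text \<open>Writing s for the norm, both |z| s and s are at most e^|Im z|. Adding the squares gives
  s^2 (1 + |z|^2) <= 2 e^(2|Im z|), and squaring once more gives the claim with 4 = 2^2.\<close>

lemma norm_sinc_sqrt_decay:
  "norm (sinc_sqrt (z\<^sup>2)) ^ 4 \<le> 4 * exp (4 * \<bar>Im z\<bar>) / (1 + (Re z)\<^sup>2)\<^sup>2"
proof -
  let ?s = "norm (sinc_sqrt (z\<^sup>2))" and ?E = "exp \<bar>Im z\<bar>"
  have "norm z * ?s \<le> ?E"
    using norm_sin_le[of z] by (metis mult_sinc_sqrt_power2 norm_mult)
  then have "(norm z * ?s)\<^sup>2 \<le> ?E\<^sup>2" by (intro power_mono) auto
  moreover have "?s\<^sup>2 \<le> ?E\<^sup>2" using norm_sinc_sqrt_le[of z] by (intro power_mono) auto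
  ultimately have "?s\<^sup>2 * (1 + (norm z)\<^sup>2) \<le> 2 * ?E\<^sup>2"
    unfolding power_mult_distrib distrib_left mult_1_right mult.commute[of "?s\<^sup>2"] by linarith
  moreover have "(Re z)\<^sup>2 \<le> (norm z)\<^sup>2"
    by (metis abs_Re_le_cmod power2_abs power_mono abs_ge_zero)
  ultimately have "?s\<^sup>2 * (1 + (Re z)\<^sup>2) \<le> 2 * ?E\<^sup>2"
    by (smt (verit) mult_left_mono zero_le_power2)
  then have "(?s\<^sup>2 * (1 + (Re z)\<^sup>2))\<^sup>2 \<le> (2 * ?E\<^sup>2)\<^sup>2"
    by (intro power_mono) auto
  moreover have "?E ^ 4 = exp (4 * \<bar>Im z\<bar>)"
    by (metis exp_of_nat_mult of_nat_numeral)
  ultimately have "?s ^ 4 * (1 + (Re z)\<^sup>2)\<^sup>2 \<le> 4 * exp (4 * \<bar>Im z\<bar>)"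
    by (simp add: power_mult_distrib flip: power_mult)
  moreover have "1 + (Re z)\<^sup>2 > 0" by (simp add: add_pos_nonneg)
  ultimately show ?thesis by (simp add: pos_le_divide_eq)
qed

section \<open>Values at purely imaginary arguments and complex square roots\<close>

lemma cos_sqrt_neg_square: "cos_sqrt (of_real (- (y\<^sup>2))) = of_real (cosh y)"
proof -
  have "complex_of_real (- (y\<^sup>2)) = (\<i> * of_real y)\<^sup>2" by (simp add: power_mult_distrib)
  then have "cos_sqrt (of_real (- (y\<^sup>2))) = cos (\<i> * of_real y)" by (simp only: cos_sqrt_power2)
  also have "\<dots> = of_real (cosh y)" by (simp add: cosh_def cos_exp_eq scaleR_conv_of_real exp_of_real[symmetric] flip: exp_minus mult.assoc add.commute)
  finally show ?thesis .
qed

lemma sinc_sqrt_neg_square: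
  "sinc_sqrt (of_real (- (y\<^sup>2))) = of_real (if y = 0 then 1 else sinh y / y)"
proof -
  have "complex_of_real (- (y\<^sup>2)) = (\<i> * of_real y)\<^sup>2" by (simp add: power_mult_distrib)
  then have "sinc_sqrt (of_real (- (y\<^sup>2))) = (if y = 0 then 1 else sin (\<i> * of_real y) / (\<i> * of_real y))"
    by (simp only: sinc_sqrt_power2) simp
  moreover have "sin (\<i> * of_real y) = \<i> * of_real (sinh y)"
    by (simp add: sin_i_times sinh_field_def exp_of_real exp_minus)
  ultimately show ?thesis by simp
qed

text \<open>With denominators cleared this is (1 + y) e^(-y) <= e^y, a consequence of 1 + y <= e^y.
  Only a polynomial factor is lost against e^y, which the sharpness argument can afford.\<close>

lemma sinhc_lower_bound:
  fixes y :: real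
  assumes "y \<ge> 0"
  shows "exp y / (2 * (1 + y)) \<le> (if y = 0 then 1 else sinh y / y)"
proof (cases "y = 0")
  case False
  have "(1 + y) * exp (- y) \<le> exp y * 1"
  proof -
    have "1 + y \<le> exp y" by (rule exp_ge_add_one_self)
    moreover have "exp (-y) \<le> 1" using assms by simp
    ultimately show ?thesis using assms by (intro mult_mono) auto
  qed
  then have "y * exp y \<le> (1 + y) * (exp y - exp (- y))" by (simp add: algebra_simps)
  then show ?thesis using False assms by (simp add: sinh_def field_simps)
qed auto

text \<open>If |Im E| > |s|, the real part of E^2 forces |Re E| > |a|; then |Re E Im E| > |s a| >=
  |s b|, against the imaginary part. Here E will be a complex energy, and the bound controls the
  growth of cos (tE).\<close>

lemma abs_Im_sqrt_shift_le:
  fixes E :: complex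
  assumes "E\<^sup>2 = complex_of_real (a\<^sup>2 - s\<^sup>2) + 2 * \<i> * of_real (s * b)" and "\<bar>b\<bar> \<le> \<bar>a\<bar>"
  shows "\<bar>Im E\<bar> \<le> \<bar>s\<bar>"
proof (rule ccontr)
  assume "\<not> ?thesis"
  then have lt: "s\<^sup>2 < (Im E)\<^sup>2" by (metis abs_le_square_iff not_le)
  have 1: "(Re E)\<^sup>2 - (Im E)\<^sup>2 = a\<^sup>2 - s\<^sup>2" and 2: "Re E * Im E = s * b"
    using assms(1) by (simp_all add: complex_eq_iff power2_eq_square mult.commute)
  have "(Re E)\<^sup>2 * (Im E)\<^sup>2 = s\<^sup>2 * b\<^sup>2" by (metis 2 power_mult_distrib)
  also have "\<dots> \<le> s\<^sup>2 * a\<^sup>2" using assms(2) by (simp add: abs_le_square_iff mult_left_mono)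
  also have "\<dots> \<le> (Im E)\<^sup>2 * a\<^sup>2" using lt by (intro mult_right_mono) auto
  also have "\<dots> < (Im E)\<^sup>2 * (Re E)\<^sup>2"
    using 1 lt by (intro mult_strict_left_mono) (auto intro: le_less_trans[OF zero_le_power2])
  finally show False by (simp add: mult.commute)
qed

section \<open>Holomorphic parameter integrals\<close>

text \<open>Cauchy's inequality with radius r/4 around w; that disc stays inside
  \<open>ball z r\<close> because w is closer than r/2 to z.\<close>

lemma norm_deriv_le_half_ball:
  assumes hol: "f holomorphic_on ball z r" and r: "r > 0"
    and B: "\<And>w. w \<in> ball z r \<Longrightarrow> norm (f w) \<le> B"
    and w: "w \<in> ball z (r / 2)"
  shows "norm (deriv f w) \<le> B * 4 / r"
proof -
  have sub: "cball w (r / 4) \<subseteq> ball z r"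
  proof
    fix y assume "y \<in> cball w (r / 4)"
    then show "y \<in> ball z r" using w r dist_triangle[of z y w] by auto
  qed
  have "norm ((deriv ^^ 1) f w) \<le> fact 1 * B / (r / 4) ^ 1"
  proof (rule Cauchy_inequality)
    show "f holomorphic_on ball w (r / 4)"
      using sub by (intro holomorphic_on_subset[OF hol]) (meson ball_subset_cball order_trans)
    show "continuous_on (cball w (r / 4)) f"
      using sub by (intro holomorphic_on_imp_continuous_on holomorphic_on_subset[OF hol])
    show "norm (f x) \<le> B" if "norm (w - x) = r / 4" for x
      using sub that by (intro B) (auto simp: dist_norm)
  qed (use r in auto)
  then show ?thesis by simp
qed

text \<open>A majorant of f alone suffices for differentiation under the integral sign: Cauchy's
  inequality turns D into the majorant 4 D / r of the difference quotients.\<close>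

lemma has_field_derivative_parametric_integral:
  fixes f :: "complex \<Rightarrow> 'a \<Rightarrow> complex"
  assumes hol: "\<And>x. (\<lambda>w. f w x) holomorphic_on ball z r" and r: "r > 0"
    and meas: "\<And>w. w \<in> ball z r \<Longrightarrow> f w \<in> borel_measurable M"
    and D: "integrable M D"
    and bound: "\<And>w x. w \<in> ball z r \<Longrightarrow> norm (f w x) \<le> D x"
  shows "((\<lambda>w. integral\<^sup>L M (f w)) has_field_derivative (\<integral>x. deriv (\<lambda>w. f w x) z \<partial>M)) (at z)"
proof -
  have int: "integrable M (f w)" if "w \<in> ball z r" for w
    using bound[OF that] by (intro Bochner_Integration.integrable_bound[OF D meas[OF that]] AE_I2) (simp add: order_trans[OF _ abs_ge_self])
  have "((\<lambda>w. (integral\<^sup>L M (f w) - integral\<^sup>L M (f z)) / (w - z)) \<longlongrightarrow> (\<integral>x. deriv (\<lambda>w. f w x) z \<partial>M)) (at z within ball z (r / 2))"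
  \<comment> \<open>Dominated convergence speaks of sequences, so the limit at z is tested along an
    arbitrary one.\<close>
  proof (subst tendsto_at_iff_sequentially, intro allI impI)
    fix X :: "nat \<Rightarrow> complex"
    assume X: "\<forall>i. X i \<in> ball z (r / 2) - {z}" and lim: "X \<longlonglongrightarrow> z"
    have Xr: "X i \<in> ball z r" for i
    proof -
      have "dist z (X i) < r / 2" using X by auto
      then show ?thesis using r by simp
    qed
    have zr: "z \<in> ball z r" using r by simp
    have quot: "(\<lambda>i. (f (X i) x - f z x) / (X i - z)) \<longlonglongrightarrow> deriv (\<lambda>w. f w x) z" for x
    proof -
      have "((\<lambda>w. f w x) has_field_derivative deriv (\<lambda>w. f w x) z) (at z)"
        using hol[of x] zr by (meson open_ball holomorphic_derivI)
      then have "((\<lambda>w. (f w x - f z x) / (w - z)) \<longlongrightarrow> deriv (\<lambda>w. f w x) z) (at z)"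
        by (simp add: has_field_derivative_iff)
      moreover have "filterlim X (at z) sequentially"
        using X lim by (auto simp: filterlim_at)
      ultimately show ?thesis by (rule filterlim_compose)
    qed
    have "(\<lambda>i. \<integral>x. (f (X i) x - f z x) / (X i - z) \<partial>M) \<longlonglongrightarrow> (\<integral>x. deriv (\<lambda>w. f w x) z \<partial>M)"
    proof (rule integral_dominated_convergence[where w = "\<lambda>x. D x * 4 / r"])
      show m: "(\<lambda>x. (f (X i) x - f z x) / (X i - z)) \<in> borel_measurable M" for i
        using meas[OF Xr] meas[OF zr] by measurable
      \<comment> \<open>The derivative is measurable in x as a pointwise limit of measurable
        quotients.\<close>
      show "(\<lambda>x. deriv (\<lambda>w. f w x) z) \<in> borel_measurable M"
        using quot m by (rule borel_measurable_LIMSEQ_metric[rotated])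
      show "integrable M (\<lambda>x. D x * 4 / r)" using D by simp
      show "AE x in M. (\<lambda>i. (f (X i) x - f z x) / (X i - z)) \<longlonglongrightarrow> deriv (\<lambda>w. f w x) z"
        using quot by simp
      show "AE x in M. norm ((f (X i) x - f z x) / (X i - z)) \<le> D x * 4 / r" for i
      proof (rule AE_I2)
        fix x
        have "norm (f (X i) x - f z x) \<le> D x * 4 / r * norm (X i - z)"
        proof (rule field_differentiable_bound[where S = "ball z (r / 2)"])
          fix w assume w: "w \<in> ball z (r / 2)"
          then have "w \<in> ball z r" using r by auto
          then show "((\<lambda>w. f w x) has_field_derivative deriv (\<lambda>w. f w x) w) (at w within ball z (r / 2))"
            using hol[of x] by (meson open_ball holomorphic_derivI DERIV_subset has_field_derivative_at_within)
          show "norm (deriv (\<lambda>w. f w x) w) \<le> D x * 4 / r"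
            using hol r bound w by (rule norm_deriv_le_half_ball)
        qed (use X r in auto)
        moreover have "X i \<noteq> z" using X by auto
        ultimately show "norm ((f (X i) x - f z x) / (X i - z)) \<le> D x * 4 / r"
          by (simp add: norm_divide divide_le_eq)
      qed
    qed
    moreover have "(\<integral>x. (f (X i) x - f z x) / (X i - z) \<partial>M) = (integral\<^sup>L M (f (X i)) - integral\<^sup>L M (f z)) / (X i - z)" for i
      using int[OF Xr] int[OF zr] by (simp only: integral_divide_zero Bochner_Integration.integral_diff)
    ultimately show "((\<lambda>w. (integral\<^sup>L M (f w) - integral\<^sup>L M (f z)) / (w - z)) \<circ> X) \<longlonglongrightarrow> (\<integral>x. deriv (\<lambda>w. f w x) z \<partial>M)"
      by (simp only: o_def)
  qed
  then have "((\<lambda>w. integral\<^sup>L M (f w)) has_field_derivative (\<integral>x. deriv (\<lambda>w. f w x) z \<partial>M)) (at z within ball z (r / 2))"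
    by (simp add: has_field_derivative_iff)
  then show ?thesis
    using r by (simp add: at_within_open[OF _ open_ball])
qed

text \<open>Differentiability is local, so each disc may have its own majorant. The integrands below
  grow exponentially in Im w and have none on the whole plane.\<close>

lemma holomorphic_parametric_integral:
  fixes f :: "complex \<Rightarrow> 'a \<Rightarrow> complex"
  assumes hol: "\<And>x. (\<lambda>w. f w x) holomorphic_on UNIV"
    and meas: "\<And>w. f w \<in> borel_measurable M"
    and D: "\<And>R. integrable M (D R)"
    and bound: "\<And>R w x. norm w \<le> R \<Longrightarrow> norm (f w x) \<le> D R x"
  shows "(\<lambda>w. integral\<^sup>L M (f w)) holomorphic_on UNIV"
proof -
  have "((\<lambda>w. integral\<^sup>L M (f w)) has_field_derivative (\<integral>x. deriv (\<lambda>w. f w x) z \<partial>M)) (at z)" for z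
  proof (rule has_field_derivative_parametric_integral[where r = 1 and D = "D (norm z + 1)"])
    show "(\<lambda>w. f w x) holomorphic_on ball z 1" for x using hol by (rule holomorphic_on_subset) simp
    fix w x assume "w \<in> ball z 1"
    then have "norm w \<le> norm z + 1"
      using norm_triangle_sub[of w z] by (auto simp: dist_norm norm_minus_commute)
    then show "norm (f w x) \<le> D (norm z + 1) x" by (rule bound)
  qed (use meas D in auto)
  then show ?thesis by (auto simp: holomorphic_on_open)
qed

text \<open>Identity theorem, with 0 as accumulation point of the real axis. It takes the place of
  contour deformation: identities in a complex parameter are verified for real values only.\<close>

lemma holomorphic_eq_of_eq_on_reals:
  assumes "f holomorphic_on UNIV" "g holomorphic_on UNIV" and "\<And>r. f (of_real r) = g (of_real r)"
  shows "f z = g z"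
proof -
  have "f z - g z = 0"
  proof (rule analytic_continuation[where f = "\<lambda>z. f z - g z" and S = UNIV and U = "range of_real" and \<xi> = 0])
    show "(0::complex) islimpt range of_real"
    proof (rule islimptI)
      fix T :: "complex set" assume "0 \<in> T" "open T"
      then obtain e where e: "e > 0" "ball 0 e \<subseteq> T" by (meson open_contains_ball)
      then show "\<exists>y\<in>range of_real. y \<in> T \<and> y \<noteq> 0"
        by (intro bexI[of _ "of_real (e / 2)"]) (auto simp: subset_eq simp del: of_real_divide)
    qed
  qed (use assms in \<open>auto intro!: holomorphic_intros\<close>)
  then show ?thesis by simp
qed

section \<open>Gaussian integrals\<close>

lemma borel_measurable_cis [measurable]: "cis \<in> borel_measurable borel"
  by (intro borel_measurable_continuous_onI) (auto simp: cis_conv_exp intro!: continuous_intros)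

lemma norm_power2_diff_le: "(norm (a - b))\<^sup>2 \<le> 2 * (norm a)\<^sup>2 + 2 * (norm b)\<^sup>2"
proof -
  have "(norm (a - b))\<^sup>2 \<le> (norm a + norm b)\<^sup>2" by (intro power_mono norm_triangle_ineq4) simp
  also have "\<dots> \<le> 2 * (norm a)\<^sup>2 + 2 * (norm b)\<^sup>2"
    using sum_squares_bound[of "norm a" "norm b"] by (simp add: power2_sum)
  finally show ?thesis .
qed

text \<open>A product majorant gives integrability on the product space at once. In the applications
  it is a Gaussian times the modulus of an integrable function.\<close>

lemma Fubini_dominated:
  fixes F :: "'a::euclidean_space \<Rightarrow> 'b::euclidean_space \<Rightarrow> complex"
  assumes F: "(\<lambda>(x, y). F x y) \<in> borel_measurable (borel \<Otimes>\<^sub>M borel)"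
    and a: "integrable lborel a" and b: "integrable lborel b"
    and bound: "\<And>x y. norm (F x y) \<le> a x * b y"
  shows "(\<integral>x. \<integral>y. F x y \<partial>lborel \<partial>lborel) = (\<integral>y. \<integral>x. F x y \<partial>lborel \<partial>lborel)"
proof -
  note [measurable] = F borel_measurable_integrable[OF a] borel_measurable_integrable[OF b]
  have m: "case_prod F \<in> borel_measurable (lborel \<Otimes>\<^sub>M lborel)" using F by simp
  have "integrable (lborel \<Otimes>\<^sub>M lborel) (case_prod F)"
  proof (rule lborel_pair.Fubini_integrable[OF m])
    have iy: "integrable lborel (\<lambda>y. F x y)" for x
      by (rule Bochner_Integration.integrable_bound[OF integrable_mult_right[OF b, of "a x"]])
        (use F bound in \<open>auto simp: abs_le_iff intro: order_trans[OF _ abs_ge_self]\<close>)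
    then show "AE x in lborel. integrable lborel (\<lambda>y. case (x, y) of (x, y) \<Rightarrow> F x y)" by simp
    show "integrable lborel (\<lambda>x. \<integral>y. norm (case (x, y) of (x, y) \<Rightarrow> F x y) \<partial>lborel)"
    proof (rule Bochner_Integration.integrable_bound[OF integrable_mult_left[OF a, of "\<integral>y. b y \<partial>lborel"]])
      show "(\<lambda>x. \<integral>y. norm (case (x, y) of (x, y) \<Rightarrow> F x y) \<partial>lborel) \<in> borel_measurable lborel"
        using F by simp
      show "AE x in lborel. norm (\<integral>y. norm (case (x, y) of (x, y) \<Rightarrow> F x y) \<partial>lborel) \<le> norm (a x * (\<integral>y. b y \<partial>lborel))"
      proof (rule AE_I2)
        fix x
        have "(\<integral>y. norm (F x y) \<partial>lborel) \<le> (\<integral>y. a x * b y \<partial>lborel)"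
          using iy b bound by (intro integral_mono) auto
        also have "\<dots> \<le> norm (a x * (\<integral>y. b y \<partial>lborel))" by simp
        finally show "norm (\<integral>y. norm (case (x, y) of (x, y) \<Rightarrow> F x y) \<partial>lborel) \<le> norm (a x * (\<integral>y. b y \<partial>lborel))"
          by (simp add: integral_nonneg)
      qed
    qed
  qed
  from lborel_pair.Fubini_integral[OF this] show ?thesis by simp
qed

section \<open>Integrals of coordinate products and under affine maps\<close>

lemma
  fixes f :: "'a::euclidean_space \<Rightarrow> real \<Rightarrow> 'b::{real_normed_field,banach,second_countable_topology}"
  assumes f: "\<And>b. b \<in> Basis \<Longrightarrow> integrable lborel (f b)"
  shows integrable_lborel_prod: "integrable lborel (\<lambda>x::'a. \<Prod>b\<in>Basis. f b (x \<bullet> b))"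
    and integral_lborel_prod: "(\<integral>x. (\<Prod>b\<in>Basis. f b ((x::'a) \<bullet> b)) \<partial>lborel) = (\<Prod>b\<in>Basis. \<integral>t. f b t \<partial>lborel)"
proof -
  interpret product_sigma_finite "\<lambda>b::'a. lborel :: real measure" ..
  have [measurable]: "f b \<in> borel_measurable borel" if "b \<in> Basis" for b
    using borel_measurable_integrable[OF f[OF that]] by simp
  have m: "(\<lambda>x::'a. \<Prod>b\<in>Basis. f b (x \<bullet> b)) \<in> borel_measurable borel"
    by measurable
  have T: "(\<lambda>f. \<Sum>b\<in>Basis. f b *\<^sub>R b) \<in> (\<Pi>\<^sub>M b\<in>(Basis::'a set). lborel) \<rightarrow>\<^sub>M borel"
    by measurable
  have eq: "(\<Prod>b\<in>Basis. f b ((\<Sum>c\<in>Basis. g c *\<^sub>R c) \<bullet> b)) = (\<Prod>b\<in>Basis. f b (g b))" for g :: "'a \<Rightarrow> real"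
    by (intro prod.cong) auto
  show "integrable lborel (\<lambda>x::'a. \<Prod>b\<in>Basis. f b (x \<bullet> b))"
    by (subst lborel_eq, subst integrable_distr_eq[OF T m]) (simp add: eq product_integrable_prod f)
  show "(\<integral>x. (\<Prod>b\<in>Basis. f b ((x::'a) \<bullet> b)) \<partial>lborel) = (\<Prod>b\<in>Basis. \<integral>t. f b t \<partial>lborel)"
    by (subst lborel_eq, subst integral_distr[OF T m]) (simp add: eq product_integral_prod f)
qed

lemma
  fixes f :: "'a::euclidean_space \<Rightarrow> 'b::{banach,second_countable_topology}" and c :: real and t :: 'a
  assumes c: "c \<noteq> 0"
  shows lborel_integrable_affine_iff: "integrable lborel (\<lambda>x. f (t + c *\<^sub>R x)) \<longleftrightarrow> integrable lborel f"
    and lborel_integral_affine: "(\<integral>x. f x \<partial>lborel) = \<bar>c\<bar> ^ DIM('a) *\<^sub>R (\<integral>x. f (t + c *\<^sub>R x) \<partial>lborel)"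
proof -
  have meas: "g \<in> borel_measurable borel \<Longrightarrow> (\<lambda>x. g (t + c *\<^sub>R x)) \<in> borel_measurable borel" for g :: "'a \<Rightarrow> 'b" and t c
    by (rule measurable_compose[where g = g]) auto
  have int: "integrable lborel (\<lambda>x. f (t + c *\<^sub>R x))" if "integrable lborel f" "c \<noteq> 0" for f :: "'a \<Rightarrow> 'b" and c :: real and t :: 'a
  proof -
    have [measurable]: "f \<in> borel_measurable borel" using borel_measurable_integrable[OF that(1)] by simp
    have "integrable (density (distr lborel borel (\<lambda>x. t + c *\<^sub>R x)) (\<lambda>_. ennreal (\<bar>c\<bar>^DIM('a)))) f"
      using that(1) lborel_affine[OF that(2), of t] by simp
    then have "integrable lborel (\<lambda>x. \<bar>c\<bar> ^ DIM('a) *\<^sub>R f (t + c *\<^sub>R x))"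
      by (simp add: integrable_density integrable_distr_eq)
    from integrable_scaleR_right[OF this, of "inverse (\<bar>c\<bar> ^ DIM('a))"] show ?thesis
      using that(2) by simp
  qed
  show iff: "integrable lborel (\<lambda>x. f (t + c *\<^sub>R x)) \<longleftrightarrow> integrable lborel f"
  proof
    assume "integrable lborel (\<lambda>x. f (t + c *\<^sub>R x))"
    from int[OF this, of "1 / c" "- (1 / c) *\<^sub>R t"] c show "integrable lborel f"
      by (simp add: scaleR_right_diff_distrib scaleR_add_right)
  qed (use int c in auto)
  show "(\<integral>x. f x \<partial>lborel) = \<bar>c\<bar> ^ DIM('a) *\<^sub>R (\<integral>x. f (t + c *\<^sub>R x) \<partial>lborel)"
  proof (cases "integrable lborel f")
    case True
    then have [measurable]: "f \<in> borel_measurable borel" using borel_measurable_integrable by fastforce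
    show ?thesis
      by (subst lborel_affine[OF c, of t]) (simp add: integral_density integral_distr)
  next
    \<comment> \<open>Without integrability both Bochner integrals have the default value 0.\<close>
    case False
    with iff show ?thesis by (simp add: not_integrable_integral_eq)
  qed
qed

lemma nn_integral_lborel_affine:
  fixes f :: "'a::euclidean_space \<Rightarrow> ennreal"
  assumes [measurable]: "f \<in> borel_measurable borel" and c: "c \<noteq> 0"
  shows "(\<integral>\<^sup>+x. f x \<partial>lborel) = \<bar>c\<bar> ^ DIM('a) * (\<integral>\<^sup>+x. f (t + c *\<^sub>R x) \<partial>lborel)"
  by (subst lborel_affine[OF c, of t]) (simp add: nn_integral_density nn_integral_distr nn_integral_cmult ennreal_power)

text \<open>Normalised to total mass 1. The value at 0 is the constant of the unitary Fourier
  transform, so the regularising factors \<open>gauss (\<delta> *\<^sub>R q)\<close> tend to exactly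
  that constant as \<delta> tends to 0.\<close>

definition gauss :: "'a::euclidean_space \<Rightarrow> real" where
  "gauss x = (2 * pi) powr (- real DIM('a) / 2) * exp (- (norm x)\<^sup>2 / 2)"

lemma gauss_pos: "gauss x > 0"
  by (simp add: gauss_def)

lemma gauss_le: "gauss (x::'a::euclidean_space) \<le> (2 * pi) powr (- real DIM('a) / 2)"
  by (simp add: gauss_def)

lemma borel_measurable_gauss [measurable]: "gauss \<in> borel_measurable borel"
  unfolding gauss_def[abs_def] by measurable

lemma gauss_prod: "gauss (x::'a::euclidean_space) = (\<Prod>b\<in>Basis. std_normal_density (x \<bullet> b))"
proof -
  have "(norm x)\<^sup>2 = (\<Sum>b\<in>Basis. (x \<bullet> b)\<^sup>2)"
    by (simp only: power2_norm_eq_inner euclidean_inner[of x x] power2_eq_square[symmetric])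
  then have "exp (- (norm x)\<^sup>2 / 2) = (\<Prod>b\<in>Basis. exp (- (x \<bullet> b)\<^sup>2 / 2))"
    by (simp add: exp_sum[symmetric] sum_negf sum_divide_distrib)
  moreover have "(2 * pi) powr (- real DIM('a) / 2) = (1 / sqrt (2 * pi)) ^ DIM('a)"
  proof -
    have "1 / sqrt (2 * pi) = (2 * pi) powr (- 1 / 2)"
      by (simp add: powr_minus_divide powr_half_sqrt)
    then show ?thesis by (simp add: powr_powr flip: powr_realpow)
  qed
  ultimately show ?thesis
    by (simp add: gauss_def std_normal_density_def prod.distrib prod_dividef power_divide)
qed

lemma fourier_std_normal_density:
  "(\<integral>t. cis (- (a * t)) * of_real (std_normal_density t) \<partial>lborel) = of_real (exp (- a\<^sup>2 / 2))"
proof -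
  have "char std_normal_distribution (- a) = (\<integral>t. std_normal_density t *\<^sub>R iexp (- a * t) \<partial>lborel)"
    unfolding char_def by (subst integral_density) auto
  then show ?thesis
    by (simp add: char_std_normal_distribution scaleR_conv_of_real cis_conv_exp mult.commute)
qed

lemma integrable_fourier_std_normal_density:
  "integrable lborel (\<lambda>t. cis (- (a * t)) * of_real (std_normal_density t))"
proof (rule Bochner_Integration.integrable_bound)
  show "integrable lborel std_normal_density"
    using integrable_std_normal_moment[of 0] by simp
  show "(\<lambda>t. cis (- (a * t)) * complex_of_real (std_normal_density t)) \<in> borel_measurable lborel"
    by measurable
qed (auto simp: norm_mult)

lemma fourier_gauss_eq_prod:
  "cis (- (p \<bullet> x)) * of_real (gauss x) = (\<Prod>b\<in>Basis. cis (- ((p \<bullet> b) * (x \<bullet> b))) * of_real (std_normal_density (x \<bullet> b)))"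
proof -
  have "cis (- (p \<bullet> x)) = (\<Prod>b\<in>Basis. cis (- ((p \<bullet> b) * (x \<bullet> b))))"
    by (simp add: euclidean_inner[of p x] cis_conv_exp exp_sum[symmetric] sum_negf sum_distrib_left)
  then show ?thesis by (simp add: gauss_prod prod.distrib)
qed

lemma
  fixes p :: "'a::euclidean_space"
  shows integrable_fourier_gauss: "integrable lborel (\<lambda>x. cis (- (p \<bullet> x)) * of_real (gauss x))"
    and integral_fourier_gauss: "(\<integral>x. cis (- (p \<bullet> x)) * of_real (gauss x) \<partial>lborel) = of_real (exp (- (norm p)\<^sup>2 / 2))"
proof -
  show "integrable lborel (\<lambda>x. cis (- (p \<bullet> x)) * of_real (gauss x))"
    unfolding fourier_gauss_eq_prod by (intro integrable_lborel_prod integrable_fourier_std_normal_density)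
  have "(norm p)\<^sup>2 = (\<Sum>b\<in>Basis. (p \<bullet> b)\<^sup>2)"
    by (simp only: power2_norm_eq_inner euclidean_inner[of p p] power2_eq_square[symmetric])
  then have "exp (- (norm p)\<^sup>2 / 2) = (\<Prod>b\<in>Basis. exp (- (p \<bullet> b)\<^sup>2 / 2))"
    by (simp add: exp_sum[symmetric] sum_negf sum_divide_distrib)
  then show "(\<integral>x. cis (- (p \<bullet> x)) * of_real (gauss x) \<partial>lborel) = of_real (exp (- (norm p)\<^sup>2 / 2))"
    unfolding fourier_gauss_eq_prod
    by (subst integral_lborel_prod) (auto intro: integrable_fourier_std_normal_density simp: fourier_std_normal_density)
qed

lemma integrable_gauss: "integrable lborel (gauss :: 'a::euclidean_space \<Rightarrow> real)"
proof -
  have "\<bar>gauss x\<bar> = gauss x" for x :: 'a using gauss_pos[of x] by simp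
  then show ?thesis using integrable_norm[OF integrable_fourier_gauss[of "0::'a"]] by (simp add: norm_mult)
qed

lemma integral_gauss: "(\<integral>x. gauss (x::'a::euclidean_space) \<partial>lborel) = 1"
proof -
  have "complex_of_real (\<integral>x. gauss (x::'a) \<partial>lborel) = 1"
    using integral_fourier_gauss[of "0::'a"] by (simp add: cis_zero)
  then show ?thesis by (simp only: of_real_eq_1_iff)
qed

lemma nn_integral_gauss: "(\<integral>\<^sup>+x. ennreal (gauss (x::'a::euclidean_space)) \<partial>lborel) = 1"
  by (subst nn_integral_eq_integral[OF integrable_gauss]) (auto simp: integral_gauss gauss_pos less_imp_le)

section \<open>The scalar Fourier transform\<close>

lemma borel_measurable_cnj [measurable]: "cnj \<in> borel_measurable borel"
  by (intro borel_measurable_continuous_onI continuous_intros)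

definition fourier_const :: "'a::euclidean_space itself \<Rightarrow> real" where
  "fourier_const _ = (2 * pi) powr (- real DIM('a) / 2)"

lemma fourier_const_pos: "fourier_const TYPE('a::euclidean_space) > 0"
  by (simp add: fourier_const_def)

lemma gauss_eq: "gauss (x::'a::euclidean_space) = fourier_const TYPE('a) * exp (- (norm x)\<^sup>2 / 2)"
  by (simp add: gauss_def fourier_const_def)

definition ft :: "('a::euclidean_space \<Rightarrow> complex) \<Rightarrow> 'a \<Rightarrow> complex" where
  "ft f p = of_real (fourier_const TYPE('a)) * (\<integral>x. cis (- (p \<bullet> x)) * f x \<partial>lborel)"

lemma integrable_cis_mult:
  assumes f: "integrable lborel f" and [measurable]: "g \<in> borel_measurable borel"
  shows "integrable lborel (\<lambda>x. cis (g x) * f x)"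
  by (rule Bochner_Integration.integrable_bound[OF f])
    (use borel_measurable_integrable[OF f] in \<open>auto simp: norm_mult\<close>)

lemma norm_ft_le: "norm (ft f (p::'a::euclidean_space)) \<le> fourier_const TYPE('a) * (\<integral>x. norm (f x) \<partial>lborel)"
proof -
  have "norm (\<integral>x. cis (- (p \<bullet> x)) * f x \<partial>lborel) \<le> (\<integral>x. norm (f x) \<partial>lborel)"
    using integral_norm_bound[of lborel "\<lambda>x. cis (- (p \<bullet> x)) * f x"] by (simp add: norm_mult)
  then show ?thesis
    using fourier_const_pos[where 'a = 'a] by (simp add: ft_def norm_mult)
qed

lemma borel_measurable_ft [measurable]:
  assumes [measurable]: "f \<in> borel_measurable borel"
  shows "ft f \<in> borel_measurable borel"
  unfolding ft_def[abs_def] by measurable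

lemma ft_add:
  assumes "integrable lborel f" "integrable lborel g"
  shows "ft (\<lambda>x. f x + g x) p = ft f p + ft g p"
  using assms by (simp add: ft_def ring_distribs integrable_cis_mult)

lemma ft_diff:
  assumes "integrable lborel f" "integrable lborel g"
  shows "ft (\<lambda>x. f x - g x) p = ft f p - ft g p"
  using assms by (simp add: ft_def ring_distribs integrable_cis_mult)

lemma cnj_ft: "cnj (ft f (p::'a::euclidean_space)) = of_real (fourier_const TYPE('a)) * (\<integral>x. cis (p \<bullet> x) * cnj (f x) \<partial>lborel)"
  using Bochner_Integration.integral_cnj[of lborel "\<lambda>x. cis (- (p \<bullet> x)) * f x"] by (simp add: ft_def cis_cnj)

lemma ft_shift: "ft (\<lambda>x. f (x - c)) p = cis (- (p \<bullet> c)) * ft f (p::'a::euclidean_space)"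
proof -
  have "(\<integral>x. cis (- (p \<bullet> x)) * f (x - c) \<partial>lborel) = (\<integral>x. cis (- (p \<bullet> c)) * (cis (- (p \<bullet> x)) * f x) \<partial>lborel)"
    by (subst lborel_integral_affine[of 1 _ c]) (simp_all add: inner_add_right cis_mult mult.assoc[symmetric])
  then show ?thesis by (simp add: ft_def)
qed

section \<open>Gaussian regularisation and pointwise Fourier inversion\<close>

lemma integrable_gauss_scaled:
  "\<delta> \<noteq> 0 \<Longrightarrow> integrable lborel (\<lambda>q::'a::euclidean_space. gauss (\<delta> *\<^sub>R q))"
  using lborel_integrable_affine_iff[of \<delta> "gauss :: 'a \<Rightarrow> real" 0] integrable_gauss by simp

text \<open>Inserting the definition of \<open>ft\<close> and exchanging the integrals leaves the
  transform of a dilated Gaussian as inner integral, which is a Gaussian of width \<delta> around x.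
  The factor \<open>gauss (\<delta> *\<^sub>R q)\<close> justifies the exchange even when
  \<open>ft f\<close> is not integrable.\<close>

lemma gaussian_mean_eq:
  fixes f :: "'a::euclidean_space \<Rightarrow> complex"
  assumes f: "integrable lborel f" and \<delta>: "\<delta> > 0"
  shows "(\<integral>y. of_real (gauss y) * f (x + \<delta> *\<^sub>R y) \<partial>lborel)
       = (\<integral>q. of_real (gauss (\<delta> *\<^sub>R q)) * ft f q * cis (q \<bullet> x) \<partial>lborel)"
proof -
  let ?K = "fourier_const TYPE('a)"
  have [measurable]: "f \<in> borel_measurable borel" using borel_measurable_integrable[OF f] by simp
  define F where "F q y = of_real (?K * gauss (\<delta> *\<^sub>R q)) * cis (- (q \<bullet> (y - x))) * f y" for q y
  \<comment> \<open>The substitution q = q' / \<delta> reduces this to the transform of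
    \<open>gauss\<close> itself.\<close>
  have scale: "(\<integral>q. of_real (?K * gauss (\<delta> *\<^sub>R q)) * cis (- (q \<bullet> v)) \<partial>lborel) = of_real ((1 / \<delta>) ^ DIM('a) * gauss ((1 / \<delta>) *\<^sub>R v))" for v :: 'a
  proof -
    have "(\<integral>q. of_real (?K * gauss (\<delta> *\<^sub>R q)) * cis (- (q \<bullet> v)) \<partial>lborel)
       = \<bar>1 / \<delta>\<bar> ^ DIM('a) *\<^sub>R (\<integral>q. of_real (?K * gauss (\<delta> *\<^sub>R (0 + (1 / \<delta>) *\<^sub>R q))) * cis (- ((0 + (1 / \<delta>) *\<^sub>R q) \<bullet> v)) \<partial>lborel)"
      by (rule lborel_integral_affine) (use \<delta> in simp)
    also have "(\<integral>q. of_real (?K * gauss (\<delta> *\<^sub>R (0 + (1 / \<delta>) *\<^sub>R q))) * cis (- ((0 + (1 / \<delta>) *\<^sub>R q) \<bullet> v)) \<partial>lborel)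
        = of_real ?K * (\<integral>q. cis (- (((1 / \<delta>) *\<^sub>R v) \<bullet> q)) * of_real (gauss q) \<partial>lborel)"
      using \<delta> by (simp add: inner_commute mult.commute mult.left_commute flip: integral_mult_right_zero)
    also have "\<dots> = of_real (gauss ((1 / \<delta>) *\<^sub>R v))"
      by (simp only: integral_fourier_gauss) (simp add: gauss_eq)
    finally show ?thesis using \<delta> by (simp add: scaleR_conv_of_real)
  qed
  have "(\<integral>q. of_real (gauss (\<delta> *\<^sub>R q)) * ft f q * cis (q \<bullet> x) \<partial>lborel) = (\<integral>q. \<integral>y. F q y \<partial>lborel \<partial>lborel)"
  proof (intro Bochner_Integration.integral_cong refl)
    fix q
    have "(\<integral>y. F q y \<partial>lborel) = (\<integral>y. of_real (?K * gauss (\<delta> *\<^sub>R q)) * cis (q \<bullet> x) * (cis (- (q \<bullet> y)) * f y) \<partial>lborel)"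
      by (intro Bochner_Integration.integral_cong refl) (simp add: F_def inner_diff_right cis_mult[of "q \<bullet> x" "- (q \<bullet> y)" for y, symmetric, simplified])
    then show "of_real (gauss (\<delta> *\<^sub>R q)) * ft f q * cis (q \<bullet> x) = (\<integral>y. F q y \<partial>lborel)"
      by (simp add: ft_def)
  qed
  also have "\<dots> = (\<integral>y. \<integral>q. F q y \<partial>lborel \<partial>lborel)"
  proof (rule Fubini_dominated)
    show "(\<lambda>(q, y). F q y) \<in> borel_measurable (borel \<Otimes>\<^sub>M borel)" unfolding F_def by measurable
    show "integrable lborel (\<lambda>q::'a. ?K * gauss (\<delta> *\<^sub>R q))" using integrable_gauss_scaled[of \<delta>, where 'a = 'a] \<delta> by simp
    show "integrable lborel (\<lambda>y. norm (f y))" using f by simp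
    show "norm (F q y) \<le> ?K * gauss (\<delta> *\<^sub>R q) * norm (f y)" for q y
      using fourier_const_pos[where 'a = 'a] gauss_pos[of "\<delta> *\<^sub>R q"] by (simp add: F_def norm_mult)
  qed
  also have "\<dots> = (\<integral>y. of_real ((1 / \<delta>) ^ DIM('a) * gauss ((1 / \<delta>) *\<^sub>R (y - x))) * f y \<partial>lborel)"
    by (simp only: F_def integral_mult_left_zero scale)
  also have "\<dots> = (\<integral>y. of_real (gauss y) * f (x + \<delta> *\<^sub>R y) \<partial>lborel)"
  proof -
    have "(\<integral>y. of_real ((1 / \<delta>) ^ DIM('a) * gauss ((1 / \<delta>) *\<^sub>R (y - x))) * f y \<partial>lborel)
      = \<bar>\<delta>\<bar> ^ DIM('a) *\<^sub>R (\<integral>y. of_real ((1 / \<delta>) ^ DIM('a) * gauss ((1 / \<delta>) *\<^sub>R (x + \<delta> *\<^sub>R y - x))) * f (x + \<delta> *\<^sub>R y) \<partial>lborel)"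
      by (rule lborel_integral_affine) (use \<delta> in simp)
    then show ?thesis using \<delta> by (simp add: scaleR_conv_of_real power_divide mult.assoc)
  qed
  finally show ?thesis ..
qed

text \<open>Gaussians of width 1/(n+1) form an approximate identity. Continuity is asked for at x
  only, because the lemma is later applied to indicators of boxes.\<close>

lemma gaussian_mean_tendsto:
  fixes f :: "'a::euclidean_space \<Rightarrow> complex"
  assumes [measurable]: "f \<in> borel_measurable borel" and B: "\<And>x. norm (f x) \<le> B" and x: "isCont f x"
  shows "(\<lambda>n. \<integral>y. of_real (gauss y) * f (x + (1 / real (Suc n)) *\<^sub>R y) \<partial>lborel) \<longlonglongrightarrow> f x"
proof -
  have "(\<lambda>n. \<integral>y. of_real (gauss y) * f (x + (1 / real (Suc n)) *\<^sub>R y) \<partial>lborel) \<longlonglongrightarrow> (\<integral>y. of_real (gauss (y::'a)) * f x \<partial>lborel)"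
  proof (rule integral_dominated_convergence[where w = "\<lambda>y::'a. B * gauss y"])
    show "integrable lborel (\<lambda>y::'a. B * gauss y)" using integrable_gauss[where 'a = 'a] by simp
    show "AE y in lborel. (\<lambda>n. of_real (gauss y) * f (x + (1 / real (Suc n)) *\<^sub>R y)) \<longlonglongrightarrow> of_real (gauss y) * f x"
    proof (rule AE_I2)
      fix y
      have "(\<lambda>n. x + (1 / real (Suc n)) *\<^sub>R y) \<longlonglongrightarrow> x + 0 *\<^sub>R y"
        by (intro tendsto_intros) (rule LIMSEQ_Suc[OF lim_1_over_n])
      then have "(\<lambda>n. f (x + (1 / real (Suc n)) *\<^sub>R y)) \<longlonglongrightarrow> f x"
        using isCont_tendsto_compose[OF x] by simp
      then show "(\<lambda>n. of_real (gauss y) * f (x + (1 / real (Suc n)) *\<^sub>R y)) \<longlonglongrightarrow> of_real (gauss y) * f x"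
        by (intro tendsto_intros)
    qed
    show "AE y in lborel. norm (of_real (gauss y) * f (x + (1 / real (Suc n)) *\<^sub>R y)) \<le> B * gauss y" for n
    proof (rule AE_I2)
      fix y
      show "norm (of_real (gauss y) * f (x + (1 / real (Suc n)) *\<^sub>R y)) \<le> B * gauss y"
        using mult_right_mono[OF B, of "gauss y"] gauss_pos[of y] by (simp add: norm_mult mult.commute)
    qed
  qed simp_all
  moreover have "(\<integral>y. of_real (gauss (y::'a)) * f x \<partial>lborel) = f x"
    using integral_gauss[where 'a = 'a] by simp
  ultimately show ?thesis by (simp only:)
qed

lemma tendsto_gauss_scaled:
  "(\<lambda>n. gauss ((1 / real (Suc n)) *\<^sub>R q)) \<longlonglongrightarrow> fourier_const TYPE('a)" for q :: "'a::euclidean_space"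
proof -
  have "(\<lambda>n. fourier_const TYPE('a) * exp (- (norm ((1 / real (Suc n)) *\<^sub>R q))\<^sup>2 / 2)) \<longlonglongrightarrow> fourier_const TYPE('a) * exp (- (norm (0 *\<^sub>R q))\<^sup>2 / 2)"
    by (intro tendsto_intros LIMSEQ_Suc[OF lim_1_over_n]) simp
  then show ?thesis by (simp add: gauss_eq)
qed

text \<open>Let \<delta> tend to 0 on both sides of \<open>gaussian_mean_eq\<close>: one side is an
  approximate identity at x, the other converges because \<open>ft f\<close> is integrable.\<close>

theorem fourier_inversion:
  fixes f :: "'a::euclidean_space \<Rightarrow> complex"
  assumes f: "integrable lborel f" and B: "\<And>x. norm (f x) \<le> B" and x: "isCont f x"
    and ftf: "integrable lborel (ft f)"
  shows "of_real (fourier_const TYPE('a)) * (\<integral>q. cis (q \<bullet> x) * ft f q \<partial>lborel) = f x"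
proof (rule LIMSEQ_unique)
  let ?K = "fourier_const TYPE('a)"
  have [measurable]: "f \<in> borel_measurable borel" using borel_measurable_integrable[OF f] by simp
  show "(\<lambda>n. \<integral>y. of_real (gauss y) * f (x + (1 / real (Suc n)) *\<^sub>R y) \<partial>lborel) \<longlonglongrightarrow> f x"
    using B x by (intro gaussian_mean_tendsto) auto
  have "(\<lambda>n. \<integral>q. of_real (gauss ((1 / real (Suc n)) *\<^sub>R q)) * ft f q * cis (q \<bullet> x) \<partial>lborel) \<longlonglongrightarrow> (\<integral>q. of_real ?K * ft f q * cis (q \<bullet> x) \<partial>lborel)"
  proof (rule integral_dominated_convergence[where w = "\<lambda>q. ?K * norm (ft f q)"])
    show "AE q in lborel. (\<lambda>n. of_real (gauss ((1 / real (Suc n)) *\<^sub>R q)) * ft f q * cis (q \<bullet> x)) \<longlonglongrightarrow> of_real ?K * ft f q * cis (q \<bullet> x)"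
      by (intro AE_I2 tendsto_intros tendsto_gauss_scaled)
    show "AE q in lborel. norm (of_real (gauss ((1 / real (Suc n)) *\<^sub>R q)) * ft f q * cis (q \<bullet> x)) \<le> ?K * norm (ft f q)" for n
      using gauss_pos[where 'a = 'a] gauss_le[where 'a = 'a]
      by (auto simp: norm_mult fourier_const_def abs_of_pos intro!: AE_I2 mult_right_mono)
  qed (use ftf in simp_all)
  moreover have "(\<integral>q. of_real ?K * ft f q * cis (q \<bullet> x) \<partial>lborel) = of_real ?K * (\<integral>q. cis (q \<bullet> x) * ft f q \<partial>lborel)"
    by (simp add: mult_ac flip: integral_mult_right_zero)
  moreover have "(\<integral>y. of_real (gauss y) * f (x + (1 / real (Suc n)) *\<^sub>R y) \<partial>lborel) = (\<integral>q. of_real (gauss ((1 / real (Suc n)) *\<^sub>R q)) * ft f q * cis (q \<bullet> x) \<partial>lborel)" for n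
    by (rule gaussian_mean_eq[OF f]) simp
  ultimately show "(\<lambda>n. \<integral>y. of_real (gauss y) * f (x + (1 / real (Suc n)) *\<^sub>R y) \<partial>lborel) \<longlonglongrightarrow> of_real ?K * (\<integral>q. cis (q \<bullet> x) * ft f q \<partial>lborel)"
    by (simp only:)
qed

text \<open>A regularised Parseval identity. The Gaussian stays inside because the product of two
  transforms of integrable functions need not be integrable; on the position side it replaces f by
  its Gaussian means.\<close>

lemma ft_pairing_gaussian:
  fixes f k :: "'a::euclidean_space \<Rightarrow> complex"
  assumes f: "integrable lborel f" and k: "integrable lborel k" and \<delta>: "\<delta> > 0"
  shows "(\<integral>q. of_real (gauss (\<delta> *\<^sub>R q)) * ft f q * cnj (ft k q) \<partial>lborel)
       = of_real (fourier_const TYPE('a)) * (\<integral>x. cnj (k x) * (\<integral>y. of_real (gauss y) * f (x + \<delta> *\<^sub>R y) \<partial>lborel) \<partial>lborel)"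
proof -
  let ?K = "fourier_const TYPE('a)"
  have [measurable]: "f \<in> borel_measurable borel" "k \<in> borel_measurable borel"
    using borel_measurable_integrable[OF f] borel_measurable_integrable[OF k] by simp_all
  define F where "F q x = of_real (?K * gauss (\<delta> *\<^sub>R q)) * ft f q * cis (q \<bullet> x) * cnj (k x)" for q x
  have "(\<integral>q. of_real (gauss (\<delta> *\<^sub>R q)) * ft f q * cnj (ft k q) \<partial>lborel) = (\<integral>q. \<integral>x. F q x \<partial>lborel \<partial>lborel)"
    by (simp add: F_def cnj_ft mult_ac flip: integral_mult_right_zero)
  also have "\<dots> = (\<integral>x. \<integral>q. F q x \<partial>lborel \<partial>lborel)"
  proof (rule Fubini_dominated)
    let ?C = "?K * (?K * (\<integral>x. norm (f x) \<partial>lborel))"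
    show "(\<lambda>(q, y). F q y) \<in> borel_measurable (borel \<Otimes>\<^sub>M borel)" unfolding F_def by measurable
    show "integrable lborel (\<lambda>q::'a. ?C * gauss (\<delta> *\<^sub>R q))" using integrable_gauss_scaled[of \<delta>, where 'a = 'a] \<delta> by simp
    show "integrable lborel (\<lambda>y. norm (k y))" using k by simp
    show "norm (F q y) \<le> ?C * gauss (\<delta> *\<^sub>R q) * norm (k y)" for q y
    proof -
      have "norm (F q y) = (?K * gauss (\<delta> *\<^sub>R q) * norm (k y)) * norm (ft f q)"
        using fourier_const_pos[where 'a = 'a] gauss_pos[of "\<delta> *\<^sub>R q"] by (simp add: F_def norm_mult)
      also have "\<dots> \<le> (?K * gauss (\<delta> *\<^sub>R q) * norm (k y)) * (?K * (\<integral>x. norm (f x) \<partial>lborel))"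
        using fourier_const_pos[where 'a = 'a] gauss_pos[of "\<delta> *\<^sub>R q"] by (intro mult_left_mono norm_ft_le) simp
      finally show ?thesis by (simp add: mult_ac)
    qed
  qed
  also have "\<dots> = (\<integral>x. of_real ?K * (cnj (k x) * (\<integral>q. of_real (gauss (\<delta> *\<^sub>R q)) * ft f q * cis (q \<bullet> x) \<partial>lborel)) \<partial>lborel)"
    by (simp add: F_def mult_ac flip: integral_mult_right_zero)
  finally show ?thesis
    by (simp add: gaussian_mean_eq[OF f \<delta>])
qed

text \<open>Free of integrability assumptions, since the left side is 0 when the integral does not
  exist.\<close>

lemma norm_integral_le_nn_integral:
  fixes f :: "'a \<Rightarrow> 'b::{banach,second_countable_topology}"
  shows "ennreal (norm (integral\<^sup>L M f)) \<le> (\<integral>\<^sup>+x. ennreal (norm (f x)) \<partial>M)"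
  by (cases "integrable M f") (simp_all add: integral_norm_bound_ennreal not_integrable_integral_eq)

text \<open>Averaging against a probability density does not increase the L^2 norm. The proof uses
  2xy <= x^2 + y^2 under the integral, translation invariance, and the total mass 1 of
  \<open>gauss\<close>.\<close>

lemma norm_gaussian_mean_le:
  fixes f :: "'a::euclidean_space \<Rightarrow> complex"
  assumes [measurable]: "f \<in> borel_measurable borel"
  shows "ennreal (norm (\<integral>x. cnj (f x) * (\<integral>y. of_real (gauss y) * f (x + \<delta> *\<^sub>R y) \<partial>lborel) \<partial>lborel))
    \<le> (\<integral>\<^sup>+x. ennreal ((norm (f x))\<^sup>2) \<partial>lborel)"
proof -
  let ?N = "\<integral>\<^sup>+x. ennreal ((norm (f x))\<^sup>2 / 2) \<partial>lborel"
  have "ennreal (norm (\<integral>x. cnj (f x) * (\<integral>y. of_real (gauss y) * f (x + \<delta> *\<^sub>R y) \<partial>lborel) \<partial>lborel))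
    \<le> (\<integral>\<^sup>+x. ennreal (norm (cnj (f x) * (\<integral>y. of_real (gauss y) * f (x + \<delta> *\<^sub>R y) \<partial>lborel))) \<partial>lborel)"
    by (rule norm_integral_le_nn_integral)
  also have "\<dots> \<le> (\<integral>\<^sup>+x. \<integral>\<^sup>+y. ennreal (gauss y) * (ennreal ((norm (f x))\<^sup>2 / 2) + ennreal ((norm (f (x + \<delta> *\<^sub>R y)))\<^sup>2 / 2)) \<partial>lborel \<partial>lborel)"
  proof (rule nn_integral_mono)
    fix x :: 'a
    have "ennreal (norm (cnj (f x) * (\<integral>y. of_real (gauss y) * f (x + \<delta> *\<^sub>R y) \<partial>lborel)))
      = ennreal (norm (f x)) * ennreal (norm (\<integral>y. of_real (gauss y) * f (x + \<delta> *\<^sub>R y) \<partial>lborel))"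
      by (simp add: norm_mult ennreal_mult)
    also have "\<dots> \<le> ennreal (norm (f x)) * (\<integral>\<^sup>+y. ennreal (norm (of_real (gauss y) * f (x + \<delta> *\<^sub>R y))) \<partial>lborel)"
      by (intro mult_left_mono norm_integral_le_nn_integral) simp
    also have "\<dots> = (\<integral>\<^sup>+y. ennreal (norm (f x)) * ennreal (norm (of_real (gauss y) * f (x + \<delta> *\<^sub>R y))) \<partial>lborel)"
      by (rule nn_integral_cmult[symmetric]) measurable
    also have "\<dots> \<le> (\<integral>\<^sup>+y. ennreal (gauss y) * (ennreal ((norm (f x))\<^sup>2 / 2) + ennreal ((norm (f (x + \<delta> *\<^sub>R y)))\<^sup>2 / 2)) \<partial>lborel)"
    proof (rule nn_integral_mono)
      fix y :: 'a
      have g: "gauss y \<ge> 0" using gauss_pos[of y] by simp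
      have "norm (f x) * norm (f (x + \<delta> *\<^sub>R y)) \<le> (norm (f x))\<^sup>2 / 2 + (norm (f (x + \<delta> *\<^sub>R y)))\<^sup>2 / 2"
        using sum_squares_bound[of "norm (f x)" "norm (f (x + \<delta> *\<^sub>R y))"] by simp
      then have "norm (f x) * norm (of_real (gauss y) * f (x + \<delta> *\<^sub>R y)) \<le> gauss y * ((norm (f x))\<^sup>2 / 2 + (norm (f (x + \<delta> *\<^sub>R y)))\<^sup>2 / 2)"
        using g mult_left_mono[OF _ g] by (simp add: norm_mult mult.left_commute)
      then show "ennreal (norm (f x)) * ennreal (norm (of_real (gauss y) * f (x + \<delta> *\<^sub>R y))) \<le> ennreal (gauss y) * (ennreal ((norm (f x))\<^sup>2 / 2) + ennreal ((norm (f (x + \<delta> *\<^sub>R y)))\<^sup>2 / 2))"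
        using g by (simp flip: ennreal_mult ennreal_plus)
    qed
    finally show "ennreal (norm (cnj (f x) * (\<integral>y. of_real (gauss y) * f (x + \<delta> *\<^sub>R y) \<partial>lborel)))
      \<le> (\<integral>\<^sup>+y. ennreal (gauss y) * (ennreal ((norm (f x))\<^sup>2 / 2) + ennreal ((norm (f (x + \<delta> *\<^sub>R y)))\<^sup>2 / 2)) \<partial>lborel)" .
  qed
  also have "\<dots> = (\<integral>\<^sup>+y. \<integral>\<^sup>+x. ennreal (gauss y) * (ennreal ((norm (f x))\<^sup>2 / 2) + ennreal ((norm (f (x + \<delta> *\<^sub>R y)))\<^sup>2 / 2)) \<partial>lborel \<partial>lborel)"
    by (rule lborel_pair.Fubini'[symmetric]) measurable
  also have "\<dots> = (\<integral>\<^sup>+y. ennreal (gauss (y::'a)) * (?N + ?N) \<partial>lborel)"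
  proof (rule nn_integral_cong)
    fix y :: 'a
    have "(\<integral>\<^sup>+x. ennreal ((norm (f (x + \<delta> *\<^sub>R y)))\<^sup>2 / 2) \<partial>lborel) = ?N"
      using nn_integral_lborel_affine[of "\<lambda>x. ennreal ((norm (f x))\<^sup>2 / 2)" 1 "\<delta> *\<^sub>R y"] by (simp add: add.commute)
    then show "(\<integral>\<^sup>+x. ennreal (gauss y) * (ennreal ((norm (f x))\<^sup>2 / 2) + ennreal ((norm (f (x + \<delta> *\<^sub>R y)))\<^sup>2 / 2)) \<partial>lborel) = ennreal (gauss y) * (?N + ?N)"
      by (simp add: nn_integral_cmult nn_integral_add)
  qed
  also have "\<dots> = ?N + ?N"
    by (simp add: nn_integral_multc nn_integral_gauss)
  also have "\<dots> = (\<integral>\<^sup>+x. ennreal ((norm (f x))\<^sup>2) \<partial>lborel)"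
    by (simp flip: nn_integral_add ennreal_plus)
  finally show ?thesis .
qed

text \<open>The inequality half of Plancherel. The regularised pairing of f with itself is bounded
  by the squared norm of f uniformly in \<delta>; Fatou removes the regularisation, and the factor
  \<open>fourier_const\<close> on both sides cancels.\<close>

theorem bessel_ft:
  fixes f :: "'a::euclidean_space \<Rightarrow> complex"
  assumes f: "integrable lborel f"
  shows "(\<integral>\<^sup>+p. ennreal ((norm (ft f p))\<^sup>2) \<partial>lborel) \<le> (\<integral>\<^sup>+x. ennreal ((norm (f x))\<^sup>2) \<partial>lborel)" (is "?L \<le> ?R")
proof -
  let ?K = "fourier_const TYPE('a)"
  have [measurable]: "f \<in> borel_measurable borel" using borel_measurable_integrable[OF f] by simp
  define g where "g n q = gauss ((1 / real (Suc n)) *\<^sub>R q) * (norm (ft f q))\<^sup>2" for n and q :: 'a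
  have [measurable]: "g n \<in> borel_measurable borel" for n unfolding g_def by measurable
  have g0: "g n q \<ge> 0" for n q using gauss_pos[of "(1 / real (Suc n)) *\<^sub>R q"] by (simp add: g_def)
  have le: "(\<integral>\<^sup>+q. ennreal (g n q) \<partial>lborel) \<le> ennreal ?K * ?R" for n
  proof -
    let ?\<delta> = "1 / real (Suc n)"
    let ?B = "?K * (\<integral>x. norm (f x) \<partial>lborel)"
    have int: "integrable lborel (g n)"
    proof (rule Bochner_Integration.integrable_bound[where f = "\<lambda>q::'a. ?B\<^sup>2 * gauss (?\<delta> *\<^sub>R q)"])
      show "integrable lborel (\<lambda>q::'a. ?B\<^sup>2 * gauss (?\<delta> *\<^sub>R q))"
        using integrable_gauss_scaled[of ?\<delta>, where 'a = 'a] by simp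
      show "AE q in lborel. norm (g n q) \<le> norm (?B\<^sup>2 * gauss (?\<delta> *\<^sub>R q))"
      proof (rule AE_I2)
        fix q :: 'a
        have "(norm (ft f q))\<^sup>2 \<le> ?B\<^sup>2" by (intro power_mono norm_ft_le) simp
        then have "g n q \<le> ?B\<^sup>2 * gauss (?\<delta> *\<^sub>R q)"
          using gauss_pos[of "?\<delta> *\<^sub>R q"] unfolding g_def by (simp add: mult.commute mult_left_mono)
        then show "norm (g n q) \<le> norm (?B\<^sup>2 * gauss (?\<delta> *\<^sub>R q))" using g0[of n q] by simp
      qed
    qed simp
    have "complex_of_real (\<integral>q. g n q \<partial>lborel) = (\<integral>q. complex_of_real (g n q) \<partial>lborel)" by simp
    also have "\<dots> = (\<integral>q. of_real (gauss (?\<delta> *\<^sub>R q)) * ft f q * cnj (ft f q) \<partial>lborel)"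
      by (intro Bochner_Integration.integral_cong refl)
        (simp only: g_def of_real_mult complex_norm_square mult.assoc)
    also have "\<dots> = of_real ?K * (\<integral>x. cnj (f x) * (\<integral>y. of_real (gauss y) * f (x + ?\<delta> *\<^sub>R y) \<partial>lborel) \<partial>lborel)"
      by (rule ft_pairing_gaussian[OF f f]) simp
    finally have "norm (complex_of_real (\<integral>q. g n q \<partial>lborel)) = ?K * norm (\<integral>x. cnj (f x) * (\<integral>y. of_real (gauss y) * f (x + ?\<delta> *\<^sub>R y) \<partial>lborel) \<partial>lborel)"
      using fourier_const_pos[where 'a = 'a] by (simp add: norm_mult)
    then have "(\<integral>q. g n q \<partial>lborel) = ?K * norm (\<integral>x. cnj (f x) * (\<integral>y. of_real (gauss y) * f (x + ?\<delta> *\<^sub>R y) \<partial>lborel) \<partial>lborel)"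
      using g0 by (simp add: integral_nonneg)
    then have "(\<integral>\<^sup>+q. ennreal (g n q) \<partial>lborel) = ennreal ?K * ennreal (norm (\<integral>x. cnj (f x) * (\<integral>y. of_real (gauss y) * f (x + ?\<delta> *\<^sub>R y) \<partial>lborel) \<partial>lborel))"
      using g0 fourier_const_pos[where 'a = 'a]
      by (subst nn_integral_eq_integral[OF int]) (auto simp: ennreal_mult)
    also have "\<dots> \<le> ennreal ?K * ?R" by (intro mult_left_mono norm_gaussian_mean_le) simp_all
    finally show ?thesis .
  qed
  have "ennreal ?K * ?L = (\<integral>\<^sup>+q. ennreal (?K * (norm (ft f q))\<^sup>2) \<partial>lborel)"
    using fourier_const_pos[where 'a = 'a] by (simp add: ennreal_mult nn_integral_cmult)
  also have "\<dots> = (\<integral>\<^sup>+q. liminf (\<lambda>n. ennreal (g n q)) \<partial>lborel)"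
  proof (rule nn_integral_cong)
    fix q :: 'a
    have "(\<lambda>n. g n q) \<longlonglongrightarrow> ?K * (norm (ft f q))\<^sup>2"
      unfolding g_def by (intro tendsto_intros tendsto_gauss_scaled)
    then show "ennreal (?K * (norm (ft f q))\<^sup>2) = liminf (\<lambda>n. ennreal (g n q))"
      by (intro lim_imp_Liminf[symmetric] tendsto_ennrealI) auto
  qed
  also have "\<dots> \<le> liminf (\<lambda>n. \<integral>\<^sup>+q. ennreal (g n q) \<partial>lborel)"
    by (rule nn_integral_liminf) simp
  also have "\<dots> \<le> ennreal ?K * ?R"
    by (rule Liminf_le) (auto simp: le)
  finally show ?thesis
    using fourier_const_pos[where 'a = 'a]
    by (metis ennreal_mult_le_mult_iff ennreal_less_zero_iff ennreal_neq_top less_irrefl)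
qed

text \<open>The pairing of k with the indicator of a box, as the regularisation is removed. The
  Gaussian means of the indicator converge at its continuity points, that is off the
  boundary.\<close>

lemma ft_pairing_box:
  fixes k :: "'a::euclidean_space \<Rightarrow> complex"
  assumes k: "integrable lborel k"
  shows "(\<lambda>n. \<integral>q. of_real (gauss ((1 / real (Suc n)) *\<^sub>R q)) * ft (indicator (box a b)) q * cnj (ft k q) \<partial>lborel)
    \<longlonglongrightarrow> of_real (fourier_const TYPE('a)) * (\<integral>x. cnj (k x) * indicator (box a b) x \<partial>lborel)"
proof -
  let ?K = "fourier_const TYPE('a)" and ?I = "indicator (box a b) :: 'a \<Rightarrow> complex"
  have [measurable]: "k \<in> borel_measurable borel" using borel_measurable_integrable[OF k] by simp
  have "integrable lborel (\<lambda>x. complex_of_real (indicator (box a b) x))"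
    by (intro integrable_of_real integrable_real_indicator) (simp_all add: emeasure_lborel_box_eq)
  moreover have "complex_of_real (indicator (box a b) x) = ?I x" for x by (simp add: indicator_def)
  ultimately have i1: "integrable lborel ?I" by simp
  have "(\<lambda>n. \<integral>x. cnj (k x) * (\<integral>y. of_real (gauss y) * ?I (x + (1 / real (Suc n)) *\<^sub>R y) \<partial>lborel) \<partial>lborel)
    \<longlonglongrightarrow> (\<integral>x. cnj (k x) * ?I x \<partial>lborel)"
  proof (rule integral_dominated_convergence[where w = "\<lambda>x. norm (k x)"])
    \<comment> \<open>The boundary of a convex set is negligible, which gives the convergence almost
      everywhere.\<close>
    have "negligible (frontier (box a b))" by (intro negligible_convex_frontier convex_box)
    then have "AE x in lebesgue. x \<notin> frontier (box a b)"
      by (simp add: negligible_iff_null_sets AE_not_in)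
    then have "AE x in lborel. x \<notin> frontier (box a b)"
      by (simp add: AE_completion_iff)
    then show "AE x in lborel. (\<lambda>n. cnj (k x) * (\<integral>y. of_real (gauss y) * ?I (x + (1 / real (Suc n)) *\<^sub>R y) \<partial>lborel)) \<longlonglongrightarrow> cnj (k x) * ?I x"
    proof eventually_elim
      case (elim x)
      then have "isCont (indicator (box a b) :: 'a \<Rightarrow> real) x" by (simp add: isCont_indicator)
      then have "isCont (\<lambda>x. complex_of_real (indicator (box a b) x)) x" by (rule isCont_of_real)
      moreover have "(\<lambda>x. complex_of_real (indicator (box a b) x)) = ?I" by (auto simp: indicator_def)
      ultimately have "isCont ?I x" by metis
      moreover have "norm (?I y) \<le> 1" for y by (simp add: indicator_def)
      ultimately show ?case
        by (intro tendsto_intros gaussian_mean_tendsto[where B = 1]) simp_all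
    qed
    show "(\<lambda>x. cnj (k x) * ?I x) \<in> borel_measurable lborel" by measurable
    show "(\<lambda>x. cnj (k x) * (\<integral>y. of_real (gauss y) * ?I (x + (1 / real (Suc n)) *\<^sub>R y) \<partial>lborel)) \<in> borel_measurable lborel" for n
    proof -
      have I: "?I \<in> borel_measurable borel" by simp
      have "(\<lambda>(x, y). complex_of_real (gauss y) * ?I (x + (1 / real (Suc n)) *\<^sub>R y)) \<in> borel_measurable (borel \<Otimes>\<^sub>M lborel)"
        using measurable_compose[OF _ I, of "\<lambda>(x, y). x + (1 / real (Suc n)) *\<^sub>R y"] by (simp add: case_prod_unfold)
      then have "(\<lambda>x. \<integral>y. of_real (gauss y) * ?I (x + (1 / real (Suc n)) *\<^sub>R y) \<partial>lborel) \<in> borel_measurable borel"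
        by (rule lborel.borel_measurable_lebesgue_integral)
      moreover have "(\<lambda>x. cnj (k x)) \<in> borel_measurable borel" by measurable
      ultimately show ?thesis unfolding measurable_lborel2 by (intro borel_measurable_times)
    qed
    show "AE x in lborel. norm (cnj (k x) * (\<integral>y. of_real (gauss y) * ?I (x + (1 / real (Suc n)) *\<^sub>R y) \<partial>lborel)) \<le> norm (k x)" for n
    proof (rule AE_I2)
      fix x
      have "norm (\<integral>y. of_real (gauss y) * ?I (x + (1 / real (Suc n)) *\<^sub>R y) \<partial>lborel)
          \<le> (\<integral>y. norm (of_real (gauss y) * ?I (x + (1 / real (Suc n)) *\<^sub>R y)) \<partial>lborel)" by (rule integral_norm_bound)
      also have "\<dots> \<le> (\<integral>y. gauss (y::'a) \<partial>lborel)"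
      proof (rule integral_mono')
        show "norm (of_real (gauss y) * ?I (x + (1 / real (Suc n)) *\<^sub>R y)) \<le> gauss y" for y
          using gauss_pos[of y] by (simp add: norm_mult indicator_def)
        show "0 \<le> gauss y" for y :: 'a using gauss_pos[of y] by simp
      qed (rule integrable_gauss)
      finally show "norm (cnj (k x) * (\<integral>y. of_real (gauss y) * ?I (x + (1 / real (Suc n)) *\<^sub>R y) \<partial>lborel)) \<le> norm (k x)"
        by (simp add: integral_gauss norm_mult mult_left_le)
    qed
    show "integrable lborel (\<lambda>x. norm (k x))" using k by (rule integrable_norm)
  qed
  then have "(\<lambda>n. of_real ?K * (\<integral>x. cnj (k x) * (\<integral>y. of_real (gauss y) * ?I (x + (1 / real (Suc n)) *\<^sub>R y) \<partial>lborel) \<partial>lborel))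
    \<longlonglongrightarrow> of_real ?K * (\<integral>x. cnj (k x) * ?I x \<partial>lborel)"
    by (rule tendsto_mult_left)
  moreover have "(\<integral>q. of_real (gauss ((1 / real (Suc n)) *\<^sub>R q)) * ft ?I q * cnj (ft k q) \<partial>lborel)
      = of_real ?K * (\<integral>x. cnj (k x) * (\<integral>y. of_real (gauss y) * ?I (x + (1 / real (Suc n)) *\<^sub>R y) \<partial>lborel) \<partial>lborel)" for n
    by (rule ft_pairing_gaussian[OF i1 k]) simp
  ultimately show ?thesis by (simp only:)
qed

text \<open>The weighted inequality 2xy <= l x^2 + y^2 / l stands in for Cauchy-Schwarz, so only
  nonnegative integrals occur. Bessel's inequality bounds the transform of the indicator by the
  volume of the box.\<close>

lemma box_integral_le_ft:
  fixes k :: "'a::euclidean_space \<Rightarrow> complex"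
  assumes k: "integrable lborel k" and l: "l > 0"
  shows "ennreal (2 * norm (\<integral>x. k x * indicator (box a b) x \<partial>lborel))
    \<le> ennreal l * emeasure lborel (box a b) + ennreal (1 / l) * (\<integral>\<^sup>+p. ennreal ((norm (ft k p))\<^sup>2) \<partial>lborel)"
proof -
  let ?K = "fourier_const TYPE('a)" and ?I = "indicator (box a b) :: 'a \<Rightarrow> complex"
  have [measurable]: "k \<in> borel_measurable borel" using borel_measurable_integrable[OF k] by simp
  have "integrable lborel (\<lambda>x. complex_of_real (indicator (box a b) x))"
    by (intro integrable_of_real integrable_real_indicator) (simp_all add: emeasure_lborel_box_eq)
  moreover have ofI: "complex_of_real (indicator (box a b) x) = ?I x" for x by (simp add: indicator_def)
  ultimately have i1: "integrable lborel ?I" by simp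
  define J where "J = (\<integral>\<^sup>+q. ennreal (norm (ft ?I q) * norm (ft k q)) \<partial>lborel)"
  have cnjk: "norm (\<integral>x. cnj (k x) * ?I x \<partial>lborel) = norm (\<integral>x. k x * ?I x \<partial>lborel)"
  proof -
    have "cnj (\<integral>x. k x * ?I x \<partial>lborel) = (\<integral>x. cnj (k x * ?I x) \<partial>lborel)"
      by (rule Bochner_Integration.integral_cnj[symmetric])
    also have "\<dots> = (\<integral>x. cnj (k x) * ?I x \<partial>lborel)"
      by (intro Bochner_Integration.integral_cong) (auto simp: indicator_def)
    finally show ?thesis by (metis complex_mod_cnj)
  qed
  have "ennreal ?K * ennreal (norm (\<integral>x. k x * ?I x \<partial>lborel)) \<le> ennreal ?K * J"
  proof (rule LIMSEQ_le_const2)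
    show "(\<lambda>n. ennreal (norm (\<integral>q. of_real (gauss ((1 / real (Suc n)) *\<^sub>R q)) * ft ?I q * cnj (ft k q) \<partial>lborel))) \<longlonglongrightarrow> ennreal ?K * ennreal (norm (\<integral>x. k x * ?I x \<partial>lborel))"
      using tendsto_ennrealI[OF tendsto_norm[OF ft_pairing_box[OF k, of a b]]] fourier_const_pos[where 'a = 'a]
      by (simp add: norm_mult ennreal_mult cnjk del: complex_cnj_cancel_iff)
    have "ennreal (norm (\<integral>q. of_real (gauss ((1 / real (Suc n)) *\<^sub>R q)) * ft ?I q * cnj (ft k q) \<partial>lborel)) \<le> ennreal ?K * J" for n
    proof -
      have "ennreal (norm (\<integral>q. of_real (gauss ((1 / real (Suc n)) *\<^sub>R q)) * ft ?I q * cnj (ft k q) \<partial>lborel))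
        \<le> (\<integral>\<^sup>+q. ennreal (norm (of_real (gauss ((1 / real (Suc n)) *\<^sub>R q)) * ft ?I q * cnj (ft k q))) \<partial>lborel)"
        by (rule norm_integral_le_nn_integral)
      also have "\<dots> \<le> (\<integral>\<^sup>+q. ennreal (?K * (norm (ft ?I q) * norm (ft k q))) \<partial>lborel)"
      proof (intro nn_integral_mono ennreal_leI)
        fix q :: 'a
        have "gauss ((1 / real (Suc n)) *\<^sub>R q) * (norm (ft ?I q) * norm (ft k q)) \<le> ?K * (norm (ft ?I q) * norm (ft k q))"
          unfolding fourier_const_def by (intro mult_right_mono gauss_le) simp
        then show "norm (of_real (gauss ((1 / real (Suc n)) *\<^sub>R q)) * ft ?I q * cnj (ft k q)) \<le> ?K * (norm (ft ?I q) * norm (ft k q))"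
          using gauss_pos[of "(1 / real (Suc n)) *\<^sub>R q"] by (simp add: norm_mult abs_of_pos mult.assoc)
      qed
      also have "\<dots> = ennreal ?K * J"
        using fourier_const_pos[where 'a = 'a] by (simp add: J_def ennreal_mult nn_integral_cmult)
      finally show ?thesis .
    qed
    then show "\<exists>N. \<forall>n\<ge>N. ennreal (norm (\<integral>q. of_real (gauss ((1 / real (Suc n)) *\<^sub>R q)) * ft ?I q * cnj (ft k q) \<partial>lborel)) \<le> ennreal ?K * J"
      by blast
  qed
  then have le: "ennreal (norm (\<integral>x. k x * ?I x \<partial>lborel)) \<le> J"
    using fourier_const_pos[where 'a = 'a]
    by (metis ennreal_mult_le_mult_iff ennreal_less_zero_iff ennreal_neq_top less_irrefl)
  have "ennreal (2 * norm (\<integral>x. k x * ?I x \<partial>lborel)) = 2 * ennreal (norm (\<integral>x. k x * ?I x \<partial>lborel))"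
    by (simp add: ennreal_mult)
  also have "\<dots> \<le> 2 * J" by (intro mult_left_mono le) simp
  also have "\<dots> = (\<integral>\<^sup>+q. ennreal (2 * (norm (ft ?I q) * norm (ft k q))) \<partial>lborel)"
    by (simp add: J_def ennreal_mult nn_integral_cmult)
  also have "\<dots> \<le> (\<integral>\<^sup>+q. ennreal l * ennreal ((norm (ft ?I q))\<^sup>2) + ennreal (1 / l) * ennreal ((norm (ft k q))\<^sup>2) \<partial>lborel)"
  proof (rule nn_integral_mono)
    fix q :: 'a
    have "2 * (sqrt l * norm (ft ?I q)) * (norm (ft k q) / sqrt l) \<le> (sqrt l * norm (ft ?I q))\<^sup>2 + (norm (ft k q) / sqrt l)\<^sup>2"
      by (rule sum_squares_bound)
    then have "2 * (norm (ft ?I q) * norm (ft k q)) \<le> l * (norm (ft ?I q))\<^sup>2 + 1 / l * (norm (ft k q))\<^sup>2"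
      using l by (simp add: power_mult_distrib power_divide)
    then show "ennreal (2 * (norm (ft ?I q) * norm (ft k q))) \<le> ennreal l * ennreal ((norm (ft ?I q))\<^sup>2) + ennreal (1 / l) * ennreal ((norm (ft k q))\<^sup>2)"
      using l by (simp flip: ennreal_mult ennreal_plus)
  qed
  also have "\<dots> = ennreal l * (\<integral>\<^sup>+q. ennreal ((norm (ft ?I q))\<^sup>2) \<partial>lborel) + ennreal (1 / l) * (\<integral>\<^sup>+q. ennreal ((norm (ft k q))\<^sup>2) \<partial>lborel)"
    by (simp add: nn_integral_add nn_integral_cmult)
  also have "\<dots> \<le> ennreal l * emeasure lborel (box a b) + ennreal (1 / l) * (\<integral>\<^sup>+q. ennreal ((norm (ft k q))\<^sup>2) \<partial>lborel)"
  proof (intro add_right_mono mult_left_mono)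
    have "(\<integral>\<^sup>+q. ennreal ((norm (ft ?I q))\<^sup>2) \<partial>lborel) \<le> (\<integral>\<^sup>+x. ennreal ((norm (?I x))\<^sup>2) \<partial>lborel)"
      by (rule bessel_ft[OF i1])
    also have "\<dots> = (\<integral>\<^sup>+x. indicator (box a b) x \<partial>lborel)"
      by (intro nn_integral_cong) (auto simp: indicator_def)
    finally show "(\<integral>\<^sup>+q. ennreal ((norm (ft ?I q))\<^sup>2) \<partial>lborel) \<le> emeasure lborel (box a b)"
      by simp
  qed simp
  finally show ?thesis .
qed

text \<open>Boxes are stable under intersection and generate the Borel sets, so vanishing integrals
  propagate to all Borel sets by induction over complements and disjoint unions.\<close>

lemma AE_zero_of_box_integrals_zero:
  fixes k :: "'a::euclidean_space \<Rightarrow> complex"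
  assumes k: "integrable lborel k" and box: "\<And>a b. (\<integral>x. k x * indicator (box a b) x \<partial>lborel) = 0"
  shows "AE x in lborel. k x = 0"
proof (rule sigma_finite_measure.density_zero[OF sigma_finite_lborel k])
  have [measurable]: "k \<in> borel_measurable borel" using borel_measurable_integrable[OF k] by simp
  have kA: "set_integrable lborel A k" if "A \<in> sets borel" for A
    unfolding set_integrable_def using k that by (intro integrable_mult_indicator) auto
  have sI: "set_lebesgue_integral lborel A k = (\<integral>x. k x * indicator A x \<partial>lborel)" for A
    unfolding set_lebesgue_integral_def by (intro Bochner_Integration.integral_cong) (auto simp: indicator_def)
  \<comment> \<open>The complement case subtracts from the integral over the whole space, which is
    reached by exhausting it with boxes.\<close>
  have UNIV0: "set_lebesgue_integral lborel UNIV k = 0"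
  proof (rule LIMSEQ_unique)
    let ?A = "\<lambda>n::nat. box (- (real n *\<^sub>R One)) (real n *\<^sub>R One) :: 'a set"
    have U: "(\<Union>i. ?A i) = UNIV" by (rule UN_box_eq_UNIV)
    have inc: "incseq ?A"
    proof (rule incseq_SucI, rule subsetI)
      fix n x assume "x \<in> ?A n"
      then have "- real n < x \<bullet> b \<and> x \<bullet> b < real n" if "b \<in> Basis" for b
        using that by (simp add: mem_box)
      then have "- real (Suc n) < x \<bullet> b \<and> x \<bullet> b < real (Suc n)" if "b \<in> Basis" for b
        using that by force
      then show "x \<in> ?A (Suc n)" by (simp add: mem_box)
    qed
    have "(\<lambda>n. set_lebesgue_integral lborel (?A n) k) \<longlonglongrightarrow> set_lebesgue_integral lborel (\<Union>i. ?A i) k"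
      by (rule set_integral_cont_up) (use inc kA in auto)
    then show "(\<lambda>n. set_lebesgue_integral lborel (?A n) k) \<longlonglongrightarrow> set_lebesgue_integral lborel UNIV k"
      using U by simp
    have "set_lebesgue_integral lborel (?A n) k = 0" for n
      unfolding sI by (rule box)
    then show "(\<lambda>n. set_lebesgue_integral lborel (?A n) k) \<longlonglongrightarrow> 0" by simp
  qed
  fix A :: "'a set" assume "A \<in> sets lborel"
  then have A: "A \<in> sigma_sets UNIV (range (\<lambda>(a, b). box a b))"
    by (simp add: borel_eq_box)
  have "Int_stable (range (\<lambda>(a, b). box a b :: 'a set))"
    by (auto simp: Int_stable_def box_Int_box)
  moreover have "range (\<lambda>(a, b). box a b :: 'a set) \<subseteq> Pow UNIV" by simp
  ultimately show "set_lebesgue_integral lborel A k = 0"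
    using A
  proof (induction rule: sigma_sets_induct_disjoint)
    case (basic A)
    then show ?case unfolding sI using box by auto
  next
    case (compl A)
    then have A: "A \<in> sets borel" by (simp add: borel_eq_box)
    have "set_lebesgue_integral lborel UNIV k = set_lebesgue_integral lborel (A \<union> (UNIV - A)) k"
      by (simp add: Un_Diff_cancel)
    also have "\<dots> = set_lebesgue_integral lborel A k + set_lebesgue_integral lborel (UNIV - A) k"
      by (rule set_integral_Un) (use A kA in auto)
    finally show ?case using UNIV0 compl by simp
  next
    case (union A)
    then have A: "A i \<in> sets borel" for i by (auto simp: borel_eq_box)
    have "set_lebesgue_integral lborel (\<Union>i. A i) k = (\<Sum>i. set_lebesgue_integral lborel (A i) k)"
      by (rule lebesgue_integral_countable_add) (use union A kA in \<open>auto simp: disjoint_family_on_def\<close>)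
    then show ?case using union by simp
  qed (simp_all add: sI)
qed

text \<open>Uniqueness in the form that fits the definition of \<open>fourier\<close>, for h
  integrable on balls only. Truncation does not affect the integral over a fixed box once n is
  large; n goes to infinity first, then l to 0.\<close>

theorem AE_zero_of_truncated_ft_tendsto_zero:
  fixes h :: "'a::euclidean_space \<Rightarrow> complex"
  assumes int: "\<And>n::nat. integrable lborel (\<lambda>x. indicator (ball 0 (real n)) x *\<^sub>R h x)"
    and lim: "(\<lambda>n. \<integral>\<^sup>+p. ennreal ((norm (ft (\<lambda>x. indicator (ball 0 (real n)) x *\<^sub>R h x) p))\<^sup>2) \<partial>lborel) \<longlonglongrightarrow> 0"
  shows "AE x in lborel. h x = 0"
proof -
  let ?h = "\<lambda>n x. indicator (ball 0 (real n)) x *\<^sub>R h x"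
  have box0: "(\<integral>x. h x * indicator (box a b) x \<partial>lborel) = 0" for a b
  proof -
    define V where "V = norm (\<integral>x. h x * indicator (box a b) x \<partial>lborel)"
    obtain N0 :: nat where N0: "box a b \<subseteq> ball 0 (real N0)"
    proof -
      have "bounded (box a b)" by simp
      then obtain r where "box a b \<subseteq> ball 0 r" by (meson bounded_subset_ballD)
      moreover obtain n :: nat where "r \<le> real n" using real_arch_simple by blast
      ultimately show ?thesis using that[of n] by (meson order_trans subset_ball)
    qed
    have eq: "(\<integral>x. ?h n x * indicator (box a b) x \<partial>lborel) = (\<integral>x. h x * indicator (box a b) x \<partial>lborel)" if "n \<ge> N0" for n
    proof -
      have "box a b \<subseteq> ball 0 (real n)" using N0 that by (meson order_trans subset_ball of_nat_mono)
      then show ?thesis by (intro Bochner_Integration.integral_cong) (auto simp: indicator_def)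
    qed
    have "2 * V \<le> l * measure lborel (box a b)" if l: "l > 0" for l
    proof -
      have "ennreal (2 * V) \<le> ennreal l * emeasure lborel (box a b) + ennreal (1 / l) * 0"
      proof (rule LIMSEQ_le_const)
        show "(\<lambda>n. ennreal l * emeasure lborel (box a b) + ennreal (1 / l) * (\<integral>\<^sup>+p. ennreal ((norm (ft (?h n) p))\<^sup>2) \<partial>lborel))
          \<longlonglongrightarrow> ennreal l * emeasure lborel (box a b) + ennreal (1 / l) * 0"
          by (intro tendsto_add tendsto_const ennreal_tendsto_cmult lim) simp
        show "\<exists>N. \<forall>n\<ge>N. ennreal (2 * V) \<le> ennreal l * emeasure lborel (box a b) + ennreal (1 / l) * (\<integral>\<^sup>+p. ennreal ((norm (ft (?h n) p))\<^sup>2) \<partial>lborel)"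
        proof (intro exI[of _ N0] allI impI)
          fix n assume "n \<ge> N0"
          from box_integral_le_ft[OF int l, of n a b, unfolded eq[OF this]]
          show "ennreal (2 * V) \<le> ennreal l * emeasure lborel (box a b) + ennreal (1 / l) * (\<integral>\<^sup>+p. ennreal ((norm (ft (?h n) p))\<^sup>2) \<partial>lborel)"
            unfolding V_def .
        qed
      qed
      also have "emeasure lborel (box a b) = ennreal (measure lborel (box a b))"
        by (intro emeasure_eq_ennreal_measure) (simp add: emeasure_lborel_box_eq)
      finally show ?thesis using l by (simp flip: ennreal_mult)
    qed
    note bnd = this
    have "V \<le> 0"
    proof (rule ccontr)
      assume "\<not> V \<le> 0"
      then have V: "V > 0" by simp
      \<comment> \<open>The choice l = V / (volume + 1) makes the right side at most V.\<close>
      have "2 * V \<le> V / (measure lborel (box a b) + 1) * measure lborel (box a b)"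
        using V by (intro bnd) (simp add: add_nonneg_pos)
      also have "\<dots> \<le> V" using V by (simp add: divide_simps add_nonneg_pos mult_left_mono)
      finally show False using V by simp
    qed
    then show ?thesis by (simp add: V_def)
  qed
  \<comment> \<open>The preceding lemma needs an integrable function, so it is applied on each of
    countably many boxes that exhaust the space.\<close>
  have "AE x in lborel. indicator (box (- (real m *\<^sub>R One)) (real m *\<^sub>R One)) x *\<^sub>R h x = 0" for m :: nat
  proof (rule AE_zero_of_box_integrals_zero)
    let ?A = "box (- (real m *\<^sub>R One)) (real m *\<^sub>R One) :: 'a set"
    obtain n :: nat where n: "?A \<subseteq> ball 0 (real n)"
    proof -
      have "bounded ?A" by simp
      then obtain r where "?A \<subseteq> ball 0 r" by (meson bounded_subset_ballD)
      moreover obtain n :: nat where "r \<le> real n" using real_arch_simple by blast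
      ultimately show ?thesis using that[of n] by (meson order_trans subset_ball)
    qed
    have "integrable lborel (\<lambda>x. indicator ?A x *\<^sub>R ?h n x)"
      by (rule integrable_mult_indicator) (use int in auto)
    moreover have "indicator ?A x *\<^sub>R ?h n x = indicator ?A x *\<^sub>R h x" for x
      using n by (auto simp: indicator_def)
    ultimately show "integrable lborel (\<lambda>x. indicator ?A x *\<^sub>R h x)" by (simp only:)
    fix a b
    obtain c d where "?A \<inter> box a b = box c d"
      using box_Int_box by blast
    then have "(indicator ?A x *\<^sub>R h x) * indicator (box a b) x = h x * indicator (box c d) x" for x
      by (auto simp: indicator_def[abs_def] simp flip: \<open>?A \<inter> box a b = box c d\<close>)
    then show "(\<integral>x. (indicator ?A x *\<^sub>R h x) * indicator (box a b) x \<partial>lborel) = 0"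
      using box0 by simp
  qed
  then have "AE x in lborel. \<forall>m::nat. indicator (box (- (real m *\<^sub>R One)) (real m *\<^sub>R One)) x *\<^sub>R h x = 0"
    by (subst AE_all_countable) blast
  then show ?thesis
  proof eventually_elim
    case (elim x)
    have "x \<in> (\<Union>m::nat. box (- (real m *\<^sub>R One)) (real m *\<^sub>R One))" by (simp add: UN_box_eq_UNIV)
    then obtain m :: nat where "x \<in> box (- (real m *\<^sub>R One)) (real m *\<^sub>R One)" by blast
    with elim[rule_format, of m] show ?case by simp
  qed
qed

text \<open>Riesz-Fischer: a fast subsequence converges almost everywhere, and Fatou turns the
  Cauchy estimate into convergence of the whole sequence.\<close>

theorem L2_complete:
  fixes G :: "nat \<Rightarrow> 'a \<Rightarrow> 'b::{banach,second_countable_topology}"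
  assumes G[measurable]: "\<And>n. G n \<in> borel_measurable M"
    and Cauchy: "\<And>e. e > 0 \<Longrightarrow> \<exists>N. \<forall>m\<ge>N. \<forall>n\<ge>N. (\<integral>\<^sup>+x. ennreal ((norm (G m x - G n x))\<^sup>2) \<partial>M) \<le> ennreal e"
  obtains g where "g \<in> borel_measurable M" "(\<lambda>n. \<integral>\<^sup>+x. ennreal ((norm (G n x - g x))\<^sup>2) \<partial>M) \<longlonglongrightarrow> 0"
proof -
  have "\<exists>N. \<forall>k. \<forall>m\<ge>N k. \<forall>n\<ge>N k. (\<integral>\<^sup>+x. ennreal ((norm (G m x - G n x))\<^sup>2) \<partial>M) \<le> ennreal ((1/4)^k)"
    using Cauchy by (intro choice allI) simp
  then obtain N :: "nat \<Rightarrow> nat" where N: "\<And>k m n. m \<ge> N k \<Longrightarrow> n \<ge> N k \<Longrightarrow> (\<integral>\<^sup>+x. ennreal ((norm (G m x - G n x))\<^sup>2) \<partial>M) \<le> ennreal ((1/4)^k)"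
    by blast
  \<comment> \<open>Adding up all earlier thresholds makes \<open>R k\<close> exceed every
    \<open>N j\<close> with j <= k, so the thresholds themselves need not be monotone.\<close>
  define R where "R k = k + (\<Sum>j\<le>k. N j)" for k
  have RN: "N j \<le> R k" if "j \<le> k" for j k
    using that member_le_sum[of j "{..k}" N] by (simp add: R_def trans_le_add2)
  have Rk: "k \<le> R k" for k by (simp add: R_def)
  define d where "d k x = (norm (G (R (Suc k)) x - G (R k) x))\<^sup>2" for k x
  have [measurable]: "d k \<in> borel_measurable M" for k unfolding d_def by measurable
  have d0: "d k x \<ge> 0" for k x by (simp add: d_def)
  \<comment> \<open>The squared distances integrate to at most 4^(-k). The weight 2^k keeps the sum
    finite and yields the pointwise rate 2^(-k), hence a geometric majorant for the
    increments.\<close>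
  have "(\<integral>\<^sup>+x. (\<Sum>k. ennreal (2^k * d k x)) \<partial>M) = (\<Sum>k. \<integral>\<^sup>+x. ennreal (2^k * d k x) \<partial>M)"
    by (rule nn_integral_suminf) measurable
  also have "\<dots> \<le> (\<Sum>k. ennreal ((1/2)^k))"
  proof (rule suminf_le)
    show "(\<integral>\<^sup>+x. ennreal (2^k * d k x) \<partial>M) \<le> ennreal ((1/2)^k)" for k
    proof -
      have "(\<integral>\<^sup>+x. ennreal (2^k * d k x) \<partial>M) = ennreal (2^k) * (\<integral>\<^sup>+x. ennreal (d k x) \<partial>M)"
        using d0 by (simp add: ennreal_mult nn_integral_cmult)
      also have "\<dots> \<le> ennreal (2^k) * ennreal ((1/4)^k)"
        unfolding d_def using RN[of k k] RN[of k "Suc k"] by (intro mult_left_mono N) auto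
      also have "\<dots> = ennreal ((1/2)^k)"
        by (simp add: power_mult_distrib[symmetric] flip: ennreal_mult)
      finally show ?thesis .
    qed
  qed auto
  also have "\<dots> = ennreal 2"
    using geometric_sums[of "1/2::real"] by (intro suminf_ennreal_eq) auto
  finally have "(\<integral>\<^sup>+x. (\<Sum>k. ennreal (2^k * d k x)) \<partial>M) < \<infinity>"
    using ennreal_less_top le_less_trans by (metis infinity_ennreal_def)
  then have "AE x in M. (\<Sum>k. ennreal (2^k * d k x)) \<noteq> \<infinity>"
    by (intro nn_integral_noteq_infinite) auto
  then have conv: "AE x in M. convergent (\<lambda>k. G (R k) x)"
  proof eventually_elim
    case (elim x)
    then obtain B where B: "(\<Sum>k. ennreal (2^k * d k x)) = ennreal B" "B \<ge> 0"
      by (metis ennreal_cases infinity_ennreal_def)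
    have bound: "norm (G (R (Suc k)) x - G (R k) x) \<le> sqrt B * (sqrt (1/2))^k" for k
    proof -
      have "ennreal (2^k * d k x) \<le> (\<Sum>k. ennreal (2^k * d k x))"
        using sum_le_suminf[of "\<lambda>k. ennreal (2^k * d k x)" "{k}"] by simp
      then have "2^k * d k x \<le> B" using B by simp
      then have "d k x \<le> B * (1/2)^k" by (simp add: power_divide field_simps)
      then have "sqrt (d k x) \<le> sqrt (B * (1/2)^k)" by simp
      then show ?thesis by (simp add: d_def real_sqrt_mult real_sqrt_power)
    qed
    have "summable (\<lambda>k. sqrt B * (sqrt (1/2))^k)"
      by (intro summable_mult summable_geometric) (simp add: real_sqrt_divide)
    then have "summable (\<lambda>k. G (R (Suc k)) x - G (R k) x)"
      by (rule summable_comparison_test[rotated]) (use bound in auto)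
    then have "convergent (\<lambda>n. \<Sum>k<n. G (R (Suc k)) x - G (R k) x)"
      by (simp add: summable_iff_convergent)
    then have "convergent (\<lambda>n. G (R n) x - G (R 0) x)"
      by (simp only: sum_lessThan_telescope[of "\<lambda>k. G (R k) x"])
    from convergent_add[OF this convergent_const[of "G (R 0) x"]] show ?case by simp
  qed
  \<comment> \<open>Where the subsequence diverges the value of \<open>lim\<close> is immaterial; g
    is measurable all the same.\<close>
  define g where "g x = lim (\<lambda>k. G (R k) x)" for x
  have gm[measurable]: "g \<in> borel_measurable M" unfolding g_def by measurable
  have le: "(\<integral>\<^sup>+x. ennreal ((norm (G n x - g x))\<^sup>2) \<partial>M) \<le> ennreal ((1/4)^j)" if n: "n \<ge> N j" for n j
  proof -
    have "(\<integral>\<^sup>+x. ennreal ((norm (G n x - g x))\<^sup>2) \<partial>M) = (\<integral>\<^sup>+x. liminf (\<lambda>k. ennreal ((norm (G n x - G (R k) x))\<^sup>2)) \<partial>M)"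
    proof (rule nn_integral_cong_AE)
      show "AE x in M. ennreal ((norm (G n x - g x))\<^sup>2) = liminf (\<lambda>k. ennreal ((norm (G n x - G (R k) x))\<^sup>2))"
        using conv
      proof eventually_elim
        case (elim x)
        then have "(\<lambda>k. G (R k) x) \<longlonglongrightarrow> g x" by (simp add: g_def convergent_LIMSEQ_iff)
        then have "(\<lambda>k. ennreal ((norm (G n x - G (R k) x))\<^sup>2)) \<longlonglongrightarrow> ennreal ((norm (G n x - g x))\<^sup>2)"
          by (intro tendsto_intros tendsto_ennrealI)
        then show ?case by (intro lim_imp_Liminf[symmetric]) auto
      qed
    qed
    also have "\<dots> \<le> liminf (\<lambda>k. \<integral>\<^sup>+x. ennreal ((norm (G n x - G (R k) x))\<^sup>2) \<partial>M)"
      by (rule nn_integral_liminf) measurable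
    also have "\<dots> \<le> ennreal ((1/4)^j)"
    proof (rule Liminf_le)
      show "eventually (\<lambda>k. (\<integral>\<^sup>+x. ennreal ((norm (G n x - G (R k) x))\<^sup>2) \<partial>M) \<le> ennreal ((1/4)^j)) sequentially"
        using eventually_ge_at_top[of j] by eventually_elim (intro N n RN)
    qed simp
    finally show ?thesis .
  qed
  have "(\<lambda>n. \<integral>\<^sup>+x. ennreal ((norm (G n x - g x))\<^sup>2) \<partial>M) \<longlonglongrightarrow> 0"
  proof (rule order_tendstoI)
    fix a :: ennreal assume "0 < a"
    have "(\<lambda>j. ennreal ((1/4)^j)) \<longlonglongrightarrow> ennreal 0"
      by (intro tendsto_ennrealI LIMSEQ_power_zero) simp
    then have "eventually (\<lambda>j. ennreal ((1/4)^j) < a) sequentially"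
      using \<open>0 < a\<close> by (intro order_tendstoD) auto
    then obtain j where j: "ennreal ((1/4)^j) < a" by (meson eventually_sequentially order_refl)
    show "eventually (\<lambda>n. (\<integral>\<^sup>+x. ennreal ((norm (G n x - g x))\<^sup>2) \<partial>M) < a) sequentially"
      using eventually_ge_at_top[of "N j"] by eventually_elim (rule le_less_trans[OF le j])
  qed simp
  then show ?thesis using gm that by blast
qed

section \<open>The Fourier transform on \<open>L\<^sup>2\<close>\<close>

lemma norm_power2_vec: "(norm (v::complex^4))\<^sup>2 = (\<Sum>i\<in>UNIV. (norm (v $ i))\<^sup>2)"
  by (simp add: norm_vec_def L2_set_def sum_nonneg)

lemma nn_integral_norm_power2_vec:
  fixes f :: "'a \<Rightarrow> complex^4"
  assumes [measurable]: "\<And>i. (\<lambda>x. f x $ i) \<in> borel_measurable M"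
  shows "(\<integral>\<^sup>+x. ennreal ((norm (f x))\<^sup>2) \<partial>M) = (\<Sum>i\<in>UNIV. \<integral>\<^sup>+x. ennreal ((norm (f x $ i))\<^sup>2) \<partial>M)"
proof -
  have "(\<integral>\<^sup>+x. ennreal ((norm (f x))\<^sup>2) \<partial>M) = (\<integral>\<^sup>+x. (\<Sum>i\<in>UNIV. ennreal ((norm (f x $ i))\<^sup>2)) \<partial>M)"
    by (simp add: norm_power2_vec sum_ennreal)
  also have "\<dots> = (\<Sum>i\<in>UNIV. \<integral>\<^sup>+x. ennreal ((norm (f x $ i))\<^sup>2) \<partial>M)"
    by (rule nn_integral_sum) measurable
  finally show ?thesis .
qed

lemma borel_measurable_vec_nth [measurable (raw)]:
  "f \<in> borel_measurable M \<Longrightarrow> (\<lambda>x. (f x :: complex^4) $ i) \<in> borel_measurable M"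
  by (rule measurable_compose[where g = "\<lambda>v. v $ i"]) (auto intro!: borel_measurable_continuous_onI continuous_intros)

lemma borel_measurable_vecI:
  fixes f :: "'a \<Rightarrow> complex^4"
  assumes "\<And>i. (\<lambda>x. f x $ i) \<in> borel_measurable M"
  shows "f \<in> borel_measurable M"
  unfolding borel_measurable_euclidean_space[of f]
proof
  fix b :: "complex^4" assume "b \<in> Basis"
  then obtain i u where "b = axis i u" by (auto simp: Basis_vec_def)
  then show "(\<lambda>x. f x \<bullet> b) \<in> borel_measurable M"
    using assms[of i] by (simp add: inner_axis)
qed

lemma borel_measurable_cutoff:
  assumes "f \<in> borel_measurable borel" "\<Delta> \<in> sets borel"
  shows "cutoff \<Delta> f \<in> borel_measurable borel"
  unfolding cutoff_def by (intro borel_measurable_scaleR borel_measurable_indicator assms)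

lemma fourier_const_real3: "fourier_const TYPE(real^3) = (2 * pi) powr (- 3 / 2)"
  by (simp add: fourier_const_def)

lemma norm_cis_smult [simp]: "norm (cis a *s (v :: complex^4)) = norm v"
  by (simp add: norm_vec_def norm_mult)

lemma integrable_vec_nth: "integrable M f \<Longrightarrow> integrable M (\<lambda>x. (f x :: complex^4) $ i)"
  by (rule integrable_bounded_linear[OF bounded_linear_vec_nth])

lemma integral_vec_nth: "integrable M f \<Longrightarrow> integral\<^sup>L M f $ i = (\<integral>x. (f x :: complex^4) $ i \<partial>M)"
  by (rule integral_bounded_linear[OF bounded_linear_vec_nth, symmetric])

lemma integrable_cis_smult:
  assumes "integrable lborel f" and [measurable]: "g \<in> borel_measurable borel"
  shows "integrable lborel (\<lambda>x. cis (g x) *s (f x :: complex^4))"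
proof (rule Bochner_Integration.integrable_bound[OF assms(1)])
  have [measurable]: "f \<in> borel_measurable borel" using borel_measurable_integrable[OF assms(1)] by simp
  show "(\<lambda>x. cis (g x) *s f x) \<in> borel_measurable lborel"
    by (rule borel_measurable_vecI) simp
qed simp

lemma fourier_integral_nth:
  assumes "integrable lborel f"
  shows "fourier_integral f p $ i = ft (\<lambda>x. f x $ i) p"
  by (simp add: fourier_integral_def ft_def integral_vec_nth integrable_cis_smult[OF assms] fourier_const_real3 scaleR_conv_of_real[where 'a = complex])

lemma borel_measurable_fourier_integral:
  assumes "integrable lborel f"
  shows "fourier_integral f \<in> borel_measurable borel"
proof (rule borel_measurable_vecI)
  fix i
  have "(\<lambda>x. f x $ i) \<in> borel_measurable borel"
    using borel_measurable_integrable[OF integrable_vec_nth[OF assms]] by simp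
  then show "(\<lambda>p. fourier_integral f p $ i) \<in> borel_measurable borel"
    by (simp add: fourier_integral_nth[OF assms] borel_measurable_ft)
qed

lemma fourier_integral_diff:
  assumes "integrable lborel f" "integrable lborel g"
  shows "fourier_integral (\<lambda>x. f x - g x) p = fourier_integral f p - fourier_integral g p"
  using assms by (simp add: vec_eq_iff fourier_integral_nth ft_diff integrable_vec_nth)

lemma fourier_integral_add:
  assumes "integrable lborel f" "integrable lborel g"
  shows "fourier_integral (\<lambda>x. f x + g x) p = fourier_integral f p + fourier_integral g p"
  using assms by (simp add: vec_eq_iff fourier_integral_nth ft_add integrable_vec_nth)

lemma bessel_fourier_integral:
  assumes f: "integrable lborel f"
  shows "(\<integral>\<^sup>+p. ennreal ((norm (fourier_integral f p))\<^sup>2) \<partial>lborel) \<le> (\<integral>\<^sup>+x. ennreal ((norm (f x))\<^sup>2) \<partial>lborel)"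
proof -
  note [measurable] = borel_measurable_fourier_integral[OF f]
  have [measurable]: "f \<in> borel_measurable borel" using borel_measurable_integrable[OF f] by simp
  have "(\<integral>\<^sup>+p. ennreal ((norm (fourier_integral f p))\<^sup>2) \<partial>lborel) = (\<Sum>i\<in>UNIV. \<integral>\<^sup>+p. ennreal ((norm (ft (\<lambda>x. f x $ i) p))\<^sup>2) \<partial>lborel)"
    by (subst nn_integral_norm_power2_vec) (simp_all add: fourier_integral_nth[OF f])
  also have "\<dots> \<le> (\<Sum>i\<in>UNIV. \<integral>\<^sup>+x. ennreal ((norm (f x $ i))\<^sup>2) \<partial>lborel)"
    by (intro sum_mono bessel_ft integrable_vec_nth f)
  also have "\<dots> = (\<integral>\<^sup>+x. ennreal ((norm (f x))\<^sup>2) \<partial>lborel)"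
    by (subst nn_integral_norm_power2_vec) simp_all
  finally show ?thesis .
qed

section \<open>Existence, injectivity and inversion of the L^2 transform\<close>

lemma eq_ae_trans_sym: "eq_ae f g \<Longrightarrow> eq_ae h g \<Longrightarrow> eq_ae f h"
  unfolding eq_ae_def by (rule eventually_elim2) auto

lemma dirac_wavefunction_iff:
  "dirac_wavefunction f \<longleftrightarrow> f \<in> borel_measurable borel \<and> (\<integral>\<^sup>+x. ennreal ((norm (f x))\<^sup>2) \<partial>lborel) < \<infinity>"
  by (auto simp: dirac_wavefunction_def integrable_iff_bounded)

lemma nn_integral_norm_power2_diff_le:
  fixes f g :: "'a \<Rightarrow> 'b::{banach,second_countable_topology}"
  assumes [measurable]: "f \<in> borel_measurable M" "g \<in> borel_measurable M"
  shows "(\<integral>\<^sup>+x. ennreal ((norm (f x - g x))\<^sup>2) \<partial>M) \<le> 2 * (\<integral>\<^sup>+x. ennreal ((norm (f x))\<^sup>2) \<partial>M) + 2 * (\<integral>\<^sup>+x. ennreal ((norm (g x))\<^sup>2) \<partial>M)"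
proof -
  have "(\<integral>\<^sup>+x. ennreal ((norm (f x - g x))\<^sup>2) \<partial>M) \<le> (\<integral>\<^sup>+x. 2 * ennreal ((norm (f x))\<^sup>2) + 2 * ennreal ((norm (g x))\<^sup>2) \<partial>M)"
  proof (rule nn_integral_mono)
    fix x
    have "ennreal ((norm (f x - g x))\<^sup>2) \<le> ennreal (2 * (norm (f x))\<^sup>2 + 2 * (norm (g x))\<^sup>2)"
      by (intro ennreal_leI norm_power2_diff_le)
    then show "ennreal ((norm (f x - g x))\<^sup>2) \<le> 2 * ennreal ((norm (f x))\<^sup>2) + 2 * ennreal ((norm (g x))\<^sup>2)"
      by (simp add: ennreal_mult)
  qed
  also have "\<dots> = 2 * (\<integral>\<^sup>+x. ennreal ((norm (f x))\<^sup>2) \<partial>M) + 2 * (\<integral>\<^sup>+x. ennreal ((norm (g x))\<^sup>2) \<partial>M)"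
    by (simp add: nn_integral_add nn_integral_cmult)
  finally show ?thesis .
qed

lemma dirac_wavefunction_diff:
  assumes "dirac_wavefunction f" "dirac_wavefunction g"
  shows "dirac_wavefunction (\<lambda>x. f x - g x)"
  unfolding dirac_wavefunction_iff
proof
  have [measurable]: "f \<in> borel_measurable borel" "g \<in> borel_measurable borel" using assms by (auto simp: dirac_wavefunction_iff)
  show "(\<lambda>x. f x - g x) \<in> borel_measurable borel" by measurable
  have "2 * (\<integral>\<^sup>+x. ennreal ((norm (f x))\<^sup>2) \<partial>lborel) + 2 * (\<integral>\<^sup>+x. ennreal ((norm (g x))\<^sup>2) \<partial>lborel) < \<infinity>"
    using assms by (simp add: dirac_wavefunction_iff ennreal_mult_less_top)
  then show "(\<integral>\<^sup>+x. ennreal ((norm (f x - g x))\<^sup>2) \<partial>lborel) < \<infinity>"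
    using nn_integral_norm_power2_diff_le[of f lborel g] by (simp add: le_less_trans)
qed

text \<open>On a set of finite measure |f| <= 1 + |f|^2 turns square integrability into
  integrability, so the truncated transforms are genuine integrals.\<close>

lemma integrable_cutoff_ball:
  assumes f: "dirac_wavefunction f"
  shows "integrable lborel (cutoff (ball 0 r) f)"
proof (rule Bochner_Integration.integrable_bound[where f = "\<lambda>x. indicator (ball 0 r) x + (norm (f x))\<^sup>2"])
  have [measurable]: "f \<in> borel_measurable borel" using f by (auto simp: dirac_wavefunction_iff)
  have "integrable lborel (indicator (ball 0 r :: (real^3) set) :: _ \<Rightarrow> real)"
    by (intro integrable_real_indicator) (simp_all add: emeasure_lborel_ball_finite[unfolded infinity_ennreal_def])
  then show "integrable lborel (\<lambda>x. indicator (ball 0 r) x + (norm (f x))\<^sup>2)"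
    using f by (intro Bochner_Integration.integrable_add) (auto simp: dirac_wavefunction_def)
  show "cutoff (ball 0 r) f \<in> borel_measurable lborel" using borel_measurable_cutoff[of f "ball 0 r"] by simp
  have "x \<le> 1 + x\<^sup>2" for x :: real using sum_squares_bound[of x 1] by (smt (verit) power_one zero_le_power2)
  then show "AE x in lborel. norm (cutoff (ball 0 r) f x) \<le> norm (indicator (ball 0 r) x + (norm (f x))\<^sup>2)"
    by (auto simp: cutoff_def indicator_def)
qed

text \<open>This gives the choice in \<open>fourier\<close> its meaning. By Bessel's inequality the
  transforms of two truncations differ by no more than the tails of f outside the balls allow, so
  they form a Cauchy sequence.\<close>

lemma fourier_limit_exists:
  assumes f: "dirac_wavefunction f"
  shows "\<exists>g. dirac_wavefunction g \<and>
     (\<lambda>n. \<integral>\<^sup>+p. ennreal ((norm (fourier_integral (cutoff (ball 0 (real n)) f) p - g p))\<^sup>2) \<partial>lborel) \<longlonglongrightarrow> 0"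
proof -
  have [measurable]: "f \<in> borel_measurable borel" using f by (auto simp: dirac_wavefunction_iff)
  define c where "c n = cutoff (ball 0 (real n)) f" for n
  have ic: "integrable lborel (c n)" for n unfolding c_def by (rule integrable_cutoff_ball[OF f])
  have [measurable]: "c n \<in> borel_measurable borel" for n unfolding c_def by (intro borel_measurable_cutoff) simp_all
  define G where "G n = fourier_integral (c n)" for n
  have Gm[measurable]: "G n \<in> borel_measurable borel" for n
    unfolding G_def by (rule borel_measurable_fourier_integral[OF ic])
  define T where "T n = (\<integral>\<^sup>+x. ennreal ((norm (f x - c n x))\<^sup>2) \<partial>lborel)" for n
  have "(\<lambda>n. T n) \<longlonglongrightarrow> (\<integral>\<^sup>+x. 0 \<partial>(lborel :: (real^3) measure))"
    unfolding T_def
  proof (rule nn_integral_dominated_convergence[where w = "\<lambda>x. ennreal ((norm (f x))\<^sup>2)"])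
    show "(\<integral>\<^sup>+x. ennreal ((norm (f x))\<^sup>2) \<partial>lborel) < \<infinity>" using f by (simp add: dirac_wavefunction_iff)
    show "AE x in lborel. ennreal ((norm (f x - c n x))\<^sup>2) \<le> ennreal ((norm (f x))\<^sup>2)" for n
      by (auto simp: c_def cutoff_def indicator_def)
    show "AE x in lborel. (\<lambda>n. ennreal ((norm (f x - c n x))\<^sup>2)) \<longlonglongrightarrow> 0"
    proof (rule AE_I2)
      fix x :: "real^3"
      obtain N :: nat where N: "norm x < real N" using reals_Archimedean2 by blast
      show "(\<lambda>n. ennreal ((norm (f x - c n x))\<^sup>2)) \<longlonglongrightarrow> 0"
      proof (rule tendsto_eventually)
        show "eventually (\<lambda>n. ennreal ((norm (f x - c n x))\<^sup>2) = 0) sequentially"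
          using eventually_ge_at_top[of N] by eventually_elim (use N in \<open>auto simp: c_def cutoff_def indicator_def\<close>)
      qed
    qed
  qed measurable
  then have T: "T \<longlonglongrightarrow> 0" by simp
  have diff: "(\<integral>\<^sup>+p. ennreal ((norm (G m p - G n p))\<^sup>2) \<partial>lborel) \<le> 2 * T m + 2 * T n" for m n
  proof -
    have "(\<integral>\<^sup>+p. ennreal ((norm (G m p - G n p))\<^sup>2) \<partial>lborel) \<le> (\<integral>\<^sup>+x. ennreal ((norm (c m x - c n x))\<^sup>2) \<partial>lborel)"
      using bessel_fourier_integral[OF Bochner_Integration.integrable_diff[OF ic[of m] ic[of n]]] by (simp add: G_def fourier_integral_diff ic)
    also have "\<dots> = (\<integral>\<^sup>+x. ennreal ((norm ((f x - c n x) - (f x - c m x)))\<^sup>2) \<partial>lborel)" by simp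
    also have "\<dots> \<le> 2 * T n + 2 * T m"
      unfolding T_def by (rule nn_integral_norm_power2_diff_le) measurable
    finally show ?thesis by (simp add: add.commute)
  qed
  obtain g where g[measurable]: "g \<in> borel_measurable lborel" and lim: "(\<lambda>n. \<integral>\<^sup>+p. ennreal ((norm (G n p - g p))\<^sup>2) \<partial>lborel) \<longlonglongrightarrow> 0"
  proof (rule L2_complete[of G lborel])
    fix e :: real assume e: "e > 0"
    then have "eventually (\<lambda>n. T n < ennreal (e / 4)) sequentially" using order_tendstoD(2)[OF T] by simp
    then obtain N where N: "\<And>n. n \<ge> N \<Longrightarrow> T n < ennreal (e / 4)" by (auto simp: eventually_sequentially)
    have "(\<integral>\<^sup>+p. ennreal ((norm (G m p - G n p))\<^sup>2) \<partial>lborel) \<le> ennreal e" if "m \<ge> N" "n \<ge> N" for m n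
    proof -
      have "2 * T m + 2 * T n \<le> 2 * ennreal (e / 4) + 2 * ennreal (e / 4)"
        using N that by (intro add_mono mult_left_mono less_imp_le) auto
      also have "\<dots> = ennreal (e / 2) + ennreal (e / 2)"
        using e ennreal_mult[of 2 "e / 4"] by simp
      also have "\<dots> = ennreal e" using e by (simp flip: ennreal_plus)
      finally show ?thesis using diff[of m n] by (rule order_trans[rotated])
    qed
    then show "\<exists>N. \<forall>m\<ge>N. \<forall>n\<ge>N. (\<integral>\<^sup>+x. ennreal ((norm (G m x - G n x))\<^sup>2) \<partial>lborel) \<le> ennreal e" by blast
  qed simp
  have "dirac_wavefunction g" unfolding dirac_wavefunction_iff
  proof
    have "eventually (\<lambda>n. (\<integral>\<^sup>+p. ennreal ((norm (G n p - g p))\<^sup>2) \<partial>lborel) < 1) sequentially"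
      using order_tendstoD(2)[OF lim, of 1] by simp
    then obtain n where n: "(\<integral>\<^sup>+p. ennreal ((norm (G n p - g p))\<^sup>2) \<partial>lborel) < 1" by (auto simp: eventually_sequentially)
    have "(\<integral>\<^sup>+p. ennreal ((norm (G n p))\<^sup>2) \<partial>lborel) \<le> (\<integral>\<^sup>+x. ennreal ((norm (c n x))\<^sup>2) \<partial>lborel)"
      unfolding G_def by (rule bessel_fourier_integral[OF ic])
    also have "\<dots> \<le> (\<integral>\<^sup>+x. ennreal ((norm (f x))\<^sup>2) \<partial>lborel)"
      by (intro nn_integral_mono) (auto simp: c_def cutoff_def indicator_def)
    also have "\<dots> < \<infinity>" using f by (simp add: dirac_wavefunction_iff)
    finally have fin: "(\<integral>\<^sup>+p. ennreal ((norm (G n p))\<^sup>2) \<partial>lborel) < \<infinity>" .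
    \<comment> \<open>The limit g is square integrable as a difference of \<open>G n\<close> and an
      error term of finite norm.\<close>
    have "(\<integral>\<^sup>+p. ennreal ((norm (G n p - (G n p - g p)))\<^sup>2) \<partial>lborel) \<le> 2 * (\<integral>\<^sup>+p. ennreal ((norm (G n p))\<^sup>2) \<partial>lborel) + 2 * (\<integral>\<^sup>+p. ennreal ((norm (G n p - g p))\<^sup>2) \<partial>lborel)"
      by (rule nn_integral_norm_power2_diff_le) measurable
    also have "\<dots> < \<infinity>" using fin n by (simp add: ennreal_mult_less_top less_trans[OF n])
    finally show "(\<integral>\<^sup>+p. ennreal ((norm (g p))\<^sup>2) \<partial>lborel) < \<infinity>" by simp
  qed (use g in simp)
  then show ?thesis using lim by (auto simp: G_def c_def)
qed

lemma
  assumes "dirac_wavefunction f"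
  shows dirac_wavefunction_fourier: "dirac_wavefunction (fourier f)"
    and fourier_limit: "(\<lambda>n. \<integral>\<^sup>+p. ennreal ((norm (fourier_integral (cutoff (ball 0 (real n)) f) p - fourier f p))\<^sup>2) \<partial>lborel) \<longlonglongrightarrow> 0"
  using someI_ex[OF fourier_limit_exists[OF assms]] by (auto simp: fourier_def)

text \<open>Linearity is exact for the truncated integrals, not for chosen representatives. The
  truncations of f - g therefore have transforms bounded by two error terms that tend to 0, and
  uniqueness applies to each component.\<close>

theorem fourier_inj:
  assumes f: "dirac_wavefunction f" and g: "dirac_wavefunction g" and eq: "eq_ae (fourier f) (fourier g)"
  shows "eq_ae f g"
proof -
  have [measurable]: "fourier f \<in> borel_measurable borel" "fourier g \<in> borel_measurable borel"
    using dirac_wavefunction_fourier[OF f] dirac_wavefunction_fourier[OF g] by (auto simp: dirac_wavefunction_iff)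
  define h where "h x = f x - g x" for x
  have h: "dirac_wavefunction h" unfolding h_def by (rule dirac_wavefunction_diff[OF f g])
  let ?c = "\<lambda>n. cutoff (ball 0 (real n))"
  let ?T = "\<lambda>f n. (\<integral>\<^sup>+p. ennreal ((norm (fourier_integral (?c n f) p - fourier f p))\<^sup>2) \<partial>lborel)"
  have cm[measurable]: "fourier_integral (?c n k) \<in> borel_measurable borel" if "dirac_wavefunction k" for n k
    by (intro borel_measurable_fourier_integral integrable_cutoff_ball that)
  note [measurable] = cm[OF f] cm[OF g] cm[OF h]
  have le: "(\<integral>\<^sup>+p. ennreal ((norm (fourier_integral (?c n h) p))\<^sup>2) \<partial>lborel) \<le> 2 * ?T f n + 2 * ?T g n" for n
  proof -
    have "?c n h = (\<lambda>x. ?c n f x - ?c n g x)" by (auto simp: cutoff_def h_def scaleR_diff_right)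
    then have "fourier_integral (?c n h) p = fourier_integral (?c n f) p - fourier_integral (?c n g) p" for p
      by (simp add: fourier_integral_diff integrable_cutoff_ball f g)
    then have "(\<integral>\<^sup>+p. ennreal ((norm (fourier_integral (?c n h) p))\<^sup>2) \<partial>lborel)
      = (\<integral>\<^sup>+p. ennreal ((norm ((fourier_integral (?c n f) p - fourier f p) - (fourier_integral (?c n g) p - fourier g p)))\<^sup>2) \<partial>lborel)"
      using eq by (intro nn_integral_cong_AE) (auto simp: eq_ae_def)
    also have "\<dots> \<le> 2 * ?T f n + 2 * ?T g n"
      by (rule nn_integral_norm_power2_diff_le) measurable
    finally show ?thesis .
  qed
  have lim: "(\<lambda>n. \<integral>\<^sup>+p. ennreal ((norm (fourier_integral (?c n h) p))\<^sup>2) \<partial>lborel) \<longlonglongrightarrow> 0"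
  proof (rule tendsto_sandwich[OF _ _ tendsto_const])
    have "(\<lambda>n. 2 * ?T f n + 2 * ?T g n) \<longlonglongrightarrow> 2 * 0 + 2 * 0"
      by (intro tendsto_add ennreal_tendsto_cmult fourier_limit f g) auto
    then show "(\<lambda>n. 2 * ?T f n + 2 * ?T g n) \<longlonglongrightarrow> 0" by simp
  qed (use le in auto)
  have "AE x in lborel. h x $ i = 0" for i
  proof (rule AE_zero_of_truncated_ft_tendsto_zero)
    have cc: "(\<lambda>x. indicator (ball 0 (real n)) x *\<^sub>R h x $ i) = (\<lambda>x. ?c n h x $ i)" for n by (simp add: cutoff_def)
    show "integrable lborel (\<lambda>x. indicator (ball 0 (real n)) x *\<^sub>R h x $ i)" for n :: nat
      unfolding cc by (intro integrable_vec_nth integrable_cutoff_ball h)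
    show "(\<lambda>n. \<integral>\<^sup>+p. ennreal ((norm (ft (\<lambda>x. indicator (ball 0 (real n)) x *\<^sub>R h x $ i) p))\<^sup>2) \<partial>lborel) \<longlonglongrightarrow> 0"
      unfolding cc fourier_integral_nth[OF integrable_cutoff_ball[OF h], symmetric]
    proof (rule tendsto_sandwich[OF _ _ tendsto_const lim])
      show "eventually (\<lambda>n. (\<integral>\<^sup>+p. ennreal ((norm (fourier_integral (?c n h) p $ i))\<^sup>2) \<partial>lborel) \<le> (\<integral>\<^sup>+p. ennreal ((norm (fourier_integral (?c n h) p))\<^sup>2) \<partial>lborel)) sequentially"
        by (intro always_eventually allI nn_integral_mono ennreal_leI power_mono Finite_Cartesian_Product.norm_nth_le) simp
    qed simp
  qed
  then have "AE x in lborel. \<forall>i\<in>UNIV. h x $ i = 0" by (subst AE_finite_all) auto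
  then show ?thesis by (auto simp: eq_ae_def h_def vec_eq_iff)
qed

text \<open>Truncation at a radius beyond r changes nothing, so the defining sequence is eventually
  constant and its L^2 limit is the integral itself.\<close>

lemma fourier_eq_fourier_integral:
  assumes f: "dirac_wavefunction f" and r: "\<And>x. norm x \<ge> r \<Longrightarrow> f x = 0"
  shows "eq_ae (fourier f) (fourier_integral f)"
proof -
  have [measurable]: "fourier f \<in> borel_measurable borel"
    using dirac_wavefunction_fourier[OF f] by (auto simp: dirac_wavefunction_iff)
  obtain N :: nat where N: "r \<le> real N" using real_arch_simple by blast
  have c: "cutoff (ball 0 (real n)) f = f" if "n \<ge> N" for n
    using r N that by (auto simp: cutoff_def indicator_def fun_eq_iff dist_norm)
  have [measurable]: "fourier_integral f \<in> borel_measurable borel"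
    using borel_measurable_fourier_integral[OF integrable_cutoff_ball[OF f, of "real N"]] c[of N] by simp
  let ?I = "\<integral>\<^sup>+p. ennreal ((norm (fourier_integral f p - fourier f p))\<^sup>2) \<partial>lborel"
  have "(\<lambda>n. \<integral>\<^sup>+p. ennreal ((norm (fourier_integral (cutoff (ball 0 (real n)) f) p - fourier f p))\<^sup>2) \<partial>lborel) \<longlonglongrightarrow> ?I"
    by (rule tendsto_eventually) (use eventually_ge_at_top[of N] in \<open>eventually_elim, simp add: c\<close>)
  then have "?I = 0" using fourier_limit[OF f] LIMSEQ_unique by blast
  then have "AE p in lborel. ennreal ((norm (fourier_integral f p - fourier f p))\<^sup>2) = 0"
    by (subst (asm) nn_integral_0_iff_AE) auto
  then show ?thesis by (auto simp: eq_ae_def)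
qed

text \<open>A witness f makes the choice in \<open>inv_fourier\<close> meaningful, and injectivity
  identifies the chosen function with f almost everywhere.\<close>

lemma inv_fourier_eqI:
  assumes f: "dirac_wavefunction f" and eq: "eq_ae (fourier f) g"
  shows "dirac_wavefunction (inv_fourier g)" and "eq_ae (inv_fourier g) f"
proof -
  have "dirac_wavefunction (inv_fourier g) \<and> eq_ae (fourier (inv_fourier g)) g"
    unfolding inv_fourier_def by (rule someI[of _ f]) (use assms in simp)
  then show "dirac_wavefunction (inv_fourier g)" and "eq_ae (inv_fourier g) f"
    using fourier_inj[of "inv_fourier g" f] f eq_ae_trans_sym[OF _ eq] by auto
qed

section \<open>The analytically continued momentum amplitude\<close>

lemma abs_le_1_plus_square: "\<bar>x\<bar> \<le> 1 + x\<^sup>2" for x :: real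
proof -
  have "2 * \<bar>x\<bar> * 1 \<le> \<bar>x\<bar>\<^sup>2 + 1\<^sup>2" by (rule sum_squares_bound)
  then show ?thesis using zero_le_power2[of x] unfolding power2_abs one_power2 by linarith
qed

text \<open>The point p + zn of complex momentum space. In particular \<open>cshift p 0 0\<close> is
  the real momentum p read as a complex vector.\<close>

definition cshift :: "real^3 \<Rightarrow> complex \<Rightarrow> real^3 \<Rightarrow> complex^3" where
  "cshift p z n = (\<chi> k. of_real (p $ k) + z * of_real (n $ k))"

lemma cshift_nth [simp]: "cshift p z n $ k = of_real (p $ k) + z * of_real (n $ k)"
  by (simp add: cshift_def)

lemma cshift_of_real: "cshift p (of_real r) n = cshift (p + r *\<^sub>R n) 0 n'"
  by (simp add: vec_eq_iff)

lemma prod_Basis_real3: "(\<Prod>b\<in>Basis. f ((x::real^3) \<bullet> b)) = (\<Prod>k\<in>UNIV. f (x $ k))"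
proof -
  have inj: "inj (\<lambda>k::3. axis k (1::real))" by (auto simp: inj_on_def axis_eq_axis)
  have B: "(Basis :: (real^3) set) = range (\<lambda>k. axis k 1)" by (auto simp: Basis_vec_def)
  show ?thesis unfolding B prod.reindex[OF inj] by (simp add: inner_axis)
qed

text \<open>The majorant in momentum space. Its product form reduces integrability to dimension
  one.\<close>

definition decay :: "real^3 \<Rightarrow> real" where
  "decay p = (\<Prod>k\<in>UNIV. 1 / (1 + (p $ k)\<^sup>2))"

lemma decay_pos: "decay p > 0"
  unfolding decay_def by (intro prod_pos) (simp add: add_pos_nonneg)

lemma integrable_decay: "integrable lborel decay"
proof -
  have "integrable lborel (\<lambda>x::real. 1 / (1 + x\<^sup>2))"
    using integrable_inverse_1_plus_square by (simp add: set_integrable_def inverse_eq_divide)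
  then have "integrable lborel (\<lambda>p::real^3. \<Prod>b\<in>Basis. 1 / (1 + (p \<bullet> b)\<^sup>2))"
    by (intro integrable_lborel_prod) simp
  then show ?thesis
    by (subst (asm) prod_Basis_real3) (simp add: decay_def[abs_def])
qed

lemma decay_le_1: "decay p \<le> 1"
  unfolding decay_def by (intro prod_le_1) (auto simp: divide_simps add_pos_nonneg)

lemma norm_nth_unit_le: "norm (n::real^3) = 1 \<Longrightarrow> \<bar>n $ k\<bar> \<le> 1"
  by (metis component_le_norm_cart)

text \<open>Each coordinate costs a factor 2 (1 + r^2), since (p_k)^2 <= 2 (q_k)^2 + 2 r^2 for q = p
  + rn. This provides one integrable majorant for all shifts in a bounded range.\<close>

lemma decay_shift:
  assumes n: "norm n = 1"
  shows "decay (p + r *\<^sub>R n) \<le> (2 * (1 + r\<^sup>2)) ^ 3 * decay p"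
proof -
  have "decay (p + r *\<^sub>R n) \<le> (\<Prod>k\<in>(UNIV::3 set). (2 * (1 + r\<^sup>2)) * (1 / (1 + (p $ k)\<^sup>2)))"
    unfolding decay_def
  proof (intro prod_mono conjI)
    fix k :: 3
    let ?q = "p $ k + r * n $ k"
    have "(n $ k)\<^sup>2 \<le> 1" using norm_nth_unit_le[OF n, of k] by (simp add: abs_square_le_1)
    then have "(r * n $ k)\<^sup>2 \<le> r\<^sup>2" by (simp add: power_mult_distrib mult_left_le)
    moreover have "(p $ k)\<^sup>2 \<le> 2 * ?q\<^sup>2 + 2 * (r * n $ k)\<^sup>2"
      using norm_power2_diff_le[of ?q "r * n $ k"] by simp
    ultimately have "(p $ k)\<^sup>2 \<le> 2 * ?q\<^sup>2 + 2 * r\<^sup>2" by linarith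
    moreover have "2 * (1 + r\<^sup>2) * (1 + ?q\<^sup>2) = 2 + 2 * ?q\<^sup>2 + 2 * r\<^sup>2 + 2 * (r\<^sup>2 * ?q\<^sup>2)" by (simp add: algebra_simps)
    moreover have "0 \<le> r\<^sup>2 * ?q\<^sup>2" by simp
    ultimately have "1 + (p $ k)\<^sup>2 \<le> 2 * (1 + r\<^sup>2) * (1 + ?q\<^sup>2)" by linarith
    then show "1 / (1 + ((p + r *\<^sub>R n) $ k)\<^sup>2) \<le> 2 * (1 + r\<^sup>2) * (1 / (1 + (p $ k)\<^sup>2))"
      by (simp add: divide_simps add_pos_nonneg)
    show "0 \<le> 1 / (1 + ((p + r *\<^sub>R n) $ k)\<^sup>2)" by simp
  qed
  also have "\<dots> = (2 * (1 + r\<^sup>2)) ^ 3 * decay p"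
  proof -
    have "(\<Prod>k\<in>(UNIV::3 set). c) = c ^ 3" for c :: real by simp
    from this[of "2 * (1 + r\<^sup>2)"] show ?thesis by (simp only: decay_def prod.distrib)
  qed
  finally show ?thesis .
qed

text \<open>The support function of the cube [-1,1]^3. Up to a constant (sin p / p)^4 is the
  transform of a fourfold convolution of the indicator of [-1,1], so \<open>4 * norm1 n\<close> is
  the extent of the initial wave in direction n.\<close>

definition norm1 :: "real^3 \<Rightarrow> real" where "norm1 n = (\<Sum>k\<in>UNIV. \<bar>n $ k\<bar>)"

text \<open>The squared energy continued to complex momenta; the square is bilinear, without
  conjugation, to stay holomorphic.\<close>

definition mass_shell :: "real \<Rightarrow> complex^3 \<Rightarrow> complex" where
  "mass_shell m \<zeta> = (\<Sum>k\<in>UNIV. (\<zeta> $ k)\<^sup>2) + of_real (m\<^sup>2)"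

text \<open>One component of the amplitude: a, b and d k stand for components of u, m \<beta> u and
  \<alpha> k u. Left as free parameters, they also express the scalar product with u, where d
  vanishes.\<close>

definition amp :: "real \<Rightarrow> real \<Rightarrow> complex \<Rightarrow> complex \<Rightarrow> (3 \<Rightarrow> complex) \<Rightarrow> complex^3 \<Rightarrow> complex" where
  "amp m t a b d \<zeta> =
    (cos_sqrt (of_real (t\<^sup>2) * mass_shell m \<zeta>) * a
      + \<i> * of_real t * sinc_sqrt (of_real (t\<^sup>2) * mass_shell m \<zeta>) * ((\<Sum>k\<in>UNIV. \<zeta> $ k * d k) + b))
    * (\<Prod>k\<in>UNIV. sinc_sqrt ((\<zeta> $ k)\<^sup>2) ^ 4)"

lemma holomorphic_amp_cshift: "(\<lambda>z. amp m t a b d (cshift p z n)) holomorphic_on A"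
proof -
  have c: "(\<lambda>z. cos_sqrt (f z)) holomorphic_on A" if "f holomorphic_on A" for f
    using holomorphic_on_compose[OF that holomorphic_cos_sqrt] by (simp add: o_def)
  have s: "(\<lambda>z. sinc_sqrt (f z)) holomorphic_on A" if "f holomorphic_on A" for f
    using holomorphic_on_compose[OF that holomorphic_sinc_sqrt] by (simp add: o_def)
  show ?thesis unfolding amp_def mass_shell_def cshift_nth
    by (intro c s holomorphic_intros)
qed

lemma continuous_on_amp_cshift: "continuous_on A (\<lambda>p. amp m t a b d (cshift p z n))"
proof -
  have c: "continuous_on A (\<lambda>p. cos_sqrt (f p))" if "continuous_on A f" for f :: "real^3 \<Rightarrow> complex"
    by (rule continuous_on_compose2[OF holomorphic_on_imp_continuous_on[OF holomorphic_cos_sqrt] that]) auto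
  have s: "continuous_on A (\<lambda>p. sinc_sqrt (f p))" if "continuous_on A f" for f :: "real^3 \<Rightarrow> complex"
    by (rule continuous_on_compose2[OF holomorphic_on_imp_continuous_on[OF holomorphic_sinc_sqrt] that]) auto
  show ?thesis unfolding amp_def mass_shell_def cshift_nth
    by (intro c s continuous_intros)
qed

lemma borel_measurable_amp_cshift [measurable]: "(\<lambda>p. amp m t a b d (cshift p z n)) \<in> borel_measurable borel"
  by (intro borel_measurable_continuous_onI continuous_on_amp_cshift)

text \<open>Here 128 = 2 * 64: the 2 comes from the bound on the momentum components, and 64 = 4^3
  from the decay estimate in three coordinates.\<close>

definition amp_const :: "real \<Rightarrow> complex \<Rightarrow> complex \<Rightarrow> (3 \<Rightarrow> complex) \<Rightarrow> real" where
  "amp_const t a b d = 128 * (norm a + \<bar>t\<bar> * ((\<Sum>k\<in>UNIV. norm (d k)) + norm b))"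

lemma amp_const_nonneg: "amp_const t a b d \<ge> 0"
  by (simp add: amp_const_def sum_nonneg)

text \<open>With q = p + Re z n and y = Im z the mass shell takes the value |q|^2 + m^2 - y^2 + 2iy
  qn, and |qn| is at most the energy of q by Cauchy-Schwarz. This is propagation speed at most 1,
  seen in momentum space.\<close>

lemma abs_Im_csqrt_mass_shell_le:
  assumes n: "norm n = 1"
  shows "\<bar>Im (csqrt (mass_shell m (cshift p z n)))\<bar> \<le> \<bar>Im z\<bar>"
proof (rule abs_Im_sqrt_shift_le)
  let ?q = "p + Re z *\<^sub>R n" and ?y = "Im z"
  let ?a = "sqrt ((norm ?q)\<^sup>2 + m\<^sup>2)"
  have nn: "(\<Sum>k\<in>UNIV. (n $ k)\<^sup>2) = 1"
    using n by (simp add: norm_vec_def L2_set_def)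
  have qq: "(norm ?q)\<^sup>2 = (\<Sum>k\<in>UNIV. (?q $ k)\<^sup>2)"
    by (simp add: norm_vec_def L2_set_def sum_nonneg)
  have cz: "cshift p z n $ k = of_real (?q $ k) + \<i> * of_real (?y * n $ k)" for k
    by (simp add: complex_eq_iff)
  have "mass_shell m (cshift p z n) = (\<Sum>k\<in>UNIV. of_real ((?q $ k)\<^sup>2) - of_real (?y\<^sup>2 * (n $ k)\<^sup>2) + 2 * \<i> * of_real (?y * (?q $ k * n $ k))) + of_real (m\<^sup>2)"
    unfolding mass_shell_def cz
    by (intro arg_cong2[where f = "(+)"] sum.cong refl) (simp add: power2_eq_square algebra_simps)
  also have "\<dots> = of_real (norm ?q ^ 2) - of_real (?y\<^sup>2 * 1) + 2 * \<i> * of_real (?y * (?q \<bullet> n)) + of_real (m\<^sup>2)"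
    unfolding qq nn[symmetric] inner_vec_def
    by (simp add: sum.distrib sum_subtractf sum_distrib_left of_real_sum)
  also have "\<dots> = of_real (?a\<^sup>2 - ?y\<^sup>2) + 2 * \<i> * of_real (?y * (?q \<bullet> n))"
    by simp
  finally show "(csqrt (mass_shell m (cshift p z n)))\<^sup>2 = of_real (?a\<^sup>2 - ?y\<^sup>2) + 2 * \<i> * of_real (?y * (?q \<bullet> n))"
    by simp
  have "\<bar>?q \<bullet> n\<bar> \<le> norm ?q" using Cauchy_Schwarz_ineq2[of ?q n] n by simp
  also have "\<dots> \<le> ?a" by (rule real_le_rsqrt) simp
  finally show "\<bar>?q \<bullet> n\<bar> \<le> \<bar>?a\<bar>" by simp
qed

text \<open>Let P be the product of the 1 + (q_k)^2 with q = p + Re z n. The linear term costs one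
  factor P and the sine quotients give P^(-2), which leaves 1/P, the function \<open>decay\<close>.
  Cosine and sine of the energy contribute |t| to the exponent, the quotients
  \<open>4 * norm1 n\<close>.\<close>

lemma norm_amp_cshift_le:
  assumes n: "norm n = 1"
  shows "norm (amp m t a b d (cshift p z n))
    \<le> amp_const t a b d * (1 + \<bar>Im z\<bar>) * exp ((\<bar>t\<bar> + 4 * norm1 n) * \<bar>Im z\<bar>) * decay (p + Re z *\<^sub>R n)"
proof -
  let ?q = "p + Re z *\<^sub>R n" and ?y = "\<bar>Im z\<bar>"
  let ?w = "of_real (t\<^sup>2) * mass_shell m (cshift p z n)"
  let ?P = "\<Prod>k\<in>UNIV. 1 + (?q $ k)\<^sup>2"
  let ?D = "\<Sum>k\<in>UNIV. norm (d k)"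
  have y0: "?y \<ge> 0" by simp
  have wE: "?w = (of_real t * csqrt (mass_shell m (cshift p z n)))\<^sup>2" by (simp add: power_mult_distrib)
  have Im: "\<bar>Im (of_real t * csqrt (mass_shell m (cshift p z n)))\<bar> \<le> \<bar>t\<bar> * ?y"
    using mult_left_mono[OF abs_Im_csqrt_mass_shell_le[OF n, of m p z], of "\<bar>t\<bar>"] by (simp add: abs_mult)
  have c: "norm (cos_sqrt ?w) \<le> exp (\<bar>t\<bar> * ?y)"
    unfolding wE by (rule order_trans[OF norm_cos_sqrt_le]) (use Im in simp)
  have s: "norm (sinc_sqrt ?w) \<le> exp (\<bar>t\<bar> * ?y)"
    unfolding wE by (rule order_trans[OF norm_sinc_sqrt_le]) (use Im in simp)
  have P1: "1 + (?q $ k)\<^sup>2 \<le> ?P" for k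
  proof -
    have "?P = (1 + (?q $ k)\<^sup>2) * (\<Prod>j\<in>UNIV - {k}. 1 + (?q $ j)\<^sup>2)"
      by (rule prod.remove) auto
    moreover have "(\<Prod>j\<in>UNIV - {k}. 1 + (?q $ j)\<^sup>2) \<ge> 1" by (intro prod_ge_1) simp
    ultimately show ?thesis by (metis mult_left_mono mult.right_neutral add_nonneg_nonneg zero_le_one zero_le_power2)
  qed
  have zk: "norm (cshift p z n $ k) \<le> 2 * ?P * (1 + ?y)" for k
  proof -
    have "cshift p z n $ k = of_real (?q $ k) + \<i> * of_real (Im z * n $ k)"
      by (simp add: complex_eq_iff)
    then have "norm (cshift p z n $ k) \<le> norm (complex_of_real (?q $ k)) + norm (\<i> * complex_of_real (Im z * n $ k))"
      by (simp only: norm_triangle_ineq)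
    also have "\<dots> = \<bar>?q $ k\<bar> + ?y * \<bar>n $ k\<bar>"
      by (simp only: norm_mult norm_of_real abs_mult norm_ii mult_1_left)
    also have "\<dots> \<le> (1 + \<bar>?q $ k\<bar>) * (1 + ?y)"
    proof -
      have "(1 + \<bar>?q $ k\<bar>) * (1 + ?y) = 1 + \<bar>?q $ k\<bar> + ?y * 1 + \<bar>?q $ k\<bar> * ?y" by (simp add: algebra_simps)
      moreover have "?y * \<bar>n $ k\<bar> \<le> ?y * 1" by (intro mult_left_mono norm_nth_unit_le n) simp
      moreover have "0 \<le> \<bar>?q $ k\<bar> * ?y" by simp
      ultimately show ?thesis by linarith
    qed
    also have "\<dots> \<le> (2 * ?P) * (1 + ?y)"
    proof (intro mult_right_mono)
      have "\<bar>?q $ k\<bar> \<le> 1 + (?q $ k)\<^sup>2"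
        by (rule abs_le_1_plus_square)
      then show "1 + \<bar>?q $ k\<bar> \<le> 2 * ?P" using P1[of k] zero_le_power2[of "?q $ k"] by linarith
    qed simp
    finally show ?thesis .
  qed
  have one: "1 \<le> 2 * ?P * (1 + ?y)"
  proof -
    have "1 \<le> ?P" using P1[of 1] zero_le_power2[of "?q $ 1"] by linarith
    then have "1 * 1 \<le> (2 * ?P) * (1 + ?y)" by (intro mult_mono) auto
    then show ?thesis by simp
  qed
  let ?M = "2 * ?P * (1 + ?y)"
  have M0: "?M \<ge> 0" using one by linarith
  have lin: "norm ((\<Sum>k\<in>UNIV. cshift p z n $ k * d k) + b) \<le> ?M * (?D + norm b)"
  proof -
    have "norm ((\<Sum>k\<in>UNIV. cshift p z n $ k * d k) + b) \<le> norm (\<Sum>k\<in>UNIV. cshift p z n $ k * d k) + norm b"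
      by (rule norm_triangle_ineq)
    also have "norm (\<Sum>k\<in>UNIV. cshift p z n $ k * d k) \<le> (\<Sum>k\<in>UNIV. norm (cshift p z n $ k * d k))"
      by (rule norm_sum)
    also have "(\<Sum>k\<in>UNIV. norm (cshift p z n $ k * d k)) \<le> (\<Sum>k\<in>UNIV. ?M * norm (d k))"
      unfolding norm_mult by (intro sum_mono mult_right_mono zk) simp
    also have "norm b \<le> ?M * norm b" using mult_right_mono[OF one, of "norm b"] by simp
    finally show ?thesis by (simp add: sum_distrib_left distrib_left)
  qed
  have f1: "norm (cos_sqrt ?w * a + \<i> * of_real t * sinc_sqrt ?w * ((\<Sum>k\<in>UNIV. cshift p z n $ k * d k) + b))
    \<le> exp (\<bar>t\<bar> * ?y) * ?M * (norm a + \<bar>t\<bar> * (?D + norm b))"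
  proof -
    have "norm (cos_sqrt ?w * a + \<i> * of_real t * sinc_sqrt ?w * ((\<Sum>k\<in>UNIV. cshift p z n $ k * d k) + b))
      \<le> norm (cos_sqrt ?w) * norm a + \<bar>t\<bar> * (norm (sinc_sqrt ?w) * norm ((\<Sum>k\<in>UNIV. cshift p z n $ k * d k) + b))"
      by (rule order_trans[OF norm_triangle_ineq]) (simp add: norm_mult mult.assoc)
    also have "\<dots> \<le> exp (\<bar>t\<bar> * ?y) * (?M * norm a) + \<bar>t\<bar> * (exp (\<bar>t\<bar> * ?y) * (?M * (?D + norm b)))"
    proof (intro add_mono mult_mono c s lin mult_left_mono)
      show "norm a \<le> ?M * norm a" using mult_right_mono[OF one, of "norm a"] by simp
    qed (use M0 in auto)
    also have "\<dots> = exp (\<bar>t\<bar> * ?y) * ?M * (norm a + \<bar>t\<bar> * (?D + norm b))"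
      by (simp add: algebra_simps)
    finally show ?thesis .
  qed
  have f2: "norm (\<Prod>k\<in>UNIV. sinc_sqrt ((cshift p z n $ k)\<^sup>2) ^ 4) \<le> 64 * exp (4 * norm1 n * ?y) / ?P\<^sup>2"
  proof -
    have "norm (\<Prod>k\<in>UNIV. sinc_sqrt ((cshift p z n $ k)\<^sup>2) ^ 4) = (\<Prod>k\<in>UNIV. norm (sinc_sqrt ((cshift p z n $ k)\<^sup>2)) ^ 4)"
      by (simp add: prod_norm[symmetric] norm_power)
    also have "\<dots> \<le> (\<Prod>k\<in>(UNIV::3 set). 4 * exp (4 * (\<bar>n $ k\<bar> * ?y)) / (1 + (?q $ k)\<^sup>2)\<^sup>2)"
    proof (intro prod_mono conjI)
      fix k :: 3
      show "norm (sinc_sqrt ((cshift p z n $ k)\<^sup>2)) ^ 4 \<le> 4 * exp (4 * (\<bar>n $ k\<bar> * ?y)) / (1 + (?q $ k)\<^sup>2)\<^sup>2"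
        using norm_sinc_sqrt_decay[of "cshift p z n $ k"] by (simp add: abs_mult mult.commute)
    qed simp
    also have "\<dots> = (\<Prod>k\<in>(UNIV::3 set). 4) * (\<Prod>k\<in>UNIV. exp (4 * (\<bar>n $ k\<bar> * ?y))) / (\<Prod>k\<in>UNIV. (1 + (?q $ k)\<^sup>2)\<^sup>2)"
      by (simp only: prod_dividef prod.distrib)
    also have "\<dots> = 64 * exp (4 * norm1 n * ?y) / ?P\<^sup>2"
      by (simp add: exp_sum[symmetric] norm1_def sum_distrib_left sum_distrib_right prod_power_distrib mult.assoc)
    finally show ?thesis .
  qed
  have Ppos: "?P > 0" by (intro prod_pos) (simp add: add_pos_nonneg)
  have decP: "decay ?q = 1 / ?P" by (simp add: decay_def prod_dividef)
  have "norm (amp m t a b d (cshift p z n)) \<le> (exp (\<bar>t\<bar> * ?y) * ?M * (norm a + \<bar>t\<bar> * (?D + norm b))) * (64 * exp (4 * norm1 n * ?y) / ?P\<^sup>2)"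
    unfolding amp_def norm_mult[of _ "prod _ _"]
    by (intro mult_mono f1 f2 mult_nonneg_nonneg add_nonneg_nonneg sum_nonneg) (use M0 Ppos[THEN less_imp_le] in auto)
  also have "\<dots> = amp_const t a b d * (1 + ?y) * (exp (\<bar>t\<bar> * ?y) * exp (4 * norm1 n * ?y)) * decay ?q"
    using Ppos unfolding decP amp_const_def by (simp add: power2_eq_square)
  also have "exp (\<bar>t\<bar> * ?y) * exp (4 * norm1 n * ?y) = exp ((\<bar>t\<bar> + 4 * norm1 n) * ?y)"
    by (simp add: exp_add[symmetric] distrib_right)
  finally show ?thesis .
qed

section \<open>Waves with compact support\<close>

definition wave :: "real \<Rightarrow> real \<Rightarrow> complex \<Rightarrow> complex \<Rightarrow> (3 \<Rightarrow> complex) \<Rightarrow> real^3 \<Rightarrow> complex" where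
  "wave m t a b d x = of_real (fourier_const TYPE(real^3)) * (\<integral>p. cis (p \<bullet> x) * amp m t a b d (cshift p 0 0) \<partial>lborel)"

lemma cshift_0: "cshift p 0 n = cshift p 0 0"
  by (simp add: vec_eq_iff)

lemma norm_axis_eq: "norm (axis k (c::real)) = \<bar>c\<bar>"
  by (simp add: norm_eq_sqrt_inner inner_axis_axis)

lemma norm_amp_real_le: "norm (amp m t a b d (cshift p 0 0)) \<le> amp_const t a b d * decay p"
  \<comment> \<open>At z = 0 the direction is immaterial; any unit vector serves.\<close>
  using norm_amp_cshift_le[of "axis 1 1" m t a b d p 0] by (simp add: norm_axis_eq cshift_0[of p "axis 1 1"])

lemma integrable_amp_real: "integrable lborel (\<lambda>p. amp m t a b d (cshift p 0 0))"
proof (rule Bochner_Integration.integrable_bound[OF integrable_mult_right[OF integrable_decay, of "amp_const t a b d"]])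
  show "AE p in lborel. norm (amp m t a b d (cshift p 0 0)) \<le> norm (amp_const t a b d * decay p)"
    using norm_amp_real_le decay_pos amp_const_nonneg by (auto simp: abs_mult abs_of_pos)
qed simp

lemma wave_eq_ft: "wave m t a b d x = ft (\<lambda>p. amp m t a b d (cshift p 0 0)) (- x)"
  by (simp add: wave_def ft_def inner_commute)

lemma borel_measurable_wave [measurable]: "wave m t a b d \<in> borel_measurable borel"
  unfolding wave_eq_ft[abs_def]
  by (rule measurable_compose[OF _ borel_measurable_ft]) auto

text \<open>The right side is entire in z. For real z it is the integral at z = 0 after a
  translation of p, hence constant on the real axis, and the identity theorem makes it constant
  everywhere.\<close>

lemma wave_contour_shift:
  assumes n: "norm n = 1"
  shows "wave m t a b d x = of_real (fourier_const TYPE(real^3)) *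
    (\<integral>p. exp (\<i> * (of_real (p \<bullet> x) + z * of_real (n \<bullet> x))) * amp m t a b d (cshift p z n) \<partial>lborel)"
proof -
  define F where "F z p = exp (\<i> * (of_real (p \<bullet> x) + z * of_real (n \<bullet> x))) * amp m t a b d (cshift p z n)" for z p
  \<comment> \<open>Majorant for |z| <= R: \<open>decay_shift\<close> removes Re z from the argument
    of \<open>decay\<close> at the price of a polynomial in R.\<close>
  define D where "D R p = exp (R * \<bar>n \<bullet> x\<bar>) * (amp_const t a b d * (1 + R) * exp ((\<bar>t\<bar> + 4 * norm1 n) * R) * ((2 * (1 + R\<^sup>2)) ^ 3 * decay p))" for R p
  have N0: "norm1 n \<ge> 0" by (simp add: norm1_def sum_nonneg)
  have hol: "(\<lambda>z. integral\<^sup>L lborel (F z)) holomorphic_on UNIV"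
  proof (rule holomorphic_parametric_integral)
    show "(\<lambda>z. F z p) holomorphic_on UNIV" for p
      unfolding F_def by (intro holomorphic_intros holomorphic_amp_cshift)
    show "F z \<in> borel_measurable lborel" for z
      unfolding F_def by measurable
    show "integrable lborel (D R)" for R
      unfolding D_def by (intro integrable_mult_right integrable_decay)
    show "norm (F z p) \<le> D R p" if R: "norm z \<le> R" for R z p
    proof -
      have Im: "\<bar>Im z\<bar> \<le> R" and Re: "\<bar>Re z\<bar> \<le> R" using R abs_Im_le_cmod abs_Re_le_cmod order_trans by blast+
      then have R0: "R \<ge> 0" by linarith
      have "norm (exp (\<i> * (of_real (p \<bullet> x) + z * of_real (n \<bullet> x)))) = exp (- (Im z * (n \<bullet> x)))"
        by (simp add: norm_exp_eq_Re)
      also have "\<dots> \<le> exp (R * \<bar>n \<bullet> x\<bar>)"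
      proof (rule exp_le_cancel_iff[THEN iffD2])
        have "- (Im z * (n \<bullet> x)) \<le> \<bar>Im z\<bar> * \<bar>n \<bullet> x\<bar>" by (metis abs_ge_minus_self abs_mult)
        also have "\<dots> \<le> R * \<bar>n \<bullet> x\<bar>" by (intro mult_right_mono Im) simp
        finally show "- (Im z * (n \<bullet> x)) \<le> R * \<bar>n \<bullet> x\<bar>" .
      qed
      finally have e: "norm (exp (\<i> * (of_real (p \<bullet> x) + z * of_real (n \<bullet> x)))) \<le> exp (R * \<bar>n \<bullet> x\<bar>)" .
      have "(Re z)\<^sup>2 \<le> R\<^sup>2" using Re R0 by (simp add: abs_le_square_iff[symmetric])
      then have "(2 * (1 + (Re z)\<^sup>2)) ^ 3 \<le> (2 * (1 + R\<^sup>2)) ^ 3" by (intro power_mono) auto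
      then have dec: "decay (p + Re z *\<^sub>R n) \<le> (2 * (1 + R\<^sup>2)) ^ 3 * decay p"
        using decay_shift[OF n, of p "Re z"] decay_pos[of p] by (meson less_imp_le mult_right_mono order_trans)
      have "norm (amp m t a b d (cshift p z n)) \<le> amp_const t a b d * (1 + R) * exp ((\<bar>t\<bar> + 4 * norm1 n) * R) * ((2 * (1 + R\<^sup>2)) ^ 3 * decay p)"
      proof (rule order_trans[OF norm_amp_cshift_le[OF n]], intro mult_mono dec)
        show "exp ((\<bar>t\<bar> + 4 * norm1 n) * \<bar>Im z\<bar>) \<le> exp ((\<bar>t\<bar> + 4 * norm1 n) * R)"
          using Im N0 by (simp add: mult_left_mono)
      qed (use Im R0 amp_const_nonneg decay_pos[THEN less_imp_le] in auto)
      then show ?thesis unfolding F_def D_def norm_mult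
        by (intro mult_mono e) auto
    qed
  qed
  have "integral\<^sup>L lborel (F z) = integral\<^sup>L lborel (F 0)"
  proof (rule holomorphic_eq_of_eq_on_reals[OF hol])
    show "(\<lambda>z. integral\<^sup>L lborel (F 0)) holomorphic_on UNIV" by simp
    fix r :: real
    have "F (of_real r) p = F 0 (r *\<^sub>R n + 1 *\<^sub>R p)" for p
      by (simp add: F_def cshift_of_real[of p r n n] inner_add_left add.commute)
    then have "integral\<^sup>L lborel (F (of_real r)) = (\<integral>p. F 0 (r *\<^sub>R n + 1 *\<^sub>R p) \<partial>lborel)"
      by (intro Bochner_Integration.integral_cong) simp_all
    also have "\<dots> = integral\<^sup>L lborel (F 0)"
      using lborel_integral_affine[of 1 "F 0" "r *\<^sub>R n"] by simp
    finally show "integral\<^sup>L lborel (F (of_real r)) = integral\<^sup>L lborel (F 0)" .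
  qed
  moreover have "wave m t a b d x = of_real (fourier_const TYPE(real^3)) * integral\<^sup>L lborel (F 0)"
    by (simp add: F_def[abs_def] wave_def cis_conv_exp cshift_0[of _ n])
  ultimately show ?thesis by (simp add: F_def[abs_def])
qed

lemma linear_exp_tendsto_0:
  assumes "(c::real) > 0"
  shows "((\<lambda>s. (1 + s) * exp (- (c * s))) \<longlongrightarrow> 0) at_top"
  using assms by real_asymp

lemma wave_eq_0:
  assumes n: "norm n = 1" and x: "x \<bullet> n > \<bar>t\<bar> + 4 * norm1 n"
  shows "wave m t a b d x = 0"
proof -
  let ?A = "\<bar>t\<bar> + 4 * norm1 n" and ?K = "fourier_const TYPE(real^3)"
  let ?C = "?K * (amp_const t a b d * integral\<^sup>L lborel decay)"
  \<comment> \<open>At z = is the exponential contributes e^(-s xn) and the amplitude at most order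
    s e^(s(|t| + r)), while the wave itself does not depend on s.\<close>
  have le: "norm (wave m t a b d x) \<le> ?C * ((1 + s) * exp (- ((x \<bullet> n - ?A) * s)))" if s: "s \<ge> 0" for s
  proof -
    let ?F = "\<lambda>p. exp (\<i> * (of_real (p \<bullet> x) + (\<i> * of_real s) * of_real (n \<bullet> x))) * amp m t a b d (cshift p (\<i> * of_real s) n)"
    have "norm (integral\<^sup>L lborel ?F) \<le> (\<integral>p. norm (?F p) \<partial>lborel)" by (rule integral_norm_bound)
    also have "\<dots> \<le> (\<integral>p. (amp_const t a b d * ((1 + s) * exp (- ((x \<bullet> n - ?A) * s)))) * decay p \<partial>lborel)"
    proof (rule integral_mono')
      show "integrable lborel (\<lambda>p. (amp_const t a b d * ((1 + s) * exp (- ((x \<bullet> n - ?A) * s)))) * decay p)"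
        by (intro integrable_mult_right integrable_decay)
      fix p
      show "0 \<le> (amp_const t a b d * ((1 + s) * exp (- ((x \<bullet> n - ?A) * s)))) * decay p"
        using amp_const_nonneg decay_pos[of p] s by simp
      have "norm (?F p) = exp (- (s * (n \<bullet> x))) * norm (amp m t a b d (cshift p (\<i> * of_real s) n))"
        by (simp add: norm_mult norm_exp_eq_Re)
      also have "\<dots> \<le> exp (- (s * (n \<bullet> x))) * (amp_const t a b d * (1 + s) * exp (?A * s) * decay p)"
        using norm_amp_cshift_le[OF n, of m t a b d p "\<i> * of_real s"] s by (intro mult_left_mono) auto
      also have "\<dots> = (amp_const t a b d * (1 + s)) * (exp (- (s * (n \<bullet> x))) * exp (?A * s)) * decay p"
        by simp
      also have "exp (- (s * (n \<bullet> x))) * exp (?A * s) = exp (- ((x \<bullet> n - ?A) * s))"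
        by (simp add: exp_add[symmetric] inner_commute algebra_simps)
      finally show "norm (?F p) \<le> (amp_const t a b d * ((1 + s) * exp (- ((x \<bullet> n - ?A) * s)))) * decay p"
        by (simp add: mult.assoc)
    qed
    also have "\<dots> = amp_const t a b d * ((1 + s) * exp (- ((x \<bullet> n - ?A) * s))) * integral\<^sup>L lborel decay"
      by (rule integral_mult_right_zero)
    finally have "?K * norm (integral\<^sup>L lborel ?F) \<le> ?K * (amp_const t a b d * ((1 + s) * exp (- ((x \<bullet> n - ?A) * s))) * integral\<^sup>L lborel decay)"
      using fourier_const_pos[where 'a = "real^3"] by (intro mult_left_mono) auto
    then show ?thesis
      unfolding wave_contour_shift[OF n, of m t a b d x "\<i> * of_real s"] norm_mult[of "of_real ?K"]
      using fourier_const_pos[where 'a = "real^3"] by (simp add: mult_ac)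
  qed
  have "((\<lambda>s. ?C * ((1 + s) * exp (- ((x \<bullet> n - ?A) * s)))) \<longlongrightarrow> ?C * 0) at_top"
    using x by (intro tendsto_mult tendsto_const linear_exp_tendsto_0) simp
  then have "norm (wave m t a b d x) \<le> ?C * 0"
    by (rule tendsto_lowerbound) (use le in \<open>auto intro!: eventually_mono[OF eventually_ge_at_top[of 0]]\<close>)
  then show ?thesis by simp
qed

lemma norm1_axis: "norm1 (axis k c) = \<bar>c\<bar>"
proof -
  have "(\<Sum>j\<in>UNIV. \<bar>axis k c $ j\<bar>) = (\<Sum>j\<in>UNIV. if j = k then \<bar>c\<bar> else 0)"
    by (intro sum.cong) (auto simp: axis_def)
  then show ?thesis by (simp add: norm1_def)
qed

text \<open>Vanishing in the six coordinate directions confines every coordinate to |x_k| <= |t| +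
  4. The factor 3 comes from bounding the norm by the sum of three coordinates.\<close>

lemma wave_bounded_support:
  assumes "norm x > 3 * (\<bar>t\<bar> + 4)"
  shows "wave m t a b d x = 0"
proof (rule ccontr)
  assume nz: "wave m t a b d x \<noteq> 0"
  have "\<bar>x $ k\<bar> \<le> \<bar>t\<bar> + 4" for k
  proof (rule ccontr)
    assume gt: "\<not> ?thesis"
    \<comment> \<open>The sign picks the direction of the axis in which x has positive
      component.\<close>
    let ?n = "axis k (sgn (x $ k))"
    have nz': "x $ k \<noteq> 0" using gt by auto
    then have "norm ?n = 1" by (simp add: norm_axis_eq abs_sgn_eq)
    moreover have "x \<bullet> ?n = \<bar>x $ k\<bar>" by (simp add: inner_axis abs_sgn)
    ultimately show False using wave_eq_0[of ?n t x] gt nz nz' by (auto simp: norm1_axis abs_sgn_eq)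
  qed
  then have "(\<Sum>k\<in>UNIV. \<bar>x $ k\<bar>) \<le> (\<Sum>k\<in>(UNIV::3 set). \<bar>t\<bar> + 4)" by (intro sum_mono) simp
  then show False using assms norm_le_l1_cart[of x] by simp
qed

section \<open>The Fourier and Laplace transforms of a wave\<close>

lemma norm_wave_le: "norm (wave m t a b d x) \<le> fourier_const TYPE(real^3) * (\<integral>p. norm (amp m t a b d (cshift p 0 0)) \<partial>lborel)"
  unfolding wave_eq_ft by (rule norm_ft_le)

lemma integrable_bounded_support:
  fixes f :: "'a::euclidean_space \<Rightarrow> 'b::{banach,second_countable_topology}"
  assumes "f \<in> borel_measurable borel" and "\<And>x. norm (f x) \<le> B" and "\<And>x. norm x > r \<Longrightarrow> f x = 0"
  shows "integrable lborel f"
proof (rule Bochner_Integration.integrable_bound[where f = "\<lambda>x. B * indicator (cball 0 r) x"])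
  have "emeasure lborel (cball (0::'a) r) < \<infinity>" by (rule emeasure_lborel_cball_finite)
  then show "integrable lborel (\<lambda>x::'a. B * indicator (cball 0 r) x)"
    by (intro integrable_mult_right integrable_real_indicator) auto
  have "norm (f x) \<le> \<bar>B\<bar>" for x using assms(2)[of x] by linarith
  then show "AE x in lborel. norm (f x) \<le> norm (B * indicator (cball 0 r) x)"
    using assms(3) by (auto simp: indicator_def abs_mult not_le)
qed (use assms in simp)

lemma integrable_wave: "integrable lborel (wave m t a b d)"
  by (rule integrable_bounded_support[OF borel_measurable_wave norm_wave_le wave_bounded_support])

text \<open>Fourier inversion for the amplitude. Its transform is the reflected wave, and bounded
  support supplies the integrability that inversion requires.\<close>

lemma ft_wave: "ft (wave m t a b d) p = amp m t a b d (cshift p 0 0)"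
proof -
  let ?g = "\<lambda>p. amp m t a b d (cshift p 0 0)" and ?K = "fourier_const TYPE(real^3)"
  have iw: "integrable lborel (ft ?g)"
    using lborel_integrable_affine_iff[of "-1" "ft ?g" 0] integrable_wave[of m t a b d]
    by (simp add: wave_eq_ft[abs_def])
  have "isCont ?g p" using continuous_on_amp_cshift[of UNIV m t a b d 0 0] by (simp add: continuous_on_eq_continuous_at)
  moreover have "norm (?g q) \<le> amp_const t a b d" for q
    using norm_amp_real_le[of m t a b d q] decay_le_1[of q] amp_const_nonneg[of t a b d]
    by (meson mult_left_le order_trans)
  ultimately have "of_real ?K * (\<integral>q. cis (q \<bullet> p) * ft ?g q \<partial>lborel) = ?g p"
    using integrable_amp_real iw by (intro fourier_inversion) auto
  moreover have "(\<integral>q. cis (q \<bullet> p) * ft ?g q \<partial>lborel) = (\<integral>x. cis (- (p \<bullet> x)) * wave m t a b d x \<partial>lborel)"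
    using lborel_integral_affine[of "-1" "\<lambda>q. cis (q \<bullet> p) * ft ?g q" 0] by (simp add: wave_eq_ft inner_commute)
  ultimately show ?thesis by (simp add: ft_def)
qed

text \<open>For real z this is \<open>ft_wave\<close> at the momentum zn. Bounded support makes the
  left side entire, so the identity theorem extends it to complex z.\<close>

lemma laplace_wave:
  assumes n: "norm n = 1"
  shows "of_real (fourier_const TYPE(real^3)) * (\<integral>x. exp (- (\<i> * z * of_real (x \<bullet> n))) * wave m t a b d x \<partial>lborel)
    = amp m t a b d (cshift 0 z n)"
proof (rule holomorphic_eq_of_eq_on_reals[where z = z])
  let ?r = "3 * (\<bar>t\<bar> + 4)"
  show "(\<lambda>z. amp m t a b d (cshift 0 z n)) holomorphic_on UNIV" by (rule holomorphic_amp_cshift)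
  have "(\<lambda>z. \<integral>x. exp (- (\<i> * z * of_real (x \<bullet> n))) * wave m t a b d x \<partial>lborel) holomorphic_on UNIV"
  proof (rule holomorphic_parametric_integral[where D = "\<lambda>R x. exp (R * ?r) * norm (wave m t a b d x)"])
    show "(\<lambda>z. exp (- (\<i> * z * of_real (x \<bullet> n))) * wave m t a b d x) holomorphic_on UNIV" for x
      by (intro holomorphic_intros)
    show "(\<lambda>x. exp (- (\<i> * z * of_real (x \<bullet> n))) * wave m t a b d x) \<in> borel_measurable lborel" for z
      by measurable
    show "integrable lborel (\<lambda>x. exp (R * ?r) * norm (wave m t a b d x))" for R
      by (intro integrable_mult_right integrable_norm integrable_wave)
    show "norm (exp (- (\<i> * z * of_real (x \<bullet> n))) * wave m t a b d x) \<le> exp (R * ?r) * norm (wave m t a b d x)" if R: "norm z \<le> R" for R z x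
    proof (cases "norm x > ?r")
      case True
      then show ?thesis by (simp add: wave_bounded_support)
    next
      case False
      have "Im z * (x \<bullet> n) \<le> \<bar>Im z\<bar> * \<bar>x \<bullet> n\<bar>" by (metis abs_ge_self abs_mult)
      also have "\<dots> \<le> R * ?r"
      proof (rule mult_mono)
        show "\<bar>Im z\<bar> \<le> R" using R abs_Im_le_cmod order_trans by blast
        then show "0 \<le> R" by linarith
        show "\<bar>x \<bullet> n\<bar> \<le> ?r" using Cauchy_Schwarz_ineq2[of x n] n False by simp
      qed simp
      finally have "exp (Im z * (x \<bullet> n)) \<le> exp (R * ?r)" by simp
      then show ?thesis by (simp add: norm_mult norm_exp_eq_Re mult_right_mono)
    qed
  qed
  then show "(\<lambda>z. of_real (fourier_const TYPE(real^3)) * (\<integral>x. exp (- (\<i> * z * of_real (x \<bullet> n))) * wave m t a b d x \<partial>lborel)) holomorphic_on UNIV"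
    by (intro holomorphic_intros)
  fix r :: real
  have "of_real (fourier_const TYPE(real^3)) * (\<integral>x. exp (- (\<i> * of_real r * of_real (x \<bullet> n))) * wave m t a b d x \<partial>lborel) = ft (wave m t a b d) (r *\<^sub>R n)"
    by (simp add: ft_def cis_conv_exp inner_commute mult.assoc)
  then show "of_real (fourier_const TYPE(real^3)) * (\<integral>x. exp (- (\<i> * of_real r * of_real (x \<bullet> n))) * wave m t a b d x \<partial>lborel) = amp m t a b d (cshift 0 (of_real r) n)"
    by (simp add: ft_wave cshift_of_real[of 0 r n 0])
qed

text \<open>At z = is the kernel of the Laplace transform is e^(s xn), at most e^(sc) on the
  support. A support that is too small thus forces the amplitude to grow too slowly.\<close>

lemma norm_amp_imaginary_le:
  assumes n: "norm n = 1" and v: "AE x in lborel. x \<bullet> n > c \<longrightarrow> wave m t a b d x = 0" and s: "s \<ge> 0"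
  shows "norm (amp m t a b d (cshift 0 (\<i> * of_real s) n)) \<le> fourier_const TYPE(real^3) * (\<integral>x. norm (wave m t a b d x) \<partial>lborel) * exp (s * c)"
proof -
  let ?F = "\<lambda>x. exp (- (\<i> * (\<i> * of_real s) * of_real (x \<bullet> n))) * wave m t a b d x"
  have "norm (integral\<^sup>L lborel ?F) \<le> (\<integral>x. norm (?F x) \<partial>lborel)" by (rule integral_norm_bound)
  also have "\<dots> \<le> (\<integral>x. exp (s * c) * norm (wave m t a b d x) \<partial>lborel)"
  proof (rule integral_mono_AE')
    show "integrable lborel (\<lambda>x. exp (s * c) * norm (wave m t a b d x))"
      by (intro integrable_mult_right integrable_norm integrable_wave)
    show "AE x in lborel. norm (?F x) \<le> exp (s * c) * norm (wave m t a b d x)"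
      using v
    proof eventually_elim
      case (elim x)
      show ?case
      proof (cases "x \<bullet> n > c")
        case False
        then have "exp (s * (x \<bullet> n)) \<le> exp (s * c)" using s by (simp add: mult_left_mono)
        then show ?thesis by (simp add: norm_mult norm_exp_eq_Re mult_right_mono)
      qed (use elim in simp)
    qed
  qed simp
  also have "\<dots> = exp (s * c) * (\<integral>x. norm (wave m t a b d x) \<partial>lborel)" by (rule integral_mult_right_zero)
  finally have "fourier_const TYPE(real^3) * norm (integral\<^sup>L lborel ?F) \<le> fourier_const TYPE(real^3) * (exp (s * c) * (\<integral>x. norm (wave m t a b d x) \<partial>lborel))"
    using fourier_const_pos[where 'a = "real^3"] by (intro mult_left_mono) auto
  then show ?thesis
    unfolding laplace_wave[OF n, of "\<i> * of_real s" m t a b d, symmetric] norm_mult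
    using fourier_const_pos[where 'a = "real^3"] by (simp add: mult_ac)
qed

section \<open>Dirac matrices and the propagator\<close>

lemma matrix_mul_scaleR_left: "(c *\<^sub>R A) ** B = c *\<^sub>R (A ** (B::complex^4^4))"
  by (simp add: vec_eq_iff matrix_matrix_mult_def scaleR_sum_right)

lemma matrix_mul_scaleR_right: "A ** (c *\<^sub>R B) = c *\<^sub>R (A ** (B::complex^4^4))"
  by (simp add: vec_eq_iff matrix_matrix_mult_def scaleR_sum_right)

lemma scaleR_matrix_vector: "(c *\<^sub>R A) *v v = c *\<^sub>R (A *v (v::complex^4))" for A :: "complex^4^4"
  by (simp add: vec_eq_iff matrix_vector_mult_def scaleR_sum_right)

lemma matrix_vector_scaleR: "A *v (c *\<^sub>R v) = c *\<^sub>R (A *v (v::complex^4))" for A :: "complex^4^4"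
  by (simp add: vec_eq_iff matrix_vector_mult_def scaleR_sum_right)

lemma matrix_scale_mult: "matrix_scale c A ** matrix_scale d B = matrix_scale (c * d) (A ** B)"
  by (simp add: vec_eq_iff matrix_scale_def matrix_matrix_mult_def sum_distrib_left mult_ac)

lemma matrix_scale_of_real: "matrix_scale (c * of_real r) A = r *\<^sub>R matrix_scale c A"
  by (simp add: vec_eq_iff matrix_scale_def scaleR_conv_of_real[where 'a = complex] mult_ac)

lemma matrix_vector_uminus_left: "(- A) *v v = - (A *v (v::complex^4))" for A :: "complex^4^4"
  by (simp add: vec_eq_iff matrix_vector_mult_def sum_negf)

lemma matrix_add_rdistrib: "(A + B) ** C = A ** C + B ** (C::complex^4^4)"
  by (simp add: vec_eq_iff matrix_matrix_mult_def sum.distrib distrib_right)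

definition energy :: "real \<Rightarrow> real^3 \<Rightarrow> real" where
  "energy m p = sqrt ((norm p)\<^sup>2 + m\<^sup>2)"

lemma energy_pos: "m > 0 \<Longrightarrow> energy m p > 0"
  by (simp add: energy_def add_nonneg_pos)

lemma energy_power2: "(energy m p)\<^sup>2 = (norm p)\<^sup>2 + m\<^sup>2"
  by (simp add: energy_def)

lemma matrix_sum_ldistrib: "A ** (\<Sum>k\<in>S. f k) = (\<Sum>k\<in>S. A ** (f k :: complex^4^4))"
  by (induction S rule: infinite_finite_induct) (simp_all add: matrix_add_ldistrib)

lemma matrix_sum_rdistrib: "(\<Sum>k\<in>S. f k) ** A = (\<Sum>k\<in>S. f k ** (A :: complex^4^4))"
  by (induction S rule: infinite_finite_induct) (simp_all add: matrix_add_rdistrib)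

lemma dirac_symbol_square:
  assumes D: "dirac_matrices \<alpha> \<beta>"
  shows "dirac_symbol m \<alpha> \<beta> p ** dirac_symbol m \<alpha> \<beta> p = (energy m p)\<^sup>2 *\<^sub>R mat 1"
proof -
  let ?X = "\<Sum>k\<in>UNIV. (p $ k) *\<^sub>R \<alpha> k" and ?Y = "m *\<^sub>R \<beta>"
  have aa: "\<alpha> j ** \<alpha> k + \<alpha> k ** \<alpha> j = (if j = k then 2 *\<^sub>R mat 1 else 0)"
    and ab: "\<alpha> k ** \<beta> + \<beta> ** \<alpha> k = 0" and bb: "\<beta> ** \<beta> = mat 1" for j k
    using D by (auto simp: dirac_matrices_def)
  have XX: "?X ** ?X = (\<Sum>j\<in>UNIV. \<Sum>k\<in>UNIV. (p $ j * p $ k) *\<^sub>R (\<alpha> j ** \<alpha> k))"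
    unfolding matrix_sum_rdistrib unfolding matrix_sum_ldistrib
    by (simp add: matrix_mul_scaleR_left matrix_mul_scaleR_right mult.commute)
  have XX': "?X ** ?X = (\<Sum>j\<in>UNIV. \<Sum>k\<in>UNIV. (p $ j * p $ k) *\<^sub>R (\<alpha> k ** \<alpha> j))"
    unfolding XX by (subst sum.swap) (simp add: mult.commute)
  \<comment> \<open>Only anticommutators are known, so the double sum is added to its
    transpose.\<close>
  have "2 *\<^sub>R (?X ** ?X) = ?X ** ?X + ?X ** ?X" by (rule scaleR_2)
  also have "\<dots> = (\<Sum>j\<in>UNIV. \<Sum>k\<in>UNIV. (p $ j * p $ k) *\<^sub>R (\<alpha> j ** \<alpha> k + \<alpha> k ** \<alpha> j))"
    by (subst (1) XX, subst XX') (simp add: sum.distrib scaleR_add_right)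
  also have "\<dots> = (\<Sum>j\<in>UNIV. \<Sum>k\<in>UNIV. if j = k then (2 * (p $ j)\<^sup>2) *\<^sub>R mat 1 else 0)"
    unfolding aa by (intro sum.cong) (auto simp: power2_eq_square)
  also have "\<dots> = (\<Sum>j\<in>UNIV. (2 * (p $ j)\<^sup>2) *\<^sub>R mat 1)" by simp
  also have "\<dots> = 2 *\<^sub>R ((norm p)\<^sup>2 *\<^sub>R mat 1)"
    by (simp add: scaleR_sum_left[symmetric] sum_distrib_left[symmetric] norm_vec_def L2_set_def sum_nonneg)
  finally have X2: "?X ** ?X = (norm p)\<^sup>2 *\<^sub>R mat 1"
    unfolding scaleR_cancel_left by simp
  have "?X ** ?Y + ?Y ** ?X = (\<Sum>k\<in>UNIV. (m * p $ k) *\<^sub>R (\<alpha> k ** \<beta> + \<beta> ** \<alpha> k))"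
    by (simp add: matrix_sum_rdistrib matrix_sum_ldistrib matrix_mul_scaleR_left matrix_mul_scaleR_right scaleR_add_right sum.distrib scaleR_sum_right mult.commute)
  then have XY: "?X ** ?Y + ?Y ** ?X = 0" by (simp add: ab)
  have "dirac_symbol m \<alpha> \<beta> p ** dirac_symbol m \<alpha> \<beta> p = ?X ** ?X + (?X ** ?Y + ?Y ** ?X) + ?Y ** ?Y"
    by (simp add: dirac_symbol_def matrix_add_ldistrib matrix_add_rdistrib)
  also have "\<dots> = (energy m p)\<^sup>2 *\<^sub>R mat 1"
    unfolding XY X2 energy_power2
    by (simp add: matrix_mul_scaleR_left matrix_mul_scaleR_right bb scaleR_add_left power2_eq_square)
  finally show ?thesis .
qed

text \<open>Even powers of B are multiples of the identity and odd powers are multiples of B, so the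
  exponential series splits into the cosine and the sine series.\<close>

lemma matrix_exp_of_square:
  fixes B :: "complex^4^4"
  assumes B: "B ** B = - (E\<^sup>2) *\<^sub>R mat 1" and E: "E \<noteq> 0"
  shows "matrix_exp (t *\<^sub>R B) = cos (t * E) *\<^sub>R mat 1 + (sin (t * E) / E) *\<^sub>R B"
proof -
  let ?P = "\<lambda>n. (((**) (t *\<^sub>R B)) ^^ n) (mat 1)"
  have even: "?P (2 * k) = ((-1) ^ k * (t * E) ^ (2 * k)) *\<^sub>R mat 1" for k
  proof (induction k)
    case (Suc k)
    have "?P (2 * Suc k) = (t *\<^sub>R B) ** ((t *\<^sub>R B) ** ?P (2 * k))" by simp
    also have "\<dots> = ((-1) ^ k * (t * E) ^ (2 * k) * t * t) *\<^sub>R (B ** B)"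
      unfolding Suc by (simp add: matrix_mul_scaleR_left matrix_mul_scaleR_right mult_ac)
    also have "\<dots> = ((-1) ^ Suc k * (t * E) ^ (2 * Suc k)) *\<^sub>R mat 1"
      unfolding B by (simp add: power2_eq_square mult_ac)
    finally show ?case .
  qed simp
  have odd: "?P (Suc (2 * k)) = ((-1) ^ k * (t * E) ^ (2 * k) * t) *\<^sub>R B" for k
  proof -
    have "?P (Suc (2 * k)) = (t *\<^sub>R B) ** ?P (2 * k)" by simp
    then show ?thesis unfolding even by (simp add: matrix_mul_scaleR_left matrix_mul_scaleR_right mult_ac)
  qed
  have step: "(1 / fact n) *\<^sub>R ?P n = (cos_coeff n *\<^sub>R (t * E) ^ n) *\<^sub>R mat 1 + (sin_coeff n *\<^sub>R (t * E) ^ n) *\<^sub>R ((1 / E) *\<^sub>R B)" for n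
  proof (cases "even n")
    case True
    then obtain k where "n = 2 * k" by blast
    then show ?thesis by (simp only: even) (simp add: cos_coeff_def sin_coeff_def)
  next
    case False
    then obtain k where "n = Suc (2 * k)" by (metis oddE Suc_eq_plus1)
    then show ?thesis by (simp only: odd) (use E in \<open>simp add: cos_coeff_def sin_coeff_def\<close>)
  qed
  have "(\<lambda>n. (1 / fact n) *\<^sub>R ?P n) sums (cos (t * E) *\<^sub>R mat 1 + sin (t * E) *\<^sub>R ((1 / E) *\<^sub>R B))"
    unfolding step by (intro sums_add sums_scaleR_left cos_converges sin_converges)
  then show ?thesis by (simp add: matrix_exp_def sums_iff)
qed

text \<open>This is e^(ith(p)) v: since (ih)^2 = -E^2, the exponential series collapses to these two
  terms.\<close>

definition dirac_propagator :: "real \<Rightarrow> (3 \<Rightarrow> complex^4^4) \<Rightarrow> complex^4^4 \<Rightarrow> real \<Rightarrow> real^3 \<Rightarrow> complex^4 \<Rightarrow> complex^4" where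
  "dirac_propagator m \<alpha> \<beta> t p v =
     cos (t * energy m p) *\<^sub>R v + (sin (t * energy m p) / energy m p) *\<^sub>R (matrix_scale \<i> (dirac_symbol m \<alpha> \<beta> p) *v v)"

lemma imaginary_dirac_symbol_square:
  assumes D: "dirac_matrices \<alpha> \<beta>"
  shows "matrix_scale \<i> (dirac_symbol m \<alpha> \<beta> p) ** matrix_scale \<i> (dirac_symbol m \<alpha> \<beta> p) = - ((energy m p)\<^sup>2) *\<^sub>R mat 1"
  unfolding matrix_scale_mult dirac_symbol_square[OF D]
  by (simp add: vec_eq_iff matrix_scale_def)

lemma matrix_exp_dirac:
  assumes m: "m > 0" and D: "dirac_matrices \<alpha> \<beta>"
  shows "matrix_exp (matrix_scale (\<i> * of_real t) (dirac_symbol m \<alpha> \<beta> p)) *v v = dirac_propagator m \<alpha> \<beta> t p v"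
  unfolding matrix_scale_of_real matrix_exp_of_square[OF imaginary_dirac_symbol_square[OF D] less_imp_neq[OF energy_pos[OF m], symmetric]]
  by (simp add: dirac_propagator_def matrix_vector_mult_add_rdistrib scaleR_matrix_vector)

lemma dirac_propagator_add:
  assumes m: "m > 0" and D: "dirac_matrices \<alpha> \<beta>"
  shows "dirac_propagator m \<alpha> \<beta> t p (dirac_propagator m \<alpha> \<beta> s p v) = dirac_propagator m \<alpha> \<beta> (t + s) p v"
proof -
  let ?E = "energy m p" and ?B = "matrix_scale \<i> (dirac_symbol m \<alpha> \<beta> p)"
  have E: "?E \<noteq> 0" using energy_pos[OF m, of p] by simp
  have BB: "?B *v (?B *v v) = - (?E\<^sup>2) *\<^sub>R v"
    unfolding matrix_vector_mul_assoc imaginary_dirac_symbol_square[OF D] by (simp add: scaleR_matrix_vector matrix_vector_uminus_left)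
  have "dirac_propagator m \<alpha> \<beta> t p (dirac_propagator m \<alpha> \<beta> s p v)
    = (cos (t * ?E) * cos (s * ?E)) *\<^sub>R v + (cos (t * ?E) * (sin (s * ?E) / ?E)) *\<^sub>R (?B *v v)
      + ((sin (t * ?E) / ?E) * cos (s * ?E)) *\<^sub>R (?B *v v) + ((sin (t * ?E) / ?E) * (sin (s * ?E) / ?E)) *\<^sub>R (?B *v (?B *v v))"
    by (simp add: dirac_propagator_def matrix_vector_right_distrib matrix_vector_scaleR scaleR_add_right)
  also have "\<dots> = (cos (t * ?E) * cos (s * ?E) - sin (t * ?E) * sin (s * ?E)) *\<^sub>R v
      + ((sin (t * ?E) * cos (s * ?E) + cos (t * ?E) * sin (s * ?E)) / ?E) *\<^sub>R (?B *v v)"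
    unfolding BB using E by (simp add: scaleR_add_left scaleR_diff_left add_divide_distrib power2_eq_square)
  also have "\<dots> = dirac_propagator m \<alpha> \<beta> (t + s) p v"
    by (simp add: dirac_propagator_def distrib_right cos_add sin_add)
  finally show ?thesis .
qed

lemma dirac_propagator_smult: "dirac_propagator m \<alpha> \<beta> t p (c *s v) = c *s dirac_propagator m \<alpha> \<beta> t p v"
  by (simp add: vec_eq_iff dirac_propagator_def vector_scalar_commute algebra_simps)

lemma dirac_propagator_plus: "dirac_propagator m \<alpha> \<beta> t p (v + w) = dirac_propagator m \<alpha> \<beta> t p v + dirac_propagator m \<alpha> \<beta> t p w"
  by (simp add: dirac_propagator_def matrix_vector_right_distrib scaleR_add_right)

text \<open>Componentwise, because the analytic estimates are scalar. At real momenta it is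
  e^(ith(p)) u times the sine quotients.\<close>

definition spinor_amp :: "real \<Rightarrow> (3 \<Rightarrow> complex^4^4) \<Rightarrow> complex^4^4 \<Rightarrow> complex^4 \<Rightarrow> real \<Rightarrow> complex^3 \<Rightarrow> complex^4" where
  "spinor_amp m \<alpha> \<beta> u t \<zeta> = (\<chi> i. amp m t (u $ i) (of_real m * (\<beta> *v u) $ i) (\<lambda>k. (\<alpha> k *v u) $ i) \<zeta>)"

definition spinor_wave :: "real \<Rightarrow> (3 \<Rightarrow> complex^4^4) \<Rightarrow> complex^4^4 \<Rightarrow> complex^4 \<Rightarrow> real \<Rightarrow> real^3 \<Rightarrow> complex^4" where
  "spinor_wave m \<alpha> \<beta> u t x = (\<chi> i. wave m t (u $ i) (of_real m * (\<beta> *v u) $ i) (\<lambda>k. (\<alpha> k *v u) $ i) x)"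

lemma matrix_vector_sum_left: "(\<Sum>k\<in>S. f k) *v v = (\<Sum>k\<in>S. f k *v (v :: complex^4))" for f :: "'i \<Rightarrow> complex^4^4"
  by (induction S rule: infinite_finite_induct) (simp_all add: matrix_vector_mult_add_rdistrib)

lemma spinor_amp_real:
  assumes m: "m > 0"
  shows "spinor_amp m \<alpha> \<beta> u t (cshift p 0 0) = (\<Prod>k\<in>UNIV. sinc_sqrt ((of_real (p $ k))\<^sup>2) ^ 4) *s dirac_propagator m \<alpha> \<beta> t p u"
proof -
  let ?E = "energy m p"
  have E: "?E \<noteq> 0" using energy_pos[OF m, of p] by simp
  have "(norm p)\<^sup>2 = (\<Sum>k\<in>UNIV. (p $ k)\<^sup>2)" by (simp add: norm_vec_def L2_set_def sum_nonneg)
  then have w: "of_real (t\<^sup>2) * mass_shell m (cshift p 0 0) = (complex_of_real (t * ?E))\<^sup>2"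
    by (simp add: mass_shell_def power_mult_distrib energy_power2 flip: of_real_power of_real_add of_real_mult of_real_sum)
  have c: "cos_sqrt (of_real (t\<^sup>2) * mass_shell m (cshift p 0 0)) = of_real (cos (t * ?E))"
    unfolding w by (simp only: cos_sqrt_power2 cos_of_real)
  have s: "of_real t * sinc_sqrt (of_real (t\<^sup>2) * mass_shell m (cshift p 0 0)) = of_real (sin (t * ?E) / ?E)"
  proof -
    \<comment> \<open>The factor t in front turns sin (tE) / (tE) into sin (tE) / E, also at t =
      0.\<close>
    have "complex_of_real (t * ?E) * sinc_sqrt ((complex_of_real (t * ?E))\<^sup>2) = of_real (sin (t * ?E))"
      by (simp only: mult_sinc_sqrt_power2 sin_of_real)
    then show ?thesis unfolding w using E by (simp add: field_simps)
  qed
  have B: "(matrix_scale \<i> (dirac_symbol m \<alpha> \<beta> p) *v u) $ i = \<i> * ((\<Sum>k\<in>UNIV. of_real (p $ k) * (\<alpha> k *v u) $ i) + of_real m * (\<beta> *v u) $ i)" for i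
  proof -
    have "(matrix_scale \<i> (dirac_symbol m \<alpha> \<beta> p) *v u) $ i = \<i> * (dirac_symbol m \<alpha> \<beta> p *v u) $ i"
      by (simp add: matrix_vector_mult_def matrix_scale_def sum_distrib_left mult.assoc)
    also have "dirac_symbol m \<alpha> \<beta> p *v u = (\<Sum>k\<in>UNIV. (p $ k) *\<^sub>R (\<alpha> k *v u)) + m *\<^sub>R (\<beta> *v u)"
      by (simp add: dirac_symbol_def matrix_vector_mult_add_rdistrib matrix_vector_sum_left scaleR_matrix_vector)
    finally show ?thesis by (simp add: scaleR_conv_of_real[where 'a = complex])
  qed
  show ?thesis
  proof (simp only: vec_eq_iff, intro allI)
    fix i
    let ?L = "(\<Sum>k\<in>UNIV. of_real (p $ k) * (\<alpha> k *v u) $ i) + of_real m * (\<beta> *v u) $ i"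
    have "spinor_amp m \<alpha> \<beta> u t (cshift p 0 0) $ i = (of_real (cos (t * ?E)) * u $ i + \<i> * (of_real (sin (t * ?E) / ?E)) * ?L) * (\<Prod>k\<in>UNIV. sinc_sqrt ((of_real (p $ k))\<^sup>2) ^ 4)"
    proof -
      have "spinor_amp m \<alpha> \<beta> u t (cshift p 0 0) $ i = (cos_sqrt (of_real (t\<^sup>2) * mass_shell m (cshift p 0 0)) * u $ i
        + \<i> * (of_real t * sinc_sqrt (of_real (t\<^sup>2) * mass_shell m (cshift p 0 0))) * ?L) * (\<Prod>k\<in>UNIV. sinc_sqrt ((of_real (p $ k))\<^sup>2) ^ 4)"
        by (simp add: spinor_amp_def amp_def mult.assoc)
      then show ?thesis unfolding c s .
    qed
    then show "spinor_amp m \<alpha> \<beta> u t (cshift p 0 0) $ i = ((\<Prod>k\<in>UNIV. sinc_sqrt ((of_real (p $ k))\<^sup>2) ^ 4) *s dirac_propagator m \<alpha> \<beta> t p u) $ i"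
      by (simp add: dirac_propagator_def B scaleR_conv_of_real[where 'a = complex] mult_ac distrib_left)
  qed
qed

lemma dirac_propagator_spinor_amp:
  assumes "m > 0" and "dirac_matrices \<alpha> \<beta>"
  shows "dirac_propagator m \<alpha> \<beta> t p (spinor_amp m \<alpha> \<beta> u s (cshift p 0 0)) = spinor_amp m \<alpha> \<beta> u (t + s) (cshift p 0 0)"
  by (simp add: spinor_amp_real assms dirac_propagator_smult dirac_propagator_add)

text \<open>The complex-valued scalar product; \<open>inner\<close> on \<open>complex^4\<close> is
  its real part.\<close>

definition cdot :: "complex^4 \<Rightarrow> complex^4 \<Rightarrow> complex" where
  "cdot u v = (\<Sum>i\<in>UNIV. cnj (u $ i) * v $ i)"

lemma cdot_hermitian: "hermitian A \<Longrightarrow> cdot u (A *v v) = cdot (A *v u) v"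
proof -
  assume A: "hermitian A"
  have "cdot u (A *v v) = (\<Sum>i\<in>UNIV. \<Sum>j\<in>UNIV. cnj (u $ i) * (A $ i $ j * v $ j))"
    by (simp add: cdot_def matrix_vector_mult_def sum_distrib_left)
  also have "\<dots> = (\<Sum>j\<in>UNIV. \<Sum>i\<in>UNIV. cnj (u $ i) * (A $ i $ j * v $ j))" by (rule sum.swap)
  also have "\<dots> = (\<Sum>j\<in>UNIV. \<Sum>i\<in>UNIV. cnj (A $ j $ i) * cnj (u $ i) * v $ j)"
  proof (intro sum.cong refl)
    fix i j
    have "A $ i $ j = cnj (A $ j $ i)" using A unfolding hermitian_def by blast
    then show "cnj (u $ i) * (A $ i $ j * v $ j) = cnj (A $ j $ i) * cnj (u $ i) * v $ j"
      by (metis mult.assoc mult.commute)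
  qed
  also have "\<dots> = cdot (A *v u) v"
    by (simp add: cdot_def matrix_vector_mult_def sum_distrib_right)
  finally show ?thesis .
qed

lemma cdot_scaleR_right: "cdot u (c *\<^sub>R v) = of_real c * cdot u v"
  by (simp add: cdot_def sum_distrib_left scaleR_conv_of_real[where 'a = complex] mult.left_commute)

lemma cdot_scaleR_left: "cdot (c *\<^sub>R u) v = of_real c * cdot u v"
  by (simp add: cdot_def sum_distrib_left scaleR_conv_of_real[where 'a = complex] mult.assoc)

lemma cdot_uminus_right: "cdot u (- v) = - cdot u v"
  by (simp add: cdot_def sum_negf)

lemma cdot_self: "cdot u u = of_real ((norm u)\<^sup>2)"
  unfolding norm_power2_vec of_real_sum complex_norm_square cdot_def by (simp add: mult.commute)

text \<open>Since \<beta> is an involution it fixes w + \<beta> w; when that sum is 0, w itself has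
  eigenvalue -1.\<close>

lemma exists_beta_eigenvector:
  assumes D: "dirac_matrices \<alpha> \<beta>"
  obtains u \<sigma> where "u \<noteq> 0" "\<beta> *v u = \<sigma> *\<^sub>R u" "\<sigma> = 1 \<or> \<sigma> = (-1::real)"
proof -
  let ?w = "axis 1 1 :: complex^4"
  have w: "?w \<noteq> 0" by simp
  have bb: "\<beta> *v (\<beta> *v ?w) = ?w" using D by (simp add: dirac_matrices_def matrix_vector_mul_assoc)
  show ?thesis
  proof (cases "?w + \<beta> *v ?w = 0")
    case True
    then have "\<beta> *v ?w = - ?w" by (simp add: add_eq_0_iff)
    then show ?thesis using that[of ?w "-1"] w by simp
  next
    case False
    have "\<beta> *v (?w + \<beta> *v ?w) = ?w + \<beta> *v ?w" by (simp add: matrix_vector_right_distrib bb add.commute)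
    then show ?thesis using that[of "?w + \<beta> *v ?w" 1] False by simp
  qed
qed

text \<open>\<open>\<beta>\<close> anticommutes with \<open>\<alpha> k\<close>, so on an eigenvector of \<open>\<beta>\<close> the velocity \<open>\<alpha> k\<close> has expectation \<open>0\<close>.\<close>

lemma cdot_alpha_eq_0:
  assumes D: "dirac_matrices \<alpha> \<beta>" and u: "\<beta> *v u = \<sigma> *\<^sub>R u" and \<sigma>: "\<sigma> \<noteq> 0"
  shows "cdot u (\<alpha> k *v u) = 0"
proof -
  have "\<alpha> k ** \<beta> = - (\<beta> ** \<alpha> k)" using D by (simp add: dirac_matrices_def add_eq_0_iff2)
  then have "(\<alpha> k ** \<beta>) *v u = (- (\<beta> ** \<alpha> k)) *v u" by simp
  then have "\<alpha> k *v (\<beta> *v u) = - (\<beta> *v (\<alpha> k *v u))"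
    by (simp add: matrix_vector_mul_assoc[symmetric] matrix_vector_uminus_left)
  moreover have "cdot u (\<beta> *v (\<alpha> k *v u)) = cdot (\<beta> *v u) (\<alpha> k *v u)"
    using D by (intro cdot_hermitian) (simp add: dirac_matrices_def)
  ultimately have "cdot u (\<sigma> *\<^sub>R (\<alpha> k *v u)) = - cdot (\<sigma> *\<^sub>R u) (\<alpha> k *v u)"
    unfolding u matrix_vector_scaleR by (metis cdot_uminus_right minus_minus)
  then have "of_real \<sigma> * cdot u (\<alpha> k *v u) = 0"
    unfolding cdot_scaleR_left cdot_scaleR_right by simp
  then show ?thesis using \<sigma> by simp
qed

section \<open>Sharpness of the support\<close>

text \<open>At isn the mass shell is m^2 - s^2 < 0, so the cosine becomes a cosh and each sine
  quotient some sinh y / y. The V-term is purely imaginary and cannot cancel the real part. The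
  exponent 12 counts four powers in each of three coordinates.\<close>

lemma amp_imaginary_lower_bound:
  assumes n: "norm n = 1" and s: "s > m" and m: "m > 0" and U: "U \<ge> 0"
  shows "U * (exp (\<bar>t\<bar> * (s - m)) / 2 * (exp (4 * s * norm1 n) / (2 * (1 + s)) ^ 12))
    \<le> norm (amp m t (of_real U) (of_real V) (\<lambda>k. 0) (cshift 0 (\<i> * of_real s) n))"
proof -
  define \<kappa> where "\<kappa> = sqrt (s\<^sup>2 - m\<^sup>2)"
  define S where "S = (if t * \<kappa> = 0 then 1 else sinh (t * \<kappa>) / (t * \<kappa>))"
  have ms: "m\<^sup>2 \<le> s\<^sup>2" using s m by (intro power_mono) auto
  have k2: "\<kappa>\<^sup>2 = s\<^sup>2 - m\<^sup>2" using ms by (simp add: \<kappa>_def)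
  have nn: "(\<Sum>k\<in>UNIV. (n $ k)\<^sup>2) = 1"
    using n by (simp add: norm_vec_def L2_set_def)
  have z2: "(cshift 0 (\<i> * of_real s) n $ k)\<^sup>2 = of_real (- ((s * \<bar>n $ k\<bar>)\<^sup>2))" for k
    by (simp add: power_mult_distrib)
  have "mass_shell m (cshift 0 (\<i> * of_real s) n) = of_real (- (s\<^sup>2 * (\<Sum>k\<in>UNIV. (n $ k)\<^sup>2)) + m\<^sup>2)"
    unfolding mass_shell_def z2 by (simp add: power_mult_distrib sum_negf sum_distrib_left)
  then have "of_real (t\<^sup>2) * mass_shell m (cshift 0 (\<i> * of_real s) n) = of_real (t\<^sup>2 * (- \<kappa>\<^sup>2))"
    unfolding nn k2 by (simp only: of_real_mult) simp
  then have w: "of_real (t\<^sup>2) * mass_shell m (cshift 0 (\<i> * of_real s) n) = of_real (- ((t * \<kappa>)\<^sup>2))"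
    by (simp add: power_mult_distrib)
  have c: "cos_sqrt (of_real (t\<^sup>2) * mass_shell m (cshift 0 (\<i> * of_real s) n)) = of_real (cosh (t * \<kappa>))"
    unfolding w by (rule cos_sqrt_neg_square)
  have sc: "sinc_sqrt (of_real (t\<^sup>2) * mass_shell m (cshift 0 (\<i> * of_real s) n)) = of_real S"
    unfolding w S_def by (rule sinc_sqrt_neg_square)
  let ?q = "\<lambda>k. if s * \<bar>n $ k\<bar> = 0 then 1 else sinh (s * \<bar>n $ k\<bar>) / (s * \<bar>n $ k\<bar>)"
  have q: "sinc_sqrt ((cshift 0 (\<i> * of_real s) n $ k)\<^sup>2) = of_real (?q k)" for k
    unfolding z2 by (rule sinc_sqrt_neg_square)
  have "amp m t (of_real U) (of_real V) (\<lambda>k. 0) (cshift 0 (\<i> * of_real s) n)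
    = (of_real (cosh (t * \<kappa>)) * of_real U + \<i> * of_real t * of_real S * of_real V) * (\<Prod>k\<in>UNIV. of_real (?q k) ^ 4)"
    unfolding amp_def c sc q by simp
  also have "\<dots> = Complex (cosh (t * \<kappa>) * U) (t * S * V) * of_real (\<Prod>k\<in>UNIV. (?q k) ^ 4)"
    by (simp add: Complex_eq)
  finally have na: "norm (amp m t (of_real U) (of_real V) (\<lambda>k. 0) (cshift 0 (\<i> * of_real s) n))
    = norm (Complex (cosh (t * \<kappa>) * U) (t * S * V)) * \<bar>\<Prod>k\<in>UNIV. (?q k) ^ 4\<bar>"
    by (simp only: norm_mult norm_of_real)
  have s0: "s > 0" using s m by simp
  have f1: "U * (exp (\<bar>t\<bar> * (s - m)) / 2) \<le> norm (Complex (cosh (t * \<kappa>) * U) (t * S * V))"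
  proof -
    \<comment> \<open>Comparing \<kappa> with s - m replaces the square root by a linear exponent
      and loses only the constant factor e^(-|t| m).\<close>
    have "(s - m)\<^sup>2 \<le> s\<^sup>2 - m\<^sup>2" using s m by (simp add: power2_eq_square algebra_simps)
    then have "s - m \<le> \<kappa>" unfolding \<kappa>_def using real_le_rsqrt by blast
    then have "exp (\<bar>t\<bar> * (s - m)) \<le> exp (\<bar>t\<bar> * \<kappa>)" by (simp add: mult_left_mono)
    also have "\<dots> = exp \<bar>t * \<kappa>\<bar>" using ms by (simp add: abs_mult \<kappa>_def)
    also have "\<dots> \<le> 2 * cosh (t * \<kappa>)" by (simp add: cosh_def abs_if)
    finally have "U * (exp (\<bar>t\<bar> * (s - m)) / 2) \<le> U * cosh (t * \<kappa>)" using U by (intro mult_left_mono) auto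
    also have "\<dots> \<le> \<bar>Re (Complex (cosh (t * \<kappa>) * U) (t * S * V))\<bar>" by (simp add: mult.commute)
    also have "\<dots> \<le> norm (Complex (cosh (t * \<kappa>) * U) (t * S * V))" by (rule abs_Re_le_cmod)
    finally show ?thesis .
  qed
  have f2: "exp (4 * s * norm1 n) / (2 * (1 + s)) ^ 12 \<le> \<bar>\<Prod>k\<in>UNIV. (?q k) ^ 4\<bar>"
  proof -
    have "exp (4 * s * norm1 n) / (2 * (1 + s)) ^ 12 = (\<Prod>k\<in>(UNIV::3 set). (exp (s * \<bar>n $ k\<bar>) / (2 * (1 + s))) ^ 4)"
    proof -
      have "(\<Prod>k\<in>(UNIV::3 set). (exp (s * \<bar>n $ k\<bar>) / (2 * (1 + s))) ^ 4) = (\<Prod>k\<in>UNIV. exp (s * \<bar>n $ k\<bar>)) ^ 4 / ((2 * (1 + s)) ^ 3) ^ 4"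
        by (simp add: prod_power_distrib[symmetric] prod_dividef power_divide)
      also have "(\<Prod>k\<in>UNIV. exp (s * \<bar>n $ k\<bar>)) ^ 4 = exp (4 * s * norm1 n)"
        by (simp add: exp_sum[symmetric] norm1_def sum_distrib_left exp_of_nat_mult[symmetric] mult.assoc)
      finally show ?thesis by (simp flip: power_mult)
    qed
    also have "\<dots> \<le> (\<Prod>k\<in>UNIV. (?q k) ^ 4)"
    proof (intro prod_mono conjI power_mono)
      fix k
      \<comment> \<open>Enlarging the denominator from 1 + s |n_k| to 1 + s makes the polynomial
        loss independent of the direction.\<close>
      have "s * \<bar>n $ k\<bar> \<le> s" using norm_nth_unit_le[OF n, of k] s0 by (simp add: mult_left_le)
      then have "exp (s * \<bar>n $ k\<bar>) / (2 * (1 + s)) \<le> exp (s * \<bar>n $ k\<bar>) / (2 * (1 + s * \<bar>n $ k\<bar>))"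
        using s0 by (intro divide_left_mono) (auto intro!: mult_pos_pos add_pos_nonneg)
      also have "\<dots> \<le> ?q k" using s0 by (intro sinhc_lower_bound) simp
      finally show "exp (s * \<bar>n $ k\<bar>) / (2 * (1 + s)) \<le> ?q k" .
    qed (use s0 in auto)
    finally show ?thesis by linarith
  qed
  show ?thesis unfolding na mult.assoc[symmetric]
    using mult_mono[OF f1 f2] s0 by simp
qed

text \<open>The velocity terms have expectation 0 in u, and \<beta> u is a real multiple of u. What
  remains has d = 0 and real a and b, as the lower bound demands.\<close>

lemma sum_cnj_spinor_amp:
  assumes D: "dirac_matrices \<alpha> \<beta>" and u: "\<beta> *v u = \<sigma> *\<^sub>R u" and \<sigma>: "\<sigma> \<noteq> 0"
  shows "cdot u (spinor_amp m \<alpha> \<beta> u t \<zeta>) = amp m t (of_real ((norm u)\<^sup>2)) (of_real (m * \<sigma> * (norm u)\<^sup>2)) (\<lambda>k. 0) \<zeta>"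
proof -
  let ?c = "cos_sqrt (of_real (t\<^sup>2) * mass_shell m \<zeta>)" and ?s = "\<i> * of_real t * sinc_sqrt (of_real (t\<^sup>2) * mass_shell m \<zeta>)"
  let ?Q = "\<Prod>k\<in>UNIV. sinc_sqrt ((\<zeta> $ k)\<^sup>2) ^ 4"
  have "cdot u (spinor_amp m \<alpha> \<beta> u t \<zeta>) = (\<Sum>i\<in>UNIV. cnj (u $ i) * ((?c * u $ i + ?s * ((\<Sum>k\<in>UNIV. \<zeta> $ k * (\<alpha> k *v u) $ i) + of_real m * (\<beta> *v u) $ i)) * ?Q))"
    by (simp add: cdot_def spinor_amp_def amp_def)
  also have "\<dots> = (?c * cdot u u + ?s * ((\<Sum>i\<in>UNIV. \<Sum>k\<in>UNIV. cnj (u $ i) * (\<zeta> $ k * (\<alpha> k *v u) $ i)) + of_real m * cdot u (\<beta> *v u))) * ?Q"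
    by (simp add: cdot_def sum_distrib_left sum_distrib_right sum.distrib distrib_left distrib_right mult_ac)
  also have "(\<Sum>i\<in>UNIV. \<Sum>k\<in>UNIV. cnj (u $ i) * (\<zeta> $ k * (\<alpha> k *v u) $ i)) = (\<Sum>k\<in>UNIV. \<zeta> $ k * cdot u (\<alpha> k *v u))"
    by (subst sum.swap) (simp add: cdot_def sum_distrib_left mult_ac)
  also have "\<dots> = 0" by (simp add: cdot_alpha_eq_0[OF D u \<sigma>])
  also have "cdot u (\<beta> *v u) = of_real (\<sigma> * (norm u)\<^sup>2)"
    unfolding u cdot_scaleR_right cdot_self by simp
  finally show ?thesis by (simp add: amp_def cdot_self mult.assoc)
qed

lemma poly_exp_tendsto_0:
  assumes "\<delta> > (0::real)"
  shows "((\<lambda>s. (2 * (1 + s)) ^ 12 * exp (- (\<delta> * s))) \<longlongrightarrow> 0) at_top"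
  using assms by real_asymp

text \<open>Vanishing beyond c allows the pairing with u to grow at most like e^(sc) along isn,
  whereas the lower bound gives e^(s(|t| + r)) up to powers of s. For c < |t| + r these are
  incompatible as s tends to infinity.\<close>

theorem spinor_wave_edge_sharp:
  assumes m: "m > 0" and D: "dirac_matrices \<alpha> \<beta>" and u: "\<beta> *v u = \<sigma> *\<^sub>R u" "\<sigma> \<noteq> 0" "u \<noteq> 0"
    and n: "norm n = 1" and c: "c < \<bar>t\<bar> + 4 * norm1 n"
  shows "\<not> (AE x in lborel. x \<bullet> n > c \<longrightarrow> spinor_wave m \<alpha> \<beta> u t x = 0)"
proof
  assume ae: "AE x in lborel. x \<bullet> n > c \<longrightarrow> spinor_wave m \<alpha> \<beta> u t x = 0"
  let ?w = "\<lambda>i. wave m t (u $ i) (of_real m * (\<beta> *v u) $ i) (\<lambda>k. (\<alpha> k *v u) $ i)"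
  define A where "A i = fourier_const TYPE(real^3) * (\<integral>x. norm (?w i x) \<partial>lborel)" for i
  define C where "C = (\<Sum>i\<in>UNIV. norm (u $ i) * A i)"
  define \<delta> where "\<delta> = \<bar>t\<bar> + 4 * norm1 n - c"
  have \<delta>: "\<delta> > 0" using c by (simp add: \<delta>_def)
  have aei: "AE x in lborel. x \<bullet> n > c \<longrightarrow> ?w i x = 0" for i
    using ae by eventually_elim (auto simp: spinor_wave_def vec_eq_iff)
  have up: "norm (cdot u (spinor_amp m \<alpha> \<beta> u t (cshift 0 (\<i> * of_real s) n))) \<le> C * exp (s * c)" if s: "s \<ge> 0" for s
  proof -
    have "norm (cdot u (spinor_amp m \<alpha> \<beta> u t (cshift 0 (\<i> * of_real s) n))) \<le> (\<Sum>i\<in>UNIV. norm (u $ i) * (A i * exp (s * c)))"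
      unfolding cdot_def
    proof (rule order_trans[OF norm_sum sum_mono])
      fix i
      show "norm (cnj (u $ i) * spinor_amp m \<alpha> \<beta> u t (cshift 0 (\<i> * of_real s) n) $ i) \<le> norm (u $ i) * (A i * exp (s * c))"
        using norm_amp_imaginary_le[OF n aei s] unfolding norm_mult A_def
        by (intro mult_mono) (simp_all add: spinor_amp_def)
    qed
    then show ?thesis by (simp add: C_def sum_distrib_right mult.assoc)
  qed
  let ?U = "(norm u)\<^sup>2"
  have U: "?U > 0" using u by simp
  have key: "?U * exp (- (\<bar>t\<bar> * m)) / 2 \<le> C * ((2 * (1 + s)) ^ 12 * exp (- (\<delta> * s)))" if s: "s > m" for s
  proof -
    have "?U * (exp (\<bar>t\<bar> * (s - m)) / 2 * (exp (4 * s * norm1 n) / (2 * (1 + s)) ^ 12)) \<le> C * exp (s * c)"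
      using amp_imaginary_lower_bound[OF n s m less_imp_le[OF U], of t "m * \<sigma> * ?U"] up[of s] s m
      unfolding sum_cnj_spinor_amp[OF D u(1,2)] by linarith
    then have "?U / 2 * (exp (\<bar>t\<bar> * (s - m)) * exp (4 * s * norm1 n)) \<le> C * exp (s * c) * (2 * (1 + s)) ^ 12"
      using s m by (simp add: pos_divide_le_eq)
    \<comment> \<open>Multiplying by e^(-s(|t| + r)) leaves a positive constant on the left and a
      function decaying like a polynomial times e^(-\<delta> s) on the right.\<close>
    then have "?U / 2 * (exp (\<bar>t\<bar> * (s - m)) * exp (4 * s * norm1 n)) * exp (- (s * (\<bar>t\<bar> + 4 * norm1 n))) \<le> C * exp (s * c) * (2 * (1 + s)) ^ 12 * exp (- (s * (\<bar>t\<bar> + 4 * norm1 n)))"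
      by (intro mult_right_mono) auto
    moreover have "exp (\<bar>t\<bar> * (s - m)) * exp (4 * s * norm1 n) * exp (- (s * (\<bar>t\<bar> + 4 * norm1 n))) = exp (- (\<bar>t\<bar> * m))"
      by (simp add: exp_add[symmetric] algebra_simps)
    moreover have "exp (s * c) * exp (- (s * (\<bar>t\<bar> + 4 * norm1 n))) = exp (- (\<delta> * s))"
      by (simp add: exp_add[symmetric] \<delta>_def algebra_simps)
    moreover have "x * y * z = x * (y * z)" "C * x * y * z = C * (y * (x * z))" for x y z :: real by simp_all
    ultimately show ?thesis by (metis (no_types, lifting) times_divide_eq_left)
  qed
  have "((\<lambda>s. C * ((2 * (1 + s)) ^ 12 * exp (- (\<delta> * s)))) \<longlongrightarrow> C * 0) at_top"
    by (intro tendsto_mult tendsto_const poly_exp_tendsto_0 \<delta>)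
  then have "?U * exp (- (\<bar>t\<bar> * m)) / 2 \<le> C * 0"
    by (rule tendsto_lowerbound) (use key in \<open>auto intro!: eventually_mono[OF eventually_gt_at_top[of m]]\<close>)
  then show False using U by (simp add: zero_less_mult_iff mult_le_0_iff)
qed

section \<open>Superposition of two waves\<close>

lemma norm1_uminus: "norm1 (- n) = norm1 n"
  by (simp add: norm1_def)

lemma spinor_wave_eq_0:
  assumes "norm n = 1" and "x \<bullet> n > \<bar>t\<bar> + 4 * norm1 n"
  shows "spinor_wave m \<alpha> \<beta> u t x = 0"
  by (simp add: vec_eq_iff spinor_wave_def wave_eq_0[OF assms])

lemma spinor_wave_bounded_support:
  assumes "norm x > 3 * (\<bar>t\<bar> + 4)"
  shows "spinor_wave m \<alpha> \<beta> u t x = 0"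
  by (simp add: vec_eq_iff spinor_wave_def wave_bounded_support[OF assms])

lemma borel_measurable_spinor_wave [measurable]: "spinor_wave m \<alpha> \<beta> u t \<in> borel_measurable borel"
  by (rule borel_measurable_vecI) (simp add: spinor_wave_def)

lemma norm_spinor_wave_bounded: "\<exists>B. \<forall>x. norm (spinor_wave m \<alpha> \<beta> u t x) \<le> B"
proof -
  let ?a = "\<lambda>i. amp m t (u $ i) (of_real m * (\<beta> *v u) $ i) (\<lambda>k. (\<alpha> k *v u) $ i)"
  let ?B = "\<Sum>i\<in>UNIV. fourier_const TYPE(real^3) * (\<integral>p. norm (?a i (cshift p 0 0)) \<partial>lborel)"
  have "norm (spinor_wave m \<alpha> \<beta> u t x) \<le> (\<Sum>i\<in>UNIV. norm (spinor_wave m \<alpha> \<beta> u t x $ i))" for x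
    unfolding norm_vec_def by (rule L2_set_le_sum) simp
  also have "(\<Sum>i\<in>UNIV. norm (spinor_wave m \<alpha> \<beta> u t x $ i)) \<le> ?B" for x
    by (intro sum_mono) (simp add: spinor_wave_def norm_wave_le)
  finally show ?thesis by blast
qed

lemma integrable_spinor_wave: "integrable lborel (spinor_wave m \<alpha> \<beta> u t)"
  using norm_spinor_wave_bounded integrable_bounded_support[OF borel_measurable_spinor_wave _ spinor_wave_bounded_support] by metis

section \<open>Spinor waves as wavefunctions, and translations\<close>

lemma dirac_wavefunction_bounded_support:
  assumes "f \<in> borel_measurable borel" and B: "\<And>x. norm (f x) \<le> B" and r: "\<And>x. norm x > r \<Longrightarrow> f x = 0"
  shows "dirac_wavefunction f"
  unfolding dirac_wavefunction_def
proof
  show "integrable lborel (\<lambda>x. (norm (f x))\<^sup>2)"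
  proof (rule integrable_bounded_support)
    show "norm ((norm (f x))\<^sup>2) \<le> B\<^sup>2" for x using power_mono[OF B[of x], of 2] by simp
    show "(norm (f x))\<^sup>2 = 0" if "norm x > r" for x using r[OF that] by simp
  qed (use assms(1) in measurable)
qed (use assms(1) in simp)

lemma fourier_integral_spinor_wave: "fourier_integral (spinor_wave m \<alpha> \<beta> u t) p = spinor_amp m \<alpha> \<beta> u t (cshift p 0 0)"
  by (simp add: vec_eq_iff fourier_integral_nth[OF integrable_spinor_wave]) (simp add: spinor_wave_def spinor_amp_def ft_wave)

lemma fourier_integral_shift:
  assumes "integrable lborel f"
  shows "fourier_integral (\<lambda>x. f (x - c)) p = cis (- (p \<bullet> c)) *s fourier_integral f p"
proof -
  have "integrable lborel (\<lambda>x. f (x - c))"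
    using lborel_integrable_affine_iff[of 1 f "- c"] assms by simp
  from fourier_integral_nth[OF this] fourier_integral_nth[OF assms] show ?thesis
    by (simp add: vec_eq_iff ft_shift[where f = "\<lambda>x. f x $ i" for i])
qed

lemma AE_lborel_shift:
  fixes c :: "'a::euclidean_space"
  assumes "AE x in lborel. P x"
  shows "AE x in lborel. P (c + x)"
proof -
  have "AE x in distr lborel borel ((+) c). P x" unfolding lborel_distr_plus by (rule assms)
  then show ?thesis by (rule AE_distrD[rotated]) simp
qed

text \<open>\<open>edge\<close> is defined by closed half-spaces, the hypotheses by open ones; the
  hyperplane between them is a null set. A larger extended real is refuted through a real number c
  strictly in between.\<close>

lemma edge_eqI:
  assumes e: "e \<noteq> 0" and z: "\<And>x. x \<bullet> e < a \<Longrightarrow> \<psi> x = 0"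
    and sharp: "\<And>c. c > a \<Longrightarrow> \<not> (AE x in lborel. x \<bullet> e < c \<longrightarrow> \<psi> x = 0)"
    and eq: "eq_ae \<phi> \<psi>"
  shows "edge e \<phi> = ereal a"
  unfolding edge_def
proof (rule Greatest_equality)
  have "negligible {x. e \<bullet> x = a}" using e by (intro negligible_hyperplane) simp
  then have "AE x in lebesgue. x \<notin> {x. e \<bullet> x = a}"
    by (simp only: negligible_iff_null_sets AE_not_in)
  then have "AE x in lborel. e \<bullet> x \<noteq> a"
    by (simp add: AE_completion_iff)
  then show "eq_ae (cutoff {x. ereal (x \<bullet> e) \<le> ereal a} \<phi>) (\<lambda>_. 0)"
    using eq unfolding eq_ae_def
  proof eventually_elim
    case (elim x)
    then show ?case using z[of x] by (auto simp: cutoff_def indicator_def inner_commute)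
  qed
next
  fix y assume y: "eq_ae (cutoff {x. ereal (x \<bullet> e) \<le> y} \<phi>) (\<lambda>_. 0)"
  show "y \<le> ereal a"
  proof (rule ccontr)
    assume "\<not> y \<le> ereal a"
    then obtain c where c: "ereal a < ereal c" "ereal c < y" by (metis ereal_dense2 not_le)
    have "AE x in lborel. x \<bullet> e < c \<longrightarrow> \<psi> x = 0"
      using y eq unfolding eq_ae_def
    proof eventually_elim
      case (elim x)
      show ?case
      proof
        assume "x \<bullet> e < c"
        then have "ereal (x \<bullet> e) \<le> y" using c(2) by (meson ereal_less_eq(3) less_imp_le order_trans)
        then show "\<psi> x = 0" using elim by (simp add: cutoff_def)
      qed
    qed
    then show False using sharp[of c] c(1) by simp
  qed
qed

text \<open>Two copies centred at -a and a, with internal times s1 and s2. Evolution by t adds t to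
  both, so internal time -t1 lets a copy reach its narrowest state at time t1.\<close>

definition two_waves ::
  "real \<Rightarrow> (3 \<Rightarrow> complex^4^4) \<Rightarrow> complex^4^4 \<Rightarrow> complex^4 \<Rightarrow> real^3 \<Rightarrow> real \<Rightarrow> real \<Rightarrow> real^3 \<Rightarrow> complex^4" where
  "two_waves m \<alpha> \<beta> u a s1 s2 x = spinor_wave m \<alpha> \<beta> u s1 (x + a) + spinor_wave m \<alpha> \<beta> u s2 (x - a)"

text \<open>The condition on L puts the left edge of the copy at -Ln strictly to the left of the
  other one's, so near that edge the first copy stands alone.\<close>

lemma edge_two_waves:
  assumes n: "norm n = 1" and L: "\<bar>\<bar>s1\<bar> - \<bar>s2\<bar>\<bar> < 2 * L"
    and m: "m > 0" and D: "dirac_matrices \<alpha> \<beta>" and u: "\<beta> *v u = \<sigma> *\<^sub>R u" "\<sigma> \<noteq> 0" "u \<noteq> 0"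
    and eq: "eq_ae \<phi> (two_waves m \<alpha> \<beta> u (L *\<^sub>R n) s1 s2)"
  shows "edge n \<phi> = ereal (- L - 4 * norm1 n - \<bar>s1\<bar>)"
proof (rule edge_eqI[OF _ _ _ eq[unfolded two_waves_def[abs_def]]])
  let ?W = "spinor_wave m \<alpha> \<beta> u"
  have n': "norm (- n) = 1" using n by simp
  have nn: "n \<bullet> n = 1" using n by (simp add: norm_eq_1)
  show "n \<noteq> 0" using n by auto
  have z1: "?W s1 (x + L *\<^sub>R n) = 0" if "x \<bullet> n < - L - 4 * norm1 n - \<bar>s1\<bar>" for x
    using that by (intro spinor_wave_eq_0[OF n']) (simp add: norm1_uminus inner_add_left nn)
  have z2: "?W s2 (x - L *\<^sub>R n) = 0" if "x \<bullet> n < L - 4 * norm1 n - \<bar>s2\<bar>" for x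
    using that by (intro spinor_wave_eq_0[OF n']) (simp add: norm1_uminus inner_diff_left nn)
  show "?W s1 (x + L *\<^sub>R n) + ?W s2 (x - L *\<^sub>R n) = 0" if "x \<bullet> n < - L - 4 * norm1 n - \<bar>s1\<bar>" for x
    using z1 z2 that L by simp
  fix c assume c: "c > - L - 4 * norm1 n - \<bar>s1\<bar>"
  show "\<not> (AE x in lborel. x \<bullet> n < c \<longrightarrow> ?W s1 (x + L *\<^sub>R n) + ?W s2 (x - L *\<^sub>R n) = 0)"
  proof
    assume ae: "AE x in lborel. x \<bullet> n < c \<longrightarrow> ?W s1 (x + L *\<^sub>R n) + ?W s2 (x - L *\<^sub>R n) = 0"
    \<comment> \<open>Below c' the second copy vanishes, so the assumption concerns the first copy
      only; by the condition on L there is still room between its edge and c'.\<close>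
    define c' where "c' = min c (L - 4 * norm1 n - \<bar>s2\<bar>)"
    have c': "c' > - L - 4 * norm1 n - \<bar>s1\<bar>" using c L by (auto simp: c'_def)
    have "AE x in lborel. x \<bullet> n < c' \<longrightarrow> ?W s1 (x + L *\<^sub>R n) = 0"
      using ae
    proof eventually_elim
      case (elim x)
      then show ?case using z2[of x] by (auto simp: c'_def)
    qed
    from AE_lborel_shift[OF this, of "- (L *\<^sub>R n)"]
    have "AE x in lborel. x \<bullet> (- n) > - (c' + L) \<longrightarrow> ?W s1 x = 0"
      by eventually_elim (simp add: inner_add_left inner_diff_left nn)
    moreover have "- (c' + L) < \<bar>s1\<bar> + 4 * norm1 (- n)" using c' by (simp add: norm1_uminus)
    ultimately show False using spinor_wave_edge_sharp[OF m D u n'] by blast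
  qed
qed

text \<open>Seen from -e the other copy is the left one, so a single lemma about left edges serves
  both directions.\<close>

lemma two_waves_swap: "two_waves m \<alpha> \<beta> u a s1 s2 = two_waves m \<alpha> \<beta> u (- a) s2 s1"
  by (simp add: two_waves_def fun_eq_iff add.commute)

lemma two_waves_bounded_support:
  assumes "norm x > 3 * (\<bar>s1\<bar> + 4) + 3 * (\<bar>s2\<bar> + 4) + norm a"
  shows "two_waves m \<alpha> \<beta> u a s1 s2 x = 0"
proof -
  have "norm x \<le> norm (x + a) + norm a" "norm x \<le> norm (x - a) + norm a"
    using norm_triangle_ineq4[of "x + a" a] norm_triangle_ineq[of "x - a" a] by simp_all
  then show ?thesis using assms by (simp add: two_waves_def spinor_wave_bounded_support)
qed

lemma dirac_wavefunction_two_waves: "dirac_wavefunction (two_waves m \<alpha> \<beta> u a s1 s2)"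
proof -
  obtain B1 B2 where B: "\<And>x. norm (spinor_wave m \<alpha> \<beta> u s1 x) \<le> B1" "\<And>x. norm (spinor_wave m \<alpha> \<beta> u s2 x) \<le> B2"
    using norm_spinor_wave_bounded by metis
  have meas: "(\<lambda>x. spinor_wave m \<alpha> \<beta> u s (x + b)) \<in> borel_measurable borel" for s b
    by (rule measurable_compose[OF _ borel_measurable_spinor_wave]) simp
  show ?thesis
  proof (rule dirac_wavefunction_bounded_support[OF _ _ two_waves_bounded_support])
    show "two_waves m \<alpha> \<beta> u a s1 s2 \<in> borel_measurable borel"
      unfolding two_waves_def[abs_def] using meas[of s1 a] meas[of s2 "- a"] by simp
    show "norm (two_waves m \<alpha> \<beta> u a s1 s2 x) \<le> B1 + B2" for x
      unfolding two_waves_def by (rule norm_triangle_mono[OF B])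
  qed
qed

lemma fourier_integral_two_waves:
  "fourier_integral (two_waves m \<alpha> \<beta> u a s1 s2) p
    = cis (p \<bullet> a) *s spinor_amp m \<alpha> \<beta> u s1 (cshift p 0 0) + cis (- (p \<bullet> a)) *s spinor_amp m \<alpha> \<beta> u s2 (cshift p 0 0)"
proof -
  have i: "integrable lborel (\<lambda>x. spinor_wave m \<alpha> \<beta> u s (x - c))" for s c
    using lborel_integrable_affine_iff[of 1 "spinor_wave m \<alpha> \<beta> u s" "- c"] integrable_spinor_wave by simp
  have "two_waves m \<alpha> \<beta> u a s1 s2 = (\<lambda>x. spinor_wave m \<alpha> \<beta> u s1 (x - (- a)) + spinor_wave m \<alpha> \<beta> u s2 (x - a))"
    by (simp add: two_waves_def fun_eq_iff)
  then have "fourier_integral (two_waves m \<alpha> \<beta> u a s1 s2) p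
    = fourier_integral (\<lambda>x. spinor_wave m \<alpha> \<beta> u s1 (x - (- a))) p + fourier_integral (\<lambda>x. spinor_wave m \<alpha> \<beta> u s2 (x - a)) p"
    by (simp only: fourier_integral_add[OF i i])
  then show ?thesis
    by (simp only: fourier_integral_shift[OF integrable_spinor_wave] fourier_integral_spinor_wave inner_minus_right minus_minus)
qed

lemma fourier_two_waves: "eq_ae (fourier (two_waves m \<alpha> \<beta> u a s1 s2)) (fourier_integral (two_waves m \<alpha> \<beta> u a s1 s2))"
proof (rule fourier_eq_fourier_integral[OF dirac_wavefunction_two_waves])
  let ?r = "3 * (\<bar>s1\<bar> + 4) + 3 * (\<bar>s2\<bar> + 4) + norm a"
  show "two_waves m \<alpha> \<beta> u a s1 s2 x = 0" if "norm x \<ge> ?r + 1" for x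
    using that by (intro two_waves_bounded_support) linarith
qed

text \<open>Translations are scalar phases in momentum space and commute with the propagator, whose
  group law adds t to both internal times. Uniqueness of the inverse transform carries this from the
  explicit transforms to the evolution.\<close>

theorem dirac_evolution_two_waves:
  assumes m: "m > 0" and D: "dirac_matrices \<alpha> \<beta>"
  shows "eq_ae (dirac_evolution m \<alpha> \<beta> t (two_waves m \<alpha> \<beta> u a s1 s2)) (two_waves m \<alpha> \<beta> u a (t + s1) (t + s2))"
  unfolding dirac_evolution_def
proof (rule inv_fourier_eqI(2)[OF dirac_wavefunction_two_waves])
  have propagate: "dirac_propagator m \<alpha> \<beta> t p (fourier_integral (two_waves m \<alpha> \<beta> u a s1 s2) p) = fourier_integral (two_waves m \<alpha> \<beta> u a (t + s1) (t + s2)) p" for p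
    by (simp add: fourier_integral_two_waves dirac_propagator_plus dirac_propagator_smult dirac_propagator_spinor_amp[OF m D])
  from fourier_two_waves[of m \<alpha> \<beta> u a "t + s1" "t + s2"] fourier_two_waves[of m \<alpha> \<beta> u a s1 s2]
  show "eq_ae (fourier (two_waves m \<alpha> \<beta> u a (t + s1) (t + s2)))
      (\<lambda>p. matrix_exp (matrix_scale (\<i> * of_real t) (dirac_symbol m \<alpha> \<beta> p)) *v fourier (two_waves m \<alpha> \<beta> u a s1 s2) p)"
    unfolding eq_ae_def matrix_exp_dirac[OF m D] by eventually_elim (simp add: propagate)
qed

lemma edge_time_eqI:
  assumes "\<And>t. edge e (dirac_evolution m \<alpha> \<beta> t \<psi>) = ereal (a - \<bar>t - t\<^sub>0\<bar>)" and "edge e \<psi> = ereal (a - \<bar>t\<^sub>0\<bar>)"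
  shows "edge_time m \<alpha> \<beta> e \<psi> = t\<^sub>0"
  unfolding edge_time_def
proof (rule the_equality)
  show "\<forall>t. edge e (dirac_evolution m \<alpha> \<beta> t \<psi>) = edge e \<psi> + ereal \<bar>t\<^sub>0\<bar> - ereal \<bar>t - t\<^sub>0\<bar>"
    by (simp add: assms)
  fix s assume "\<forall>t. edge e (dirac_evolution m \<alpha> \<beta> t \<psi>) = edge e \<psi> + ereal \<bar>s\<bar> - ereal \<bar>t - s\<bar>"
  then have "a - \<bar>t - t\<^sub>0\<bar> = a - \<bar>t\<^sub>0\<bar> + \<bar>s\<bar> - \<bar>t - s\<bar>" for t by (simp add: assms)
  \<comment> \<open>Subtracting the equations at t = s and at t = \<open>t\<^sub>0\<close> leaves 2
    |s - \<open>t\<^sub>0\<close>| = 0.\<close>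
  from this[of s] this[of t\<^sub>0] show "s = t\<^sub>0" by simp
qed

text \<open>By the reverse triangle inequality ||t - t1| - |t - t2|| <= |t1 - t2| < 2L for every t,
  so the same copy governs the left edge at all times.\<close>

lemma edge_time_two_waves:
  assumes n: "norm n = 1" and L: "\<bar>t\<^sub>1 - t\<^sub>2\<bar> < 2 * L"
    and m: "m > 0" and D: "dirac_matrices \<alpha> \<beta>" and u: "\<beta> *v u = \<sigma> *\<^sub>R u" "\<sigma> \<noteq> 0" "u \<noteq> 0"
  shows "edge_time m \<alpha> \<beta> n (two_waves m \<alpha> \<beta> u (L *\<^sub>R n) (- t\<^sub>1) (- t\<^sub>2)) = t\<^sub>1"
proof (rule edge_time_eqI[where a = "- L - 4 * norm1 n"])
  fix t
  have "\<bar>\<bar>t + - t\<^sub>1\<bar> - \<bar>t + - t\<^sub>2\<bar>\<bar> < 2 * L" using L by linarith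
  from edge_two_waves[OF n this m D u dirac_evolution_two_waves[OF m D]]
  show "edge n (dirac_evolution m \<alpha> \<beta> t (two_waves m \<alpha> \<beta> u (L *\<^sub>R n) (- t\<^sub>1) (- t\<^sub>2))) = ereal (- L - 4 * norm1 n - \<bar>t - t\<^sub>1\<bar>)"
    by simp
next
  have "\<bar>\<bar>- t\<^sub>1\<bar> - \<bar>- t\<^sub>2\<bar>\<bar> < 2 * L" using L by linarith
  from edge_two_waves[OF n this m D u, of "two_waves m \<alpha> \<beta> u (L *\<^sub>R n) (- t\<^sub>1) (- t\<^sub>2)"]
  show "edge n (two_waves m \<alpha> \<beta> u (L *\<^sub>R n) (- t\<^sub>1) (- t\<^sub>2)) = ereal (- L - 4 * norm1 n - \<bar>t\<^sub>1\<bar>)"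
    by (simp add: eq_ae_def)
qed

theorem mainTheorem7:
  fixes m :: real and \<alpha> :: "3 \<Rightarrow> complex^4^4" and \<beta> :: "complex^4^4"
    and e :: "real^3" and t\<^sub>1 t\<^sub>2 :: real
  assumes "m > 0"
    and "dirac_matrices \<alpha> \<beta>"
    and "norm e = 1"
  shows "\<exists>\<psi>. dirac_wavefunction \<psi> \<and> \<not> eq_ae \<psi> (\<lambda>_. 0) \<and>
             (\<exists>\<Delta>. bounded \<Delta> \<and> localized_in \<psi> \<Delta>) \<and>
             edge_time m \<alpha> \<beta> e \<psi> = t\<^sub>1 \<and>
             edge_time m \<alpha> \<beta> (- e) \<psi> = t\<^sub>2"
proof -
  obtain u \<sigma> where u: "u \<noteq> 0" "\<beta> *v u = \<sigma> *\<^sub>R u" and \<sigma>: "\<sigma> = 1 \<or> \<sigma> = (-1::real)"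
    by (rule exists_beta_eigenvector[OF assms(2)])
  have \<sigma>0: "\<sigma> \<noteq> 0" using \<sigma> by auto
  \<comment> \<open>Half of the time difference is the threshold; the added 1 makes the inequality
    strict.\<close>
  define L where "L = \<bar>t\<^sub>1 - t\<^sub>2\<bar> / 2 + 1"
  have L: "\<bar>t\<^sub>1 - t\<^sub>2\<bar> < 2 * L" "\<bar>t\<^sub>2 - t\<^sub>1\<bar> < 2 * L" by (simp_all add: L_def field_simps abs_minus_commute)
  define \<psi> where "\<psi> = two_waves m \<alpha> \<beta> u (L *\<^sub>R e) (- t\<^sub>1) (- t\<^sub>2)"
  have swap: "\<psi> = two_waves m \<alpha> \<beta> u (L *\<^sub>R (- e)) (- t\<^sub>2) (- t\<^sub>1)"
    unfolding \<psi>_def by (subst two_waves_swap) simp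
  have "dirac_wavefunction \<psi>" unfolding \<psi>_def by (rule dirac_wavefunction_two_waves)
  moreover have "\<not> eq_ae \<psi> (\<lambda>_. 0)"
  proof
    assume "eq_ae \<psi> (\<lambda>_. 0)"
    \<comment> \<open>For the zero class even a = \<infinity> is admissible, so its edge would be
      infinite, whereas the edge computed next is a real number.\<close>
    then have "eq_ae (cutoff {x. ereal (x \<bullet> e) \<le> \<infinity>} \<psi>) (\<lambda>_. 0)"
      by (simp add: cutoff_def eq_ae_def)
    moreover have "edge e \<psi> = ereal (- L - 4 * norm1 e - \<bar>- t\<^sub>1\<bar>)"
      using L by (intro edge_two_waves[OF assms(3) _ assms(1,2) u(2) \<sigma>0 u(1)]) (auto simp: \<psi>_def eq_ae_def)
    moreover have "edge e \<psi> = \<infinity>"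
      unfolding edge_def by (rule Greatest_equality) (use calculation(1) in auto)
    ultimately show False by simp
  qed
  moreover have "\<exists>\<Delta>. bounded \<Delta> \<and> localized_in \<psi> \<Delta>"
  proof (intro exI conjI)
    let ?r = "3 * (\<bar>- t\<^sub>1\<bar> + 4) + 3 * (\<bar>- t\<^sub>2\<bar> + 4) + norm (L *\<^sub>R e)"
    show "bounded (cball (0 :: real^3) ?r)" by simp
    have "cutoff (cball 0 ?r) \<psi> x = \<psi> x" for x
      using two_waves_bounded_support[of "- t\<^sub>1" "- t\<^sub>2" "L *\<^sub>R e" x m \<alpha> \<beta> u]
      by (cases "norm x > ?r") (auto simp: cutoff_def \<psi>_def)
    then show "localized_in \<psi> (cball 0 ?r)" by (simp add: localized_in_def eq_ae_def)
  qed
  moreover have "edge_time m \<alpha> \<beta> e \<psi> = t\<^sub>1"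
    unfolding \<psi>_def by (rule edge_time_two_waves[OF assms(3) L(1) assms(1,2) u(2) \<sigma>0 u(1)])
  moreover have "edge_time m \<alpha> \<beta> (- e) \<psi> = t\<^sub>2"
    unfolding swap by (rule edge_time_two_waves[OF _ L(2) assms(1,2) u(2) \<sigma>0 u(1)]) (use assms(3) in simp)
  ultimately show ?thesis by blast
qed

end
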